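(* For any $\lambda\in(0,1/2)$ and $\alpha>0$ there exists a randomized algorithm that, except with probability at most $n^{-\alpha}$, finds an optimal solution to the Simple Noisy Signal Aggregation problem with parameter $\lambda$ (i.e. a permutation $\sigma$ of $[n]$ maximizing $s_q(\sigma)$) in time $n^{O((\alpha+1)\lambda^{-4})}$.
   Context: There are $n$ items $1,\dots,n$ and an unknown true order given by a permutation $\pi$ of $[n]$; write $a<_\pi b$ if $\pi(a)<\pi(b)$. For each unordered pair $\{a,b\}$ the algorithm receives a signal $s_{a,b}\in\{+,-\}$; conditioned on $\pi$ the signals are independent, and if $\pi(a)>\pi(b)$ then $s_{a,b}$ (oriented from $a$ to $b$) equals $+$ with probability $\frac12+\lambda$ and $-$ with probability $\frac12-\lambda$, while if $\pi(a)<\pi(b)$ then it equals $+$ with probability $\frac12-\lambda$ and $-$ with probability $\frac12+\lambda$. Writing ${\cal D}_{a<b}$, ${\cal D}_{b<a}$ for the signal distributions in the two cases, define $q(a<b)=\log\frac{{\cal D}_{a<b}(s_{a,b})}{{\cal D}_{b<a}(s_{a,b})}$ (so $q(b<a)=-q(a<b)$), and for a permutation $\sigma$ the score $s_q(\sigma)=\sum_{i,j:\ \sigma(i)<\sigma(j)} q(i<j)$. An optimal solution is a $\sigma$ maximizing $s_q(\sigma)$, equivalently a maximum likelihood permutation under a uniform prior. *)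

theory Defs
  imports "HOL-Probability.Probability" "HOL-Combinatorics.Permutations"
begin

section \<open>Noisy signals and optimal orders\<close>

text \<open>
  Items are \<open>1, \<dots>, n\<close>, and \<open>True\<close> encodes the sign \<open>+\<close>. An outcome of all signals assigns one
  sign to each unordered pair \<open>{a, b}\<close>, stored at the representative \<open>(a, b)\<close> with \<open>a < b\<close> and
  oriented from \<open>a\<close> to \<open>b\<close>. Reversing the orientation flips the sign.
\<close>

type_synonym signals = "nat \<times> nat \<Rightarrow> bool"

definition pairs :: "nat \<Rightarrow> (nat \<times> nat) set" where
  "pairs n = {(a, b). 1 \<le> a \<and> a < b \<and> b \<le> n}"

definition signal :: "signals \<Rightarrow> nat \<Rightarrow> nat \<Rightarrow> bool" where
  "signal s a b = (if a < b then s (a, b) else \<not> s (b, a))"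

text \<open>
  Laws of the signal oriented from \<open>a\<close> to \<open>b\<close>: \<open>D_before\<close> if \<open>a\<close> precedes \<open>b\<close> in the true order,
  \<open>D_after\<close> if \<open>b\<close> precedes \<open>a\<close>.
\<close>

definition D_before :: "real \<Rightarrow> bool pmf" where
  "D_before lam = bernoulli_pmf (1/2 - lam)"

definition D_after :: "real \<Rightarrow> bool pmf" where
  "D_after lam = bernoulli_pmf (1/2 + lam)"

definition signals_pmf :: "real \<Rightarrow> nat \<Rightarrow> (nat \<Rightarrow> nat) \<Rightarrow> signals pmf" where
  "signals_pmf lam n \<pi> =
     Pi_pmf (pairs n) False (\<lambda>(a, b). if \<pi> a < \<pi> b then D_before lam else D_after lam)"

definition q :: "real \<Rightarrow> signals \<Rightarrow> nat \<Rightarrow> nat \<Rightarrow> real" where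
  "q lam s a b = ln (pmf (D_before lam) (signal s a b) / pmf (D_after lam) (signal s a b))"

definition score :: "real \<Rightarrow> nat \<Rightarrow> signals \<Rightarrow> (nat \<Rightarrow> nat) \<Rightarrow> real" where
  "score lam n s \<sigma> =
     (\<Sum>(i, j) \<in> {(i, j). i \<in> {1..n} \<and> j \<in> {1..n} \<and> \<sigma> i < \<sigma> j}. q lam s i j)"

definition optimal :: "real \<Rightarrow> nat \<Rightarrow> signals \<Rightarrow> (nat \<Rightarrow> nat) \<Rightarrow> bool" where
  "optimal lam n s \<sigma> \<longleftrightarrow>
     \<sigma> permutes {1..n} \<and> (\<forall>\<tau>. \<tau> permutes {1..n} \<longrightarrow> score lam n s \<tau> \<le> score lam n s \<sigma>)"

lemma q_antisym:
  assumes "0 < lam" "lam < 1/2" "a \<noteq> b"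
  shows "q lam s b a = - q lam s a b"
proof -
  have "signal s b a = (\<not> signal s a b)"
    using assms by (auto simp: signal_def)
  then show ?thesis
    using assms by (cases "signal s a b") (auto simp: q_def D_before_def D_after_def ln_div)
qed

section \<open>Randomized algorithms\<close>

text \<open>
  The machine model is a randomized random-access machine, presented as a structured language.
  A state consists of registers and an addressable memory, both holding natural numbers; a program
  mentions finitely many registers, and reaches memory by indirect addressing. Every instruction and every control transfer costs one time
  unit. Addition and truncated subtraction are the only arithmetic operations: with unit-cost
  addition, but without unit-cost multiplication, running times agree with those of Turing machines
  up to a polynomial. The only source of randomness is a fair coin.
\<close>

type_synonym state = "(nat \<Rightarrow> nat) \<times> (nat \<Rightarrow> nat)"

datatype instr =
    Const nat nat
  | Add nat nat nat
  | Sub nat nat nat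
  | Load nat nat
  | Store nat nat
  | Coin nat

datatype com =
    Skip
  | Instr instr
  | Seq com com
  | If nat com com
  | While nat com

primrec exec :: "instr \<Rightarrow> state \<Rightarrow> state pmf" where
  "exec (Const x k) st = (case st of (r, m) \<Rightarrow> return_pmf (r(x := k), m))"
| "exec (Add x y z) st = (case st of (r, m) \<Rightarrow> return_pmf (r(x := r y + r z), m))"
| "exec (Sub x y z) st = (case st of (r, m) \<Rightarrow> return_pmf (r(x := r y - r z), m))"
| "exec (Load x y) st = (case st of (r, m) \<Rightarrow> return_pmf (r(x := m (r y)), m))"
| "exec (Store x y) st = (case st of (r, m) \<Rightarrow> return_pmf (r, m(r x := r y)))"
| "exec (Coin x) st =
     (case st of (r, m) \<Rightarrow> map_pmf (\<lambda>b. (r(x := of_bool b), m)) (bernoulli_pmf (1/2)))"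

text \<open>Small steps; conditionals and loops test whether a register is nonzero.\<close>

primrec step :: "com \<Rightarrow> state \<Rightarrow> (com \<times> state) pmf" where
  "step Skip st = return_pmf (Skip, st)"
| "step (Instr i) st = map_pmf (Pair Skip) (exec i st)"
| "step (Seq c d) st =
     (if c = Skip then return_pmf (d, st)
      else map_pmf (\<lambda>(c', st'). (Seq c' d, st')) (step c st))"
| "step (If x c d) st = return_pmf (if fst st x \<noteq> 0 then c else d, st)"
| "step (While x c) st = return_pmf (if fst st x \<noteq> 0 then Seq c (While x c) else Skip, st)"

primrec run :: "nat \<Rightarrow> com \<times> state \<Rightarrow> (com \<times> state) pmf" where
  "run 0 cfg = return_pmf cfg"
| "run (Suc t) cfg = bind_pmf (step (fst cfg) (snd cfg)) (run t)"

lemma run_Skip: "run t (Skip, st) = return_pmf (Skip, st)"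
  by (induction t) (auto simp: bind_return_pmf)

text \<open>
  On input, register 0 holds \<open>n\<close> and, for distinct \<open>a, b\<close> in \<open>{1..n}\<close>, memory cell \<open>a * n + b\<close>
  holds 1 if the signal oriented from \<open>a\<close> to \<open>b\<close> is \<open>+\<close>; everything else is 0. On output, cell \<open>i\<close>
  holds \<open>\<sigma> i\<close> for \<open>i\<close> in \<open>{1..n}\<close>.
\<close>

definition input_memory :: "nat \<Rightarrow> signals \<Rightarrow> nat \<Rightarrow> nat" where
  "input_memory n s k =
     (let a = (k - 1) div n; b = (k - 1) mod n + 1
      in of_bool (1 \<le> a \<and> a \<le> n \<and> a \<noteq> b \<and> signal s a b))"

definition input_state :: "nat \<Rightarrow> signals \<Rightarrow> state" where
  "input_state n s = ((\<lambda>_. 0)(0 := n), input_memory n s)"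

definition output_perm :: "nat \<Rightarrow> state \<Rightarrow> nat \<Rightarrow> nat" where
  "output_perm n st i = (if i \<in> {1..n} then snd st i else i)"

lemma input_memory_cell:
  assumes "a \<in> {1..n}" "b \<in> {1..n}"
  shows "input_memory n s (a * n + b) = of_bool (a \<noteq> b \<and> signal s a b)"
proof -
  have "a * n + b - 1 = (b - 1) + a * n" "b - 1 < n"
    using assms by auto
  then have "(a * n + b - 1) div n = a" "(a * n + b - 1) mod n = b - 1"
    by auto
  then show ?thesis
    using assms by (simp add: input_memory_def Let_def)
qed

text \<open>Worst case over all signals and all coin flips.\<close>

definition halts_within :: "nat \<Rightarrow> com \<Rightarrow> nat \<Rightarrow> bool" where
  "halts_within t c n \<longleftrightarrow>
     (\<forall>s. \<forall>cfg \<in> set_pmf (run t (c, input_state n s)). fst cfg = Skip)"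

text \<open>Joint law of the signals and of the permutation left in memory after \<open>t\<close> steps.\<close>

definition run_outcome ::
    "real \<Rightarrow> nat \<Rightarrow> (nat \<Rightarrow> nat) \<Rightarrow> com \<Rightarrow> nat \<Rightarrow> (signals \<times> (nat \<Rightarrow> nat)) pmf" where
  "run_outcome lam n \<pi> c t =
     bind_pmf (signals_pmf lam n \<pi>) (\<lambda>s.
       map_pmf (\<lambda>cfg. (s, output_perm n (snd cfg))) (run t (c, input_state n s)))"

end

theory Submission
  imports Defs
begin

text \<open>
  The algorithm is deterministic. It inserts the items one at a time and maintains an order of
  \<open>{1..k}\<close> with the fewest disagreeing signals. An optimal order puts every item within
  \<open>K = O((alpha + 1) * lam ^ -4 * ln n)\<close> of its true position, for every \<open>k\<close> at once, outside an
  event of probability at most \<open>n powr - alpha\<close>. Hence the optimal orders of \<open>{1..k}\<close> and of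
  \<open>{1..k + 1}\<close>, the latter without the new item, differ by displacements of at most \<open>2 K + 1\<close>, and
  a dynamic program over the prefix sets compatible with such displacements, of which there are
  \<open>n * 2 powr O(K)\<close>, finds the next optimal order.

  For the displacement bound, let \<open>M\<close> be the largest number of items that cross a cut
  of the order, and write \<open>h = O((alpha + 1) * lam ^ -2 * ln n)\<close>. An item displaced by
  \<open>d \<ge> h\<close> could be moved back past \<open>d\<close> items, which form the corresponding interval of the true order
  up to \<open>2 M\<close> exceptions; since its signals against every long interval of the true order are typical,
  \<open>d < 4 M / lam\<close>. So the \<open>M\<close> pairs of items crossing the worst cut lie in a block of length
  \<open>O(h + M / lam)\<close>. A union bound over all sequences of items shows that a block of length \<open>m\<close> of
  an optimal order has at most \<open>h m\<close> inversions, whence \<open>M\<^sup>2 = O(h * (h + M / lam))\<close>. This gives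
  \<open>M = O(h / lam)\<close> and \<open>K = O(h / lam\<^sup>2)\<close>.
\<close>

section \<open>Execution of coin-free programs\<close>

text \<open>The optimal order depends on all signals, so no concentration bound applies to it
  directly. Hence \<open>typical\<close> is demanded in advance for families that only
  \<open>\<pi>\<close> determines. There are up to \<open>n ^ m\<close> sequences of length
  \<open>m\<close>, and a failure probability below \<open>n powr - m\<close> for each is available
  only if it has more than \<open>h * m\<close> inversions. This fixes the unit \<open>h\<close>,
  and it is why the crossing items must be confined to a short block: only there do
  \<open>M * M\<close> inversions stand against a small length. The displacement bound is circular
  at first sight: displacements are bounded by \<open>M\<close>, and \<open>M\<close> by the length
  of a block that contains displaced items. The circle closes because \<open>M\<close> enters
  linearly on one side and squared on the other. Every intermediate order has to be optimal, not
  only the last one: the window around the old order is known to contain the next optimum only if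
  the old order is itself near the true order. Typicality is never tested. Whatever the signals are,
  the program halts in time with a permutation; only optimality can fail. \<open>lam\<close> and
  \<open>alpha\<close> reach it through one constant, the factor \<open>c\<close> in the window
  width.\<close>

inductive det_steps :: "nat \<Rightarrow> com \<times> state \<Rightarrow> com \<times> state \<Rightarrow> bool" where
  det_refl: "det_steps 0 cfg cfg"
| det_step: "c \<noteq> Skip \<Longrightarrow> step c st = return_pmf cfg \<Longrightarrow> det_steps t cfg cfg' \<Longrightarrow>
    det_steps (Suc t) (c, st) cfg'"

lemma det_steps_trans:
  "det_steps t cfg cfg' \<Longrightarrow> det_steps u cfg' cfg'' \<Longrightarrow> det_steps (t + u) cfg cfg''"
  by (induction rule: det_steps.induct) (auto intro: det_step)

text \<open>Lifting works because \<open>det_steps\<close> never counts an idle step of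
  \<open>Skip\<close>: in \<open>Seq Skip d\<close> the next step already hands control to
  \<open>d\<close>.\<close>

lemma det_steps_Seq:
  "det_steps t cfg cfg' \<Longrightarrow>
    det_steps t (Seq (fst cfg) d, snd cfg) (Seq (fst cfg') d, snd cfg')"
  by (induction rule: det_steps.induct)
    (auto intro!: det_refl det_step simp: map_pmf_def bind_return_pmf split: prod.split)

lemma run_det_steps: "det_steps t cfg cfg' \<Longrightarrow> run (t + u) cfg = run u cfg'"
  by (induction rule: det_steps.induct) (auto simp: bind_return_pmf)

text \<open>The extra units in \<open>big_Seq\<close> and \<open>big_While_True\<close> pay for the
  step from \<open>Seq Skip d\<close> to \<open>d\<close>. The point distribution in
  \<open>big_Instr\<close> excludes \<open>Coin\<close>.\<close>

inductive big :: "com \<Rightarrow> state \<Rightarrow> nat \<Rightarrow> state \<Rightarrow> bool" where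
  big_Skip: "big Skip st 0 st"
| big_Instr: "exec i st = return_pmf st' \<Longrightarrow> big (Instr i) st 1 st'"
| big_Seq: "big c st t st' \<Longrightarrow> big d st' u st'' \<Longrightarrow> big (Seq c d) st (t + 1 + u) st''"
| big_If: "big (if fst st x \<noteq> 0 then c else d) st t st' \<Longrightarrow> big (If x c d) st (1 + t) st'"
| big_While_True: "fst st x \<noteq> 0 \<Longrightarrow> big c st t st' \<Longrightarrow> big (While x c) st' u st'' \<Longrightarrow>
    big (While x c) st (1 + t + 1 + u) st''"
| big_While_False: "fst st x = 0 \<Longrightarrow> big (While x c) st 1 st"

inductive_cases big_SkipE: "big Skip st t st'"
inductive_cases big_InstrE: "big (Instr i) st t st'"
inductive_cases big_SeqE: "big (Seq c d) st t st'"
inductive_cases big_IfE: "big (If x c d) st t st'"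

lemma det_steps_big: "big c st t st' \<Longrightarrow> det_steps t (c, st) (Skip, st')"
proof (induction rule: big.induct)
  case (big_Skip st)
  show ?case by (rule det_refl)
next
  case (big_Instr i st st')
  then show ?case
    using det_step[of "Instr i" st "(Skip, st')" 0, OF _ _ det_refl] by simp
next
  case (big_Seq c st t st' d u st'')
  have "det_steps (Suc u) (Seq Skip d, st') (Skip, st'')"
    using big_Seq by (auto intro: det_step)
  with det_steps_Seq[OF big_Seq.IH(1), of d] show ?case
    using det_steps_trans by fastforce
next
  case (big_If st x c d t st')
  then show ?case by (auto intro: det_step)
next
  case (big_While_True st x c t st' u st'')
  have "det_steps (Suc u) (Seq Skip (While x c), st') (Skip, st'')"
    using big_While_True by (auto intro: det_step)
  then have "det_steps (t + Suc u) (Seq c (While x c), st) (Skip, st'')"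
    using det_steps_trans det_steps_Seq[OF big_While_True.IH(1), of "While x c"] by fastforce
  then show ?case
    using big_While_True.hyps by (auto intro: det_step)
next
  case (big_While_False st x c)
  then show ?case
    using det_step[of "While x c" st "(Skip, st)" 0, OF _ _ det_refl] by simp
qed

text \<open>A finished run idles in \<open>Skip\<close>, so one bound \<open>T\<close> serves all
  inputs, whatever their exact running times.\<close>

lemma run_big: "big c st t st' \<Longrightarrow> t \<le> T \<Longrightarrow> run T (c, st) = return_pmf (Skip, st')"
  using run_det_steps[OF det_steps_big, of c st t st' "T - t"] by (simp add: run_Skip)

text \<open>The third argument of the postcondition is the elapsed time.\<close>

definition wp ::
    "com \<Rightarrow> ((nat \<Rightarrow> nat) \<Rightarrow> (nat \<Rightarrow> nat) \<Rightarrow> nat \<Rightarrow> bool) \<Rightarrow> (nat \<Rightarrow> nat) \<Rightarrow> (nat \<Rightarrow> nat) \<Rightarrow> nat \<Rightarrow> bool"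
  where "wp c Q r m \<tau> \<longleftrightarrow> (\<exists>t st. big c (r, m) t st \<and> Q (fst st) (snd st) (\<tau> + t))"

lemma wp_Skip [simp]: "wp Skip Q r m \<tau> = Q r m \<tau>"
  by (force simp: wp_def elim: big_SkipE intro: big_Skip)

lemma wp_Instr: "wp (Instr i) Q r m \<tau> \<longleftrightarrow>
    (\<exists>st. exec i (r, m) = return_pmf st \<and> Q (fst st) (snd st) (Suc \<tau>))"
  unfolding wp_def by (force elim: big_InstrE intro: big_Instr[unfolded One_nat_def])

lemma wp_Const [simp]: "wp (Instr (Const x k)) Q r m \<tau> = Q (r(x := k)) m (Suc \<tau>)"
  and wp_Add [simp]: "wp (Instr (Add x y z)) Q r m \<tau> = Q (r(x := r y + r z)) m (Suc \<tau>)"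
  and wp_Sub [simp]: "wp (Instr (Sub x y z)) Q r m \<tau> = Q (r(x := r y - r z)) m (Suc \<tau>)"
  and wp_Load [simp]: "wp (Instr (Load x y)) Q r m \<tau> = Q (r(x := m (r y))) m (Suc \<tau>)"
  and wp_Store [simp]: "wp (Instr (Store x y)) Q r m \<tau> = Q r (m(r x := r y)) (Suc \<tau>)"
  by (auto simp: wp_Instr)

lemma wp_Seq [simp]: "wp (Seq c d) Q r m \<tau> = wp c (\<lambda>r m \<tau>. wp d Q r m (Suc \<tau>)) r m \<tau>"
proof
  assume "wp (Seq c d) Q r m \<tau>"
  then obtain t st where *: "big (Seq c d) (r, m) t st" "Q (fst st) (snd st) (\<tau> + t)"
    unfolding wp_def by auto
  from *(1) obtain t1 st1 t2 where "big c (r, m) t1 st1" "big d st1 t2 st" "t = t1 + 1 + t2"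
    by (rule big_SeqE) auto
  with *(2) show "wp c (\<lambda>r m \<tau>. wp d Q r m (Suc \<tau>)) r m \<tau>"
    unfolding wp_def
    by (intro exI[of _ t1] exI[of _ st1] conjI exI[of _ t2] exI[of _ st]) (auto simp: ac_simps)
next
  assume "wp c (\<lambda>r m \<tau>. wp d Q r m (Suc \<tau>)) r m \<tau>"
  then obtain t st u st' where *: "big c (r, m) t st" "big d st u st'"
      "Q (fst st') (snd st') (Suc (\<tau> + t) + u)"
    unfolding wp_def by auto
  from big_Seq[OF *(1,2)] *(3) show "wp (Seq c d) Q r m \<tau>"
    unfolding wp_def by (intro exI[of _ "t + 1 + u"] exI[of _ st']) (auto simp: ac_simps)
qed

lemma wp_If [simp]:
  "wp (If x c d) Q r m \<tau> = (if r x \<noteq> 0 then wp c Q r m (Suc \<tau>) else wp d Q r m (Suc \<tau>))"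
proof -
  have "wp (If x c d) Q r m \<tau> = wp (if r x \<noteq> 0 then c else d) Q r m (Suc \<tau>)"
  proof
    assume "wp (If x c d) Q r m \<tau>"
    then obtain t st where *: "big (If x c d) (r, m) t st" "Q (fst st) (snd st) (\<tau> + t)"
      unfolding wp_def by auto
    from *(1) obtain u where "big (if r x \<noteq> 0 then c else d) (r, m) u st" "t = 1 + u"
      by (rule big_IfE) auto
    with *(2) show "wp (if r x \<noteq> 0 then c else d) Q r m (Suc \<tau>)"
      unfolding wp_def by (intro exI[of _ u] exI[of _ st]) auto
  next
    assume "wp (if r x \<noteq> 0 then c else d) Q r m (Suc \<tau>)"
    then obtain t st where *: "big (if fst (r, m) x \<noteq> 0 then c else d) (r, m) t st"
        "Q (fst st) (snd st) (Suc \<tau> + t)"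
      unfolding wp_def by auto
    from big_If[OF *(1)] *(2) show "wp (If x c d) Q r m \<tau>"
      unfolding wp_def by (intro exI[of _ "1 + t"] exI[of _ st]) auto
  qed
  then show ?thesis by auto
qed

lemma wp_mono:
  "wp c Q r m \<tau> \<Longrightarrow> (\<And>r' m' \<tau>'. Q r' m' \<tau>' \<Longrightarrow> Q' r' m' \<tau>') \<Longrightarrow> wp c Q' r m \<tau>"
  unfolding wp_def by blast

lemma wp_While_True:
  assumes "r x \<noteq> 0" "wp c (\<lambda>r m \<tau>. wp (While x c) Q r m (Suc \<tau>)) r m (Suc \<tau>)"
  shows "wp (While x c) Q r m \<tau>"
proof -
  obtain t st u st' where *: "big c (r, m) t st" "big (While x c) st u st'"
      "Q (fst st') (snd st') (Suc (Suc \<tau> + t) + u)"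
    using assms(2) unfolding wp_def by auto
  have "big (While x c) (r, m) (1 + t + 1 + u) st'"
    using assms(1) by (intro big_While_True[OF _ *(1,2)]) auto
  with *(3) show ?thesis
    unfolding wp_def by (intro exI[of _ "1 + t + 1 + u"] exI[of _ st']) (auto simp: ac_simps)
qed

lemma wp_While_False: "r x = 0 \<Longrightarrow> Q r m (Suc \<tau>) \<Longrightarrow> wp (While x c) Q r m \<tau>"
  unfolding wp_def by (intro exI[of _ 1] exI[of _ "(r, m)"]) (auto intro: big_While_False[unfolded One_nat_def])

section \<open>Counting loops and their cost\<close>

abbreviation (input) rOne :: nat where "rOne \<equiv> 2"

text \<open>Decrementing before the body lets the body see \<open>N - 1\<close> down to
  \<open>0\<close>, which are the positions themselves.\<close>

definition countdown :: "nat \<Rightarrow> com \<Rightarrow> com" where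
  "countdown i c = While i (Seq (Instr (Sub i i rOne)) c)"

text \<open>\<open>I j\<close> describes the state with \<open>j\<close> rounds left. A round costs
  4 beyond its body: the test, the decrement and two control transfers of \<open>Seq\<close>; the
  final test costs 1.\<close>

lemma wp_countdown:
  assumes "r i = N" "I N r m"
    and one: "\<And>j r m. I j r m \<Longrightarrow> r rOne = 1"
    and body: "\<And>j r m \<tau>. j < N \<Longrightarrow> I (Suc j) r m \<Longrightarrow> r i = Suc j \<Longrightarrow>
      wp c (\<lambda>r' m' \<tau>'. r' i = j \<and> I j r' m' \<and> \<tau>' \<le> \<tau> + B) (r(i := j)) m \<tau>"
    and post: "\<And>r' m' \<tau>'. r' i = 0 \<Longrightarrow> I 0 r' m' \<Longrightarrow> \<tau>' \<le> \<tau> + N * (B + 4) + 1 \<Longrightarrow> Q r' m' \<tau>'"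
  shows "wp (countdown i c) Q r m \<tau>"
proof -
  have "wp (countdown i c) Q r m \<tau>'"
    if "r i = j" "I j r m" "j \<le> N" "\<tau>' + j * (B + 4) \<le> \<tau> + N * (B + 4)" for j r m \<tau>'
    using that
  proof (induction j arbitrary: r m \<tau>')
    case 0
    then show ?case
      unfolding countdown_def by (intro wp_While_False post) auto
  next
    case (Suc j)
    have "wp c (\<lambda>r m \<tau>. wp (countdown i c) Q r m (Suc \<tau>)) (r(i := j)) m (Suc (Suc (Suc \<tau>')))"
      using Suc.prems
      by (intro wp_mono[OF body[of j r m "Suc (Suc (Suc \<tau>'))"]] Suc.IH) auto
    then show ?case
      unfolding countdown_def using Suc.prems one[OF Suc.prems(2)]
      by (intro wp_While_True) (auto simp: countdown_def)
  qed
  then show ?thesis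
    using assms(1,2) by auto
qed

section \<open>Dynamic programming over sets of positions\<close>

text \<open>\<open>w x y\<close> is the price of placing \<open>x\<close> before \<open>y\<close>.
  With \<open>w = win s\<close> the total counts the signals that the order contradicts.\<close>

primrec lcost :: "('a \<Rightarrow> 'a \<Rightarrow> nat) \<Rightarrow> 'a list \<Rightarrow> nat" where
  "lcost w [] = 0"
| "lcost w (x # xs) = (\<Sum>y\<leftarrow>xs. w x y) + lcost w xs"

lemma lcost_append:
  "lcost w (xs @ ys) = lcost w xs + lcost w ys + (\<Sum>x\<leftarrow>xs. \<Sum>y\<leftarrow>ys. w x y)"
  by (induction xs) auto

lemma lcost_snoc: "lcost w (xs @ [x]) = lcost w xs + (\<Sum>y\<leftarrow>xs. w y x)"
  by (simp add: lcost_append)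

lemma lcost_map: "lcost w (map g xs) = lcost (\<lambda>x y. w (g x) (g y)) xs"
  by (induction xs) (simp_all add: comp_def)

section \<open>Position sets as bit masks, which serve as table addresses\<close>

definition code :: "nat set \<Rightarrow> nat" where
  "code X = (\<Sum>x\<in>X. 2 ^ x)"

lemma bit_code: "finite X \<Longrightarrow> bit (code X) y \<longleftrightarrow> y \<in> X"
proof (induction X arbitrary: y rule: finite_induct)
  case (insert x X)
  have "code (insert x X) = 2 ^ x + code X"
    using insert by (simp add: code_def)
  also have "\<dots> = Bit_Operations.or (2 ^ x) (code X)"
    using insert by (intro disjunctive_add) (auto simp: bit_exp_iff)
  finally show ?case
    using insert by (auto simp: bit_or_iff bit_exp_iff)
qed (simp add: code_def)

lemma code_empty [simp]: "code {} = 0"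
  by (simp add: code_def)

lemma code_insert: "finite X \<Longrightarrow> x \<notin> X \<Longrightarrow> code (insert x X) = 2 ^ x + code X"
  by (simp add: code_def)

lemma code_lessThan: "code {..<k} = 2 ^ k - 1"
  by (induction k) (auto simp: lessThan_Suc code_insert)

lemma code_less:
  assumes "X \<subseteq> {..<k}"
  shows "code X < 2 ^ k"
proof -
  have "code X \<le> code {..<k}"
    unfolding code_def using assms by (intro sum_mono2) auto
  then show ?thesis
    using zero_less_power[of "2::nat" k] unfolding code_lessThan by linarith
qed

lemma bit_less_exp: "S < 2 ^ k \<Longrightarrow> bit S j \<Longrightarrow> j < (k::nat)" for S :: nat
  using bit_take_bit_iff[of k S j] by (simp add: take_bit_nat_eq_self)

lemma finite_bits: "finite {j. bit (S::nat) j}"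
proof -
  have "{j. bit S j} \<subseteq> {..<S}"
    using bit_less_exp[OF less_exp[of S]] by auto
  then show ?thesis
    by (rule finite_subset) simp
qed

lemma code_bits: "code {j. bit S j} = S"
  by (rule bit_eqI) (simp add: bit_code finite_bits)

text \<open>The machine has no bit test. In a scan from the top, the remainder
  \<open>S mod 2 ^ Suc j\<close> shows bit \<open>j\<close> by a comparison with
  \<open>2 ^ j\<close>, and subtracting that power leaves the next remainder.\<close>

lemma mod_exp_Suc:
  fixes S :: nat
  shows "S mod 2 ^ Suc j = (if bit S j then 2 ^ j else 0) + S mod 2 ^ j"
  using take_bit_Suc_from_most[of j S] by (auto simp: take_bit_eq_mod)

lemma exp_le_mod_exp_Suc: "(2::nat) ^ j \<le> S mod 2 ^ Suc j \<longleftrightarrow> bit S j"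
proof -
  have "S mod 2 ^ j < 2 ^ j"
    by simp
  then show ?thesis
    unfolding mod_exp_Suc by (cases "bit S j") (simp_all add: not_le)
qed

lemma bit_exp_le: "bit S x \<Longrightarrow> 2 ^ x \<le> (S::nat)"
  using exp_le_mod_exp_Suc[of x S] mod_less_eq_dividend[of S "2 ^ Suc x"] by linarith

lemma bit_diff_exp: "bit S x \<Longrightarrow> bit (S - 2 ^ x) y \<longleftrightarrow> bit (S::nat) y \<and> y \<noteq> x"
proof -
  assume *: "bit S x"
  let ?X = "{j. bit S j}"
  have "S = code (insert x (?X - {x}))"
    using * code_bits[of S] by (simp add: insert_absorb)
  also have "\<dots> = 2 ^ x + code (?X - {x})"
    by (rule code_insert) (auto simp: finite_bits)
  finally have "S - 2 ^ x = code (?X - {x})"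
    by simp
  then show ?thesis
    by (simp add: bit_code finite_bits)
qed

text \<open>The price of placing \<open>x\<close> after the rest of mask \<open>S\<close>; the
  summand \<open>y = x\<close> is harmless because the weights in use vanish on the
  diagonal.\<close>

definition add_cost :: "nat \<Rightarrow> (nat \<Rightarrow> nat \<Rightarrow> nat) \<Rightarrow> nat \<Rightarrow> nat \<Rightarrow> nat" where
  "add_cost k w S x = (\<Sum>y | y < k \<and> bit S y. w y x)"

lemma add_cost_diff:
  assumes "bit S x" "x < k"
  shows "add_cost k w S z = w x z + add_cost k w (S - 2 ^ x) z"
proof -
  have "{y. y < k \<and> bit S y} = insert x {y. y < k \<and> bit (S - 2 ^ x) y}"
    using assms by (auto simp: bit_diff_exp)
  then show ?thesis
    unfolding add_cost_def by (simp add: bit_diff_exp[OF assms(1)])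
qed

lemma add_cost_code:
  assumes "distinct zs" "set zs \<subseteq> {..<k}"
  shows "add_cost k w (code (set zs)) x = (\<Sum>y\<leftarrow>zs. w y x)"
proof -
  have "{y. y < k \<and> bit (code (set zs)) y} = set zs"
    using assms by (auto simp: bit_code)
  then show ?thesis
    unfolding add_cost_def using assms by (simp add: sum_list_distinct_conv_sum_set)
qed

text \<open>
  A value \<open>v S = c + 1\<close> records that some order of the positions in \<open>S\<close> has cost at most \<open>c\<close>,
  with last position \<open>ch S\<close>; the value \<open>0\<close> means that no order has been found.
\<close>

definition sound :: "nat \<Rightarrow> (nat \<Rightarrow> nat \<Rightarrow> nat) \<Rightarrow> (nat \<Rightarrow> nat) \<Rightarrow> (nat \<Rightarrow> nat) \<Rightarrow> bool" where
  "sound k w v ch \<longleftrightarrow> v 0 = 1 \<and>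
     (\<forall>S. 0 < S \<longrightarrow> S < 2 ^ k \<longrightarrow> v S \<noteq> 0 \<longrightarrow>
        ch S < k \<and> bit S (ch S) \<and> v (S - 2 ^ ch S) \<noteq> 0 \<and>
        v (S - 2 ^ ch S) + add_cost k w S (ch S) \<le> v S)"

lemma sound_cong:
  assumes "sound k w v ch" "\<And>S. S < 2 ^ k \<Longrightarrow> ch' S = ch S"
  shows "sound k w v ch'"
  using assms unfolding sound_def by simp

text \<open>The order on table values in which \<open>0\<close> stands for infinity.\<close>

definition better :: "nat \<Rightarrow> nat \<Rightarrow> bool" where
  "better a b \<longleftrightarrow> (b \<noteq> 0 \<longrightarrow> a \<noteq> 0 \<and> a \<le> b)"

lemma better_refl [simp]: "better a a"
  by (simp add: better_def)

lemma better_trans: "better a b \<Longrightarrow> better b c \<Longrightarrow> better a c"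
  by (auto simp: better_def)

lemma bit_less_mono: "bit S x \<Longrightarrow> S - 2 ^ x < (S::nat)"
  using bit_exp_le[of S x] zero_less_power[of "2::nat" x] by linarith

text \<open>\<open>sound\<close> asks for an inequality because lowering the entry at
  \<open>S\<close> leaves the entries of larger sets derived from it unchanged: they remain upper
  bounds.\<close>

lemma sound_update:
  assumes "sound k w v ch" "x < k" "bit S x" "v (S - 2 ^ x) \<noteq> 0"
    "v S \<noteq> 0 \<longrightarrow> v (S - 2 ^ x) + add_cost k w S x \<le> v S"
  shows "sound k w (v(S := v (S - 2 ^ x) + add_cost k w S x)) (ch(S := x))" (is "sound k w ?v ?ch")
  unfolding sound_def
proof (intro conjI allI impI)
  have less: "S - 2 ^ x < S"
    by (rule bit_less_mono) fact
  then show "?v 0 = 1"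
    using assms(1) by (auto simp: sound_def)
  fix S' assume S': "0 < S'" "S' < 2 ^ k" "?v S' \<noteq> 0"
  have better: "better (?v S'') (v S'')" for S''
    using assms(4,5) by (auto simp: better_def)
  have "?ch S' < k \<and> bit S' (?ch S') \<and> v (S' - 2 ^ ?ch S') \<noteq> 0 \<and>
      v (S' - 2 ^ ?ch S') + add_cost k w S' (?ch S') \<le> ?v S'"
    using assms S' unfolding sound_def by auto
  with better[of "S' - 2 ^ ?ch S'"]
  show "?ch S' < k" "bit S' (?ch S')" "?v (S' - 2 ^ ?ch S') \<noteq> 0"
      "?v (S' - 2 ^ ?ch S') + add_cost k w S' (?ch S') \<le> ?v S'"
    by (auto simp: better_def simp del: fun_upd_apply)
qed

text \<open>
  Position \<open>k - 1\<close> carries the item being inserted, whose place is unknown; it is exempt from the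
  window.
\<close>

definition windowed :: "nat \<Rightarrow> nat \<Rightarrow> nat \<Rightarrow> nat set \<Rightarrow> bool" where
  "windowed k D p X \<longleftrightarrow> {..<p - D} \<subseteq> X \<and> X \<subseteq> {..<p - D + 2 * D} \<union> {k - 1}"

definition windowed_list :: "nat \<Rightarrow> nat \<Rightarrow> nat list \<Rightarrow> bool" where
  "windowed_list k D zs \<longleftrightarrow> distinct zs \<and> set zs = {..<k} \<and>
     (\<forall>p \<le> k. windowed k D p (set (take p zs)))"

text \<open>Without the top position, the mask consists of ones below \<open>p - D\<close> followed
  by an arbitrary word \<open>T\<close>. Since the window ends at \<open>p - D + 2 * D\<close> with
  truncated subtraction, \<open>T\<close> has \<open>2 * D\<close> bits even when
  \<open>p < D\<close>. The second bound is the test by which \<open>visit\<close> skips masks that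
  reach beyond the old items.\<close>

lemma windowed_code:
  assumes X: "windowed k D p X" "X \<subseteq> {..<k}" and "p \<le> k" "0 < k" "0 < D"
  obtains T where "T < 2 ^ (2 * D)" "2 ^ (p - D) - 1 + 2 ^ (p - D) * T < 2 ^ (k - 1)"
    "code X = 2 ^ (p - D) - 1 + 2 ^ (p - D) * T \<or>
     code X = 2 ^ (p - D) - 1 + 2 ^ (p - D) * T + 2 ^ (k - 1)"
proof -
  define t where "t = p - D"
  have t: "t \<le> k - 1"
    using assms by (auto simp: t_def)
  define Y where "Y = X - {k - 1}"
  have fin: "finite X" "finite Y"
    using X(2) finite_subset by (auto simp: Y_def)
  have Y: "{..<t} \<subseteq> Y" "Y \<subseteq> {..<t + 2 * D}" "Y \<subseteq> {..<k - 1}"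
    using X t unfolding Y_def windowed_def t_def[symmetric] by fastforce+
  define Z where "Z = (\<lambda>y. y - t) ` (Y - {..<t})"
  have inj: "inj_on (\<lambda>y. y - t) (Y - {..<t})"
    by (auto simp: inj_on_def)
  have "code Y = code {..<t} + code (Y - {..<t})"
    unfolding code_def using sum.subset_diff[OF Y(1) fin(2), of "(^) (2::nat)"] by simp
  also have "code (Y - {..<t}) = 2 ^ t * code Z"
    unfolding code_def Z_def sum_distrib_left sum.reindex[OF inj]
    by (intro sum.cong) (auto simp: simp flip: power_add)
  finally have code_Y: "code Y = 2 ^ t - 1 + 2 ^ t * code Z"
    by (simp add: code_lessThan)
  have "Z \<subseteq> {..<2 * D}"
    using Y by (auto simp: Z_def)
  then have "code Z < 2 ^ (2 * D)"
    by (rule code_less)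
  moreover have "code Y < 2 ^ (k - 1)"
    by (rule code_less) fact
  moreover have "code X = code Y \<or> code X = code Y + 2 ^ (k - 1)"
  proof (cases "k - 1 \<in> X")
    case True
    then have "X = insert (k - 1) Y"
      by (auto simp: Y_def)
    then show ?thesis
      using code_insert[OF fin(2), of "k - 1"] by (auto simp: Y_def)
  next
    case False
    then show ?thesis by (simp add: Y_def)
  qed
  ultimately show ?thesis
    using that[of "code Z"] by (simp add: code_Y t_def)
qed

text \<open>The counterpart of \<open>sound\<close>: there a value is at least the cost of some
  actual order, here it is at most the cost of every windowed one.\<close>

definition reached :: "nat \<Rightarrow> nat \<Rightarrow> (nat \<Rightarrow> nat \<Rightarrow> nat) \<Rightarrow> nat \<Rightarrow> (nat \<Rightarrow> nat) \<Rightarrow> bool" where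
  "reached k D w p v \<longleftrightarrow> (\<forall>zs. windowed_list k D zs \<longrightarrow>
     better (v (code (set (take p zs)))) (Suc (lcost w (take p zs))))"

lemma reached_0: "sound k w v ch \<Longrightarrow> reached k D w 0 v"
  by (simp add: reached_def sound_def)

text \<open>A level overwrites the table in place, so the new entries are compared with the values
  \<open>v\<close> before the level. Relaxing the sets in the window suffices, as prefixes of
  windowed lists are such sets.\<close>

lemma reached_Suc:
  assumes "reached k D w p v" "p < k" "\<And>S. better (v' S) (v S)"
    "\<And>X x. windowed k D (Suc p) X \<Longrightarrow> X \<subseteq> {..<k} \<Longrightarrow> x \<in> X \<Longrightarrow> v (code X - 2 ^ x) \<noteq> 0 \<Longrightarrow>
       better (v' (code X)) (v (code X - 2 ^ x) + add_cost k w (code X) x)"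
    and diag: "\<And>x. w x x = 0"
  shows "reached k D w (Suc p) v'"
  unfolding reached_def
proof (intro allI impI)
  fix zs assume zs: "windowed_list k D zs"
  then have len: "length zs = k"
    unfolding windowed_list_def using distinct_card[of zs] by auto
  let ?X = "set (take (Suc p) zs)" and ?Y = "set (take p zs)" and ?x = "zs ! p"
  have take: "take (Suc p) zs = take p zs @ [?x]"
    using len assms(2) by (simp add: take_Suc_conv_app_nth)
  have d: "distinct (take (Suc p) zs)"
    using zs by (simp add: windowed_list_def)
  have X: "?X = insert ?x ?Y" "?x \<notin> ?Y"
    using d unfolding take by auto
  have code: "code ?X = 2 ^ ?x + code ?Y"
    unfolding X(1) by (rule code_insert) (use X(2) in auto)
  have sub: "?X \<subseteq> {..<k}"
    using zs set_take_subset[of "Suc p" zs] by (auto simp: windowed_list_def)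
  have 1: "better (v (code ?Y)) (Suc (lcost w (take p zs)))"
    using assms(1) zs by (auto simp: reached_def)
  have "better (v' (code ?X)) (v (code ?Y) + add_cost k w (code ?X) ?x)"
  proof (cases "v (code ?Y) = 0")
    case True
    then show ?thesis
      using 1 by (auto simp: better_def)
  next
    case False
    have "windowed k D (Suc p) ?X"
      using zs assms(2) unfolding windowed_list_def by (meson Suc_leI)
    then show ?thesis
      using assms(4)[of ?X ?x] False sub X(1) code by simp
  qed
  moreover have "add_cost k w (code ?X) ?x = (\<Sum>y\<leftarrow>take p zs. w y ?x)"
    using add_cost_code[OF d sub, of w ?x] diag by (simp add: take)
  moreover have "lcost w (take (Suc p) zs) = lcost w (take p zs) + (\<Sum>y\<leftarrow>take p zs. w y ?x)"
    by (simp add: take lcost_snoc)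
  ultimately show "better (v' (code ?X)) (Suc (lcost w (take (Suc p) zs)))"
    using 1 by (auto simp: better_def)
qed

lemma reached_final:
  assumes "reached k D w k v" "windowed_list k D zs"
  shows "better (v (2 ^ k - 1)) (Suc (lcost w zs))"
proof -
  have "length zs = k"
    using assms(2) distinct_card[of zs] by (auto simp: windowed_list_def)
  then have "take k zs = zs" by simp
  moreover have "code (set zs) = 2 ^ k - 1"
    using assms(2) by (simp add: windowed_list_def code_lessThan)
  ultimately show ?thesis
    using assms unfolding reached_def by metis
qed

lemma windowed_list_upt: "0 < D \<Longrightarrow> windowed_list k D [0..<k]"
  unfolding windowed_list_def windowed_def by (auto simp: take_upt)

text \<open>State of the backtracking: \<open>zs\<close> has been read off, the positions in \<open>S\<close> remain.\<close>

definition traced :: "nat \<Rightarrow> (nat \<Rightarrow> nat \<Rightarrow> nat) \<Rightarrow> (nat \<Rightarrow> nat) \<Rightarrow> nat \<Rightarrow> nat list \<Rightarrow> bool" where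
  "traced k w v S zs \<longleftrightarrow> distinct zs \<and> set zs = {..<k} - {j. bit S j} \<and> S < 2 ^ k \<and> v S \<noteq> 0 \<and>
     v S + lcost w zs + (\<Sum>z\<leftarrow>zs. add_cost k w S z) \<le> v (2 ^ k - 1)"

lemma bit_full: "bit ((2::nat) ^ k - 1) j \<longleftrightarrow> j < k"
  using bit_code[of "{..<k}" j] by (simp add: code_lessThan)

lemma traced_init: "v (2 ^ k - 1) \<noteq> 0 \<Longrightarrow> traced k w v (2 ^ k - 1) []"
  using bit_full[of k] by (simp add: traced_def lessThan_def)

text \<open>Moving \<open>ch S\<close> from the mask to the front of \<open>zs\<close> only
  reclassifies pairs: \<open>add_cost k w S z\<close> splits into \<open>w (ch S) z\<close>, which
  joins \<open>lcost\<close>, and the term for the smaller mask.\<close>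

lemma traced_step:
  assumes "traced k w v S zs" "sound k w v ch" "length zs < k" and diag: "\<And>x. w x x = 0"
  shows "ch S < k" "2 ^ ch S \<le> S" "traced k w v (S - 2 ^ ch S) (ch S # zs)"
proof -
  let ?x = "ch S"
  have "S \<noteq> 0"
  proof
    assume "S = 0"
    then have "set zs = {..<k}"
      using assms(1) by (auto simp: traced_def)
    then show False
      using assms(1,3) distinct_card[of zs] by (auto simp: traced_def)
  qed
  then have x: "?x < k" "bit S ?x" "v (S - 2 ^ ?x) \<noteq> 0"
      "v (S - 2 ^ ?x) + add_cost k w S ?x \<le> v S"
    using assms(1,2) by (auto simp: traced_def sound_def)
  show "?x < k" "2 ^ ?x \<le> S"
    using x bit_exp_le by auto
  have cost: "add_cost k w S z = w ?x z + add_cost k w (S - 2 ^ ?x) z" for z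
    by (rule add_cost_diff) fact+
  have "(\<Sum>z\<leftarrow>zs. add_cost k w S z) = (\<Sum>z\<leftarrow>zs. w ?x z) + (\<Sum>z\<leftarrow>zs. add_cost k w (S - 2 ^ ?x) z)"
    unfolding cost by (simp add: sum_list_addf)
  moreover have "set (?x # zs) = {..<k} - {j. bit (S - 2 ^ ?x) j}" "?x \<notin> set zs"
    using assms(1) x by (auto simp: traced_def bit_diff_exp[OF x(2)])
  moreover have "S - 2 ^ ?x < 2 ^ k"
    using assms(1) by (simp add: traced_def less_imp_diff_less)
  ultimately show "traced k w v (S - 2 ^ ?x) (?x # zs)"
    using assms(1) x(3,4) cost[of ?x] diag[of ?x] unfolding traced_def
    by simp
qed

lemma traced_final:
  assumes "traced k w v S zs" "sound k w v ch" "length zs = k"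
  shows "distinct zs" "set zs = {..<k}" "Suc (lcost w zs) \<le> v (2 ^ k - 1)"
proof -
  show dist: "distinct zs"
    using assms by (simp add: traced_def)
  have "set zs \<subseteq> {..<k}" "card (set zs) = k"
    using assms distinct_card[of zs] by (auto simp: traced_def)
  then show *: "set zs = {..<k}"
    by (intro card_subset_eq) auto
  have "\<not> bit S j" for j
    using assms(1) * bit_less_exp[of S k j] by (auto simp: traced_def)
  then have "S = 0"
    using code_bits[of S] by simp
  then show "Suc (lcost w zs) \<le> v (2 ^ k - 1)"
    using assms(1,2) by (auto simp: traced_def sound_def)
qed

section \<open>The program\<close>

text \<open>Registers are numbered by lifetime: those below \<open>rS\<close> are fixed while the
  search and the traceback of one insertion run, so frame conditions become intervals such as
  \<open>{18..32}\<close>.\<close>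

abbreviation (input) "rN \<equiv> 0 :: nat"
abbreviation (input) "rZero \<equiv> 3 :: nat"
abbreviation (input) "rStep \<equiv> 4 :: nat"
abbreviation (input) "rQ \<equiv> 5 :: nat"
abbreviation (input) "rSq \<equiv> 6 :: nat"
abbreviation (input) "rD \<equiv> 7 :: nat"
abbreviation (input) "rMul \<equiv> 8 :: nat"
abbreviation (input) "rPow \<equiv> 9 :: nat"
abbreviation (input) "rOrd \<equiv> 10 :: nat"
abbreviation (input) "rLim \<equiv> 11 :: nat"
abbreviation (input) "rK \<equiv> 12 :: nat"
abbreviation (input) "rTop \<equiv> 13 :: nat"
abbreviation (input) "rVal \<equiv> 14 :: nat"
abbreviation (input) "rCh \<equiv> 15 :: nat"
abbreviation (input) "rFull \<equiv> 16 :: nat"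
abbreviation (input) "rS \<equiv> 17 :: nat"
abbreviation (input) "rX \<equiv> 18 :: nat"
abbreviation (input) "rY \<equiv> 19 :: nat"
abbreviation (input) "rRem \<equiv> 20 :: nat"
abbreviation (input) "rRem' \<equiv> 21 :: nat"
abbreviation (input) "rPx \<equiv> 22 :: nat"
abbreviation (input) "rPy \<equiv> 23 :: nat"
abbreviation (input) "rT \<equiv> 24 :: nat"
abbreviation (input) "rIx \<equiv> 25 :: nat"
abbreviation (input) "rAcc \<equiv> 26 :: nat"
abbreviation (input) "rA \<equiv> 27 :: nat"
abbreviation (input) "rB \<equiv> 28 :: nat"
abbreviation (input) "rV \<equiv> 29 :: nat"
abbreviation (input) "rCand \<equiv> 30 :: nat"
abbreviation (input) "rAS \<equiv> 31 :: nat"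
abbreviation (input) "rOld \<equiv> 32 :: nat"
abbreviation (input) "rPc \<equiv> 33 :: nat"
abbreviation (input) "rP \<equiv> 34 :: nat"
abbreviation (input) "rM \<equiv> 35 :: nat"
abbreviation (input) "rInc \<equiv> 36 :: nat"
abbreviation (input) "rMc \<equiv> 37 :: nat"
abbreviation (input) "rKc \<equiv> 38 :: nat"
abbreviation (input) "rI \<equiv> 39 :: nat"
abbreviation (input) "rNew \<equiv> 40 :: nat"
abbreviation (input) "rSz \<equiv> 41 :: nat"

primrec seqs :: "com list \<Rightarrow> com" where
  "seqs [] = Skip"
| "seqs (c # cs) = Seq c (seqs cs)"

text \<open>Truncated subtraction is the only comparison: \<open>rT\<close> is zero iff the power
  \<open>2 ^ y\<close> fits into the remainder, so \<open>Skip\<close> is the branch for an absent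
  position. The row of the signal cell comes from the table at \<open>rMul\<close>, as there is no
  multiplication.\<close>

definition weigh :: com where
  "weigh = seqs [Instr (Add rA rPow rY), Instr (Load rPy rA), Instr (Sub rT rPy rRem'),
     If rT Skip (seqs [Instr (Sub rRem' rRem' rPy), Instr (Add rA rOrd rY), Instr (Load rB rA),
       Instr (Add rA rMul rB), Instr (Load rA rA), Instr (Add rA rA rIx), Instr (Load rA rA),
       Instr (Add rAcc rAcc rA)])]"

definition update :: com where
  "update = seqs [Instr (Store rAS rCand), Instr (Add rA rCh rS), Instr (Store rA rX)]"

text \<open>As \<open>0\<close> means infinity, it is tested before any comparison: a missing
  predecessor gives no candidate, and a missing old value is overwritten at once.\<close>

definition try_last :: com where
  "try_last = seqs [Instr (Add rA rPow rX), Instr (Load rPx rA), Instr (Sub rT rPx rRem),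
     If rT Skip (seqs [Instr (Sub rRem rRem rPx), Instr (Add rA rOrd rX), Instr (Load rIx rA),
       Instr (Const rAcc 0), Instr (Add rRem' rS rZero), Instr (Add rY rK rZero),
       countdown rY weigh,
       Instr (Sub rA rS rPx), Instr (Add rA rVal rA), Instr (Load rV rA),
       If rV (seqs [Instr (Add rCand rV rAcc), Instr (Add rAS rVal rS), Instr (Load rOld rAS),
         Instr (Sub rT rOld rCand), If rOld (If rT update Skip) update]) Skip])]"

definition relax :: com where
  "relax = seqs [Instr (Add rRem rS rZero), Instr (Add rX rK rZero), countdown rX try_last]"

definition visit :: com where
  "visit = seqs [Instr (Sub rT rTop rM),
     If rT (seqs [Instr (Add rS rM rZero), relax, Instr (Add rS rM rTop), relax]) Skip,
     Instr (Add rM rM rInc)]"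

text \<open>
  A level visits the position sets that contain everything below \<open>p - D\<close>, an arbitrary subset of
  the next \<open>2 D\<close> positions, and optionally the top position. As bit masks, the sets without the top
  position form an arithmetic progression with difference \<open>2 ^ (p - D)\<close>.
\<close>

definition level :: com where
  "level = seqs [Instr (Add rP rP rOne), Instr (Sub rA rP rD), Instr (Add rA rPow rA),
     Instr (Load rInc rA), Instr (Sub rM rInc rOne), Instr (Add rMc rLim rZero),
     countdown rMc visit]"

definition search :: com where
  "search = seqs [Instr (Const rP 0), Instr (Add rPc rK rZero), countdown rPc level]"

definition read_off :: com where
  "read_off = seqs [Instr (Add rA rCh rS), Instr (Load rX rA), Instr (Add rA rOrd rX),
     Instr (Load rY rA), Instr (Add rA rNew rI), Instr (Store rA rY), Instr (Add rA rPow rX),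
     Instr (Load rY rA), Instr (Sub rS rS rY)]"

definition traceback :: com where
  "traceback = seqs [Instr (Sub rS rFull rOne), Instr (Add rNew rCh rFull), Instr (Add rI rK rZero),
     countdown rI read_off]"

text \<open>Each stage puts its value table, choice table and new order into fresh memory behind the
  old order. Fresh cells are 0, which already reads as an empty table, so nothing has to be cleared.
  \<open>rTop\<close> is loaded before \<open>rK\<close> grows and thus belongs to the new, last
  position.\<close>

definition insertion :: com where
  "insertion = seqs [Instr (Add rA rPow rK), Instr (Load rTop rA), Instr (Add rA rOrd rK),
     Instr (Add rK rK rOne), Instr (Store rA rK), Instr (Add rVal rOrd rN),
     Instr (Add rFull rTop rTop), Instr (Add rCh rVal rFull), Instr (Store rVal rOne),
     search, traceback, Instr (Add rOrd rNew rZero)]"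

section \<open>Memory layout and verification of one insertion\<close>

definition agree :: "nat set \<Rightarrow> (nat \<Rightarrow> nat) \<Rightarrow> (nat \<Rightarrow> nat) \<Rightarrow> bool" where
  "agree X r r' \<longleftrightarrow> (\<forall>z. z \<notin> X \<longrightarrow> r' z = r z)"

lemma agreeD: "agree X r r' \<Longrightarrow> z \<notin> X \<Longrightarrow> r' z = r z"
  by (simp add: agree_def)

lemma agree_refl [simp]: "agree X r r"
  by (simp add: agree_def)

lemma agree_trans: "agree X r r' \<Longrightarrow> agree Y r' r'' \<Longrightarrow> X \<subseteq> Z \<Longrightarrow> Y \<subseteq> Z \<Longrightarrow> agree Z r r''"
  by (auto simp: agree_def subset_iff) metis

lemma agree_upd [simp]: "z \<in> X \<Longrightarrow> agree X r (r'(z := u)) = agree X r r'"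
  by (auto simp: agree_def)

text \<open>\<open>f\<close> is the signal matrix in the input cells, the last of which is
  \<open>n * n + n\<close>; the multiples of \<open>n\<close> start at \<open>MB\<close> and the
  powers of 2 at \<open>PB\<close>. The tables reach index \<open>n + 2 * D\<close> so that
  \<open>2 ^ (2 * D)\<close>, the number of rounds of a level, can be looked up.\<close>

locale layout =
  fixes n D MB PB :: nat and f :: "nat \<Rightarrow> nat \<Rightarrow> nat"
  assumes D_pos: "0 < D"
    and MB: "n * n + n < MB"
    and PB: "PB = MB + (n + 2 * D + 1)"
    and f_diag: "f x x = 0"
begin

definition globals :: "(nat \<Rightarrow> nat) \<Rightarrow> bool" where
  "globals r \<longleftrightarrow> r rN = n \<and> r rOne = 1 \<and> r rZero = 0 \<and> r rD = D \<and> r rMul = MB \<and> r rPow = PB \<and>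
     r rLim = 2 ^ (2 * D)"

definition tables :: "(nat \<Rightarrow> nat) \<Rightarrow> bool" where
  "tables m \<longleftrightarrow> (\<forall>a \<in> {1..n}. \<forall>b \<in> {1..n}. m (a * n + b) = f a b) \<and>
     (\<forall>i \<le> n + 2 * D. m (MB + i) = i * n \<and> m (PB + i) = 2 ^ i)"

lemma tables_upd: "tables m \<Longrightarrow> PB + (n + 2 * D + 1) \<le> z \<Longrightarrow> tables (m(z := u))"
proof -
  assume *: "tables m" "PB + (n + 2 * D + 1) \<le> z"
  have "a * n + b \<noteq> z" if "a \<in> {1..n}" "b \<in> {1..n}" for a b
  proof -
    have "a * n \<le> n * n"
      using that by simp
    moreover have "b \<le> n"
      using that by simp
    ultimately show ?thesis
      using *(2) MB PB by linarith
  qed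
  moreover have "MB + i \<noteq> z \<and> PB + i \<noteq> z" if "i \<le> n + 2 * D" for i
    using that *(2) PB by simp
  ultimately show ?thesis
    using *(1) unfolding tables_def by simp
qed

end

text \<open>One insertion: \<open>os\<close> is the old order with the new item appended,
  \<open>k\<close> counts that item too, and positions are indices into \<open>os\<close>.\<close>

locale stage = layout +
  fixes OB k :: nat and os :: "nat list"
  assumes k: "0 < k" "k \<le> n"
    and OB: "PB + (n + 2 * D + 1) \<le> OB"
    and os: "length os = k" "set os \<subseteq> {1..n}"
begin

definition wgt :: "nat \<Rightarrow> nat \<Rightarrow> nat" where
  "wgt y x = f (os ! y) (os ! x)"

lemma wgt_diag [simp]: "wgt x x = 0"
  by (simp add: wgt_def f_diag)

definition "VB = OB + n"
definition "CB = VB + 2 ^ k"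

definition env :: "(nat \<Rightarrow> nat) \<Rightarrow> bool" where
  "env r \<longleftrightarrow> globals r \<and> r rOrd = OB \<and> r rK = k \<and> r rTop = 2 ^ (k - 1) \<and> r rVal = VB \<and>
     r rCh = CB \<and> r rFull = 2 ^ k"

definition store :: "(nat \<Rightarrow> nat) \<Rightarrow> bool" where
  "store m \<longleftrightarrow> tables m \<and> (\<forall>j < k. m (OB + j) = os ! j) \<and> (\<forall>z \<ge> CB + 2 ^ k. m z = 0)"

text \<open>The cells behind the value table hold the choices; the default \<open>0\<close> there
  allows statements about all \<open>S\<close>.\<close>

definition val :: "(nat \<Rightarrow> nat) \<Rightarrow> nat \<Rightarrow> nat" where
  "val m S = (if S < 2 ^ k then m (VB + S) else 0)"

definition ch :: "(nat \<Rightarrow> nat) \<Rightarrow> nat \<Rightarrow> nat" where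
  "ch m S = m (CB + S)"

definition good :: "(nat \<Rightarrow> nat) \<Rightarrow> bool" where
  "good m \<longleftrightarrow> store m \<and> sound k wgt (val m) (ch m)"

lemma env_agree:
  "env r \<Longrightarrow> agree X r r' \<Longrightarrow> X \<subseteq> {17..} \<Longrightarrow> env r'"
proof -
  assume *: "env r" "agree X r r'" "X \<subseteq> {17..}"
  then have "r' z = r z" if "z < 17" for z
    using that agreeD[of X r r' z] by fastforce
  then show ?thesis
    using *(1) unfolding env_def globals_def by simp
qed

lemma os_nth: "j < k \<Longrightarrow> os ! j \<in> {1..n}"
  using os nth_mem by blast

lemma store_upd: "store m \<Longrightarrow> z \<in> {VB..<CB + 2 ^ k} \<Longrightarrow> store (m(z := u))"
  using OB k tables_upd[of m z u] by (auto simp: store_def VB_def)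

lemma wp_weigh:
  assumes "env r" "store m" "S < 2 ^ k" "x < k" "r rY = k" "r rRem' = S" "r rAcc = 0"
    "r rIx = os ! x"
    and Q: "\<And>r' \<tau>'. agree {rY, rA, rB, rPy, rT, rRem', rAcc} r r' \<Longrightarrow>
      r' rAcc = add_cost k wgt S x \<Longrightarrow> \<tau>' \<le> \<tau> + k * 30 + 1 \<Longrightarrow> Q r' m \<tau>'"
  shows "wp (countdown rY weigh) Q r m \<tau>"
proof -
  let ?X = "{rY, rA, rB, rPy, rT, rRem', rAcc}"
  define I where "I j r' m' \<longleftrightarrow> agree ?X r r' \<and> m' = m \<and> r' rRem' = S mod 2 ^ j \<and>
    r' rAcc = (\<Sum>y | j \<le> y \<and> y < k \<and> bit S y. wgt y x)" for j :: nat and r' m' :: "nat \<Rightarrow> nat"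
  have env: "env r'" if "agree ?X r r'" for r'
    using env_agree[OF assms(1) that] by auto
  show ?thesis
  proof (rule wp_countdown[where N = k and I = I and B = 26])
    show "I k r m"
      using assms(3,6,7) unfolding I_def by simp
    fix j r1 m1 \<tau>1
    assume j: "j < k" "I (Suc j) r1 m1" "r1 rY = Suc j"
    have env1: "env r1" and m1: "m1 = m" and rem: "r1 rRem' = S mod 2 ^ Suc j"
      and ix: "r1 rIx = os ! x"
      using j env assms(8) agreeD[of ?X r r1 rIx] by (auto simp: I_def)
    have load: "m (PB + j) = 2 ^ j" "m (OB + j) = os ! j" "m (MB + os ! j) = os ! j * n"
        "m (os ! j * n + os ! x) = wgt j x"
      using assms(2) j(1) k os_nth[of j] os_nth[of x] assms(4)
      by (auto simp: store_def tables_def wgt_def)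
    have regs: "r1 rPow = PB" "r1 rOrd = OB" "r1 rMul = MB"
      using env1 by (auto simp: env_def globals_def)
    have sum: "(\<Sum>y | j \<le> y \<and> y < k \<and> bit S y. wgt y x) =
        (if bit S j then wgt j x else 0) + (\<Sum>y | Suc j \<le> y \<and> y < k \<and> bit S y. wgt y x)"
    proof (cases "bit S j")
      case True
      then have "{y. j \<le> y \<and> y < k \<and> bit S y} = insert j {y. Suc j \<le> y \<and> y < k \<and> bit S y}"
        using j(1) by (auto simp: Suc_le_eq le_less)
      then show ?thesis
        using True by simp
    next
      case False
      then have "{y. j \<le> y \<and> y < k \<and> bit S y} = {y. Suc j \<le> y \<and> y < k \<and> bit S y}"
        by (auto simp: Suc_le_eq le_less)
      then show ?thesis
        using False by simp
    qed
    have less: "S mod 2 ^ j < 2 ^ j"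
      by simp
    show "wp weigh (\<lambda>r' m' \<tau>'. r' rY = j \<and> I j r' m' \<and> \<tau>' \<le> \<tau>1 + 26) (r1(rY := j)) m1 \<tau>1"
    proof (cases "bit S j")
      case True
      then have "S mod (2 * 2 ^ j) = 2 ^ j + S mod 2 ^ j"
        using mod_exp_Suc[of S j] by simp
      then show ?thesis
        using j(2) sum True by (simp add: weigh_def m1 regs load rem ix I_def)
    next
      case False
      then have "S mod (2 * 2 ^ j) = S mod 2 ^ j"
        using mod_exp_Suc[of S j] by simp
      then show ?thesis
        using j(2) sum False less by (simp add: weigh_def m1 regs load rem ix I_def)
    qed
  next
    fix j r1 m1 assume "I j r1 m1"
    then show "r1 rOne = 1"
      using env[of r1] by (auto simp: I_def env_def globals_def)
  next
    fix r1 m1 \<tau>1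
    assume "I 0 r1 m1" "\<tau>1 \<le> \<tau> + k * (26 + 4) + 1"
    then show "Q r1 m1 \<tau>1"
      using Q[of r1 \<tau>1] by (auto simp: I_def add_cost_def)
  qed fact
qed


lemma good_update:
  assumes "good m" "S < 2 ^ k" "x < k" "bit S x" "val m (S - 2 ^ x) \<noteq> 0"
    "val m S \<noteq> 0 \<longrightarrow> val m (S - 2 ^ x) + add_cost k wgt S x \<le> val m S"
  defines "m' \<equiv> m(VB + S := val m (S - 2 ^ x) + add_cost k wgt S x, CB + S := x)"
  shows "good m'" "val m' = (val m)(S := val m (S - 2 ^ x) + add_cost k wgt S x)"
proof -
  have "store m'"
    unfolding m'_def using assms(1,2) by (intro store_upd) (auto simp: good_def CB_def)
  moreover show val: "val m' = (val m)(S := val m (S - 2 ^ x) + add_cost k wgt S x)"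
    using assms(2) by (auto simp: val_def m'_def CB_def fun_eq_iff)
  have "ch m' S' = ((ch m)(S := x)) S'" if "S' < 2 ^ k" for S'
    using that assms(2) by (auto simp: ch_def m'_def CB_def)
  moreover have "sound k wgt ((val m)(S := val m (S - 2 ^ x) + add_cost k wgt S x)) ((ch m)(S := x))"
    by (rule sound_update) (use assms(1,3-6) in \<open>simp_all add: good_def\<close>)
  then have "sound k wgt (val m') (ch m')"
    unfolding val by (rule sound_cong) fact
  ultimately show "good m'"
    unfolding good_def by simp
qed

definition "relax_cost = k * (k * 30 + 60) + 10"

lemma wp_relax:
  assumes "env r" "good m" "r rS = S" "S < 2 ^ k"
    and Q: "\<And>r' m' \<tau>'. agree {18..32} r r' \<Longrightarrow> good m' \<Longrightarrow> (\<And>S'. better (val m' S') (val m S')) \<Longrightarrow>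
      (\<And>x. x < k \<Longrightarrow> bit S x \<Longrightarrow> val m (S - 2 ^ x) \<noteq> 0 \<Longrightarrow>
         better (val m' S) (val m (S - 2 ^ x) + add_cost k wgt S x)) \<Longrightarrow>
      \<tau>' \<le> \<tau> + relax_cost \<Longrightarrow> Q r' m' \<tau>'"
  shows "wp relax Q r m \<tau>"
proof -
  let ?X = "{18..32::nat}"
  define I where "I j r' m' \<longleftrightarrow> agree ?X r r' \<and> good m' \<and> r' rRem = S mod 2 ^ j \<and>
    (\<forall>S'. better (val m' S') (val m S')) \<and> (\<forall>S'. S' \<noteq> S \<longrightarrow> val m' S' = val m S') \<and>
    (\<forall>x. j \<le> x \<and> x < k \<and> bit S x \<and> val m (S - 2 ^ x) \<noteq> 0 \<longrightarrow>
         better (val m' S) (val m (S - 2 ^ x) + add_cost k wgt S x))" for j :: nat and r' m' :: "nat \<Rightarrow> nat"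
  have env: "env r'" if "agree ?X r r'" for r'
    using env_agree[OF assms(1) that] by auto
  have loop: "wp (countdown rX try_last) (\<lambda>r m \<tau>. Q r m (Suc \<tau>)) (r(rRem := S, rX := k)) m
      (Suc (Suc (Suc (Suc \<tau>))))"
  proof (rule wp_countdown[where N = k and I = I and B = "k * 30 + 50"])
    show "(r(rRem := S, rX := k)) rX = k"
      by simp
    show "I k (r(rRem := S, rX := k)) m"
      using assms(2,4) unfolding I_def by auto
    fix j r1 m1 \<tau>1
    assume j: "j < k" "I (Suc j) r1 m1" "r1 rX = Suc j"
    have env1: "env r1" and rem: "r1 rRem = S mod 2 ^ Suc j" and good1: "good m1"
      and rS: "r1 rS = S"
      using j env assms(3) agreeD[of ?X r r1 rS] by (auto simp: I_def)
    have better1: "better (val m1 S') (val m S')" and other: "S' \<noteq> S \<Longrightarrow> val m1 S' = val m S'" for S'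
      using j(2) by (auto simp: I_def)
    have load: "m1 (PB + j) = 2 ^ j" "m1 (OB + j) = os ! j"
      using good1 j(1) k by (auto simp: good_def store_def tables_def)
    have regs: "r1 rPow = PB" "r1 rOrd = OB" "r1 rZero = 0" "r1 rK = k" "r1 rVal = VB" "r1 rCh = CB"
      using env1 by (auto simp: env_def globals_def)
    have less: "S mod 2 ^ j < 2 ^ j"
      by simp
    have lej: "j \<le> x \<longleftrightarrow> x = j \<or> Suc j \<le> x" for x
      by auto
    show "wp try_last (\<lambda>r' m' \<tau>'. r' rX = j \<and> I j r' m' \<and> \<tau>' \<le> \<tau>1 + (k * 30 + 50))
        (r1(rX := j)) m1 \<tau>1"
    proof (cases "bit S j")
      case False
      then have "S mod (2 * 2 ^ j) = S mod 2 ^ j"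
        using mod_exp_Suc[of S j] by simp
      moreover have "I j (r1(27 := PB + j, rX := j, 22 := 2 ^ j, 24 := 2 ^ j - S mod 2 ^ j)) m1"
        using j(2) False calculation unfolding I_def by (auto simp: lej)
      ultimately show ?thesis
        using less by (simp add: try_last_def regs load rem fun_upd_twist)
    next
      case True
      then have mod: "S mod (2 * 2 ^ j) = 2 ^ j + S mod 2 ^ j"
        using mod_exp_Suc[of S j] by simp
      \<comment> \<open>The loop changes values only at \<open>S\<close>, so the smaller entry read
        here still has its initial value.\<close>
      have Sj: "S - 2 ^ j < S" "S - 2 ^ j \<noteq> S"
        using bit_less_mono[OF True] by auto
      have val_Sj: "m1 (VB + (S - 2 ^ j)) = val m (S - 2 ^ j)"
        using other[OF Sj(2)] Sj(1) assms(4) by (simp add: val_def)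
      have val_S: "m1 (VB + S) = val m1 S"
        using assms(4) by (simp add: val_def)
      let ?c = "val m (S - 2 ^ j) + add_cost k wgt S j"
      let ?m = "m1(VB + S := ?c, CB + S := j)"
      have skip: "I j r2 m1"
        if "agree ?X r1 r2" "r2 rRem = S mod 2 ^ j"
          "val m (S - 2 ^ j) = 0 \<or> val m1 S \<noteq> 0 \<and> val m1 S \<le> ?c" for r2
        using j(2) that agree_trans[of ?X r r1 ?X r2 ?X] unfolding I_def
        by (auto simp: lej better_def)
      have upd: "I j r2 ?m"
        if "agree ?X r1 r2" "r2 rRem = S mod 2 ^ j" "val m (S - 2 ^ j) \<noteq> 0"
          "val m1 S = 0 \<or> ?c < val m1 S" for r2
      proof -
        have g: "good ?m" "val ?m = (val m1)(S := ?c)"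
          using good_update[OF good1 assms(4) j(1) True] other[OF Sj(2)] that(3,4) by auto
        have "better ?c (val m1 S)"
          using that(3,4) by (auto simp: better_def)
        then have mono: "better (val ?m S') (val m1 S')" for S'
          by (simp add: g)
        have "val ?m S = ?c"
          by (simp add: g)
        have "better (val ?m S) (val m (S - 2 ^ x) + add_cost k wgt S x)"
          if "j \<le> x" "x < k" "bit S x" "val m (S - 2 ^ x) \<noteq> 0" for x
        proof (cases "x = j")
          case True
          then show ?thesis
            using \<open>val ?m S = ?c\<close> by simp
        next
          case False
          then have "better (val m1 S) (val m (S - 2 ^ x) + add_cost k wgt S x)"
            using j(2) that by (auto simp: I_def)
          then show ?thesis
            using better_trans[OF mono] by blast
        qed
        moreover have "better (val ?m S') (val m S')" for S'
          using better_trans[OF mono better1] .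
        moreover have "val ?m S' = val m S'" if "S' \<noteq> S" for S'
          using that other by (simp add: g)
        moreover have "agree ?X r r2"
          using j(2) that(1) agree_trans[of ?X r r1 ?X r2 ?X] by (simp add: I_def)
        ultimately show ?thesis
          using that(2) g(1) unfolding I_def by blast
      qed
      show ?thesis
      proof (simp add: try_last_def regs load rem mod, rule wp_weigh[where S = S and x = j], goal_cases)
        case 1
        show ?case
          by (rule env_agree[OF env1, where X = ?X]) auto
      next
        case (9 r2 \<tau>2)
        have acc: "r2 rAcc = add_cost k wgt S j"
          using 9 by simp
        have r2: "r2 rVal = VB" "r2 rCh = CB" "r2 rS = S" "r2 rPx = 2 ^ j" "r2 rX = j" "r2 rRem = S mod 2 ^ j"
          using agreeD[OF 9(1), of rVal] agreeD[OF 9(1), of rCh] agreeD[OF 9(1), of rS]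
            agreeD[OF 9(1), of rPx] agreeD[OF 9(1), of rX] agreeD[OF 9(1), of rRem]
          by (simp_all add: regs rS)
        have ag: "agree ?X r1 r2"
          using agree_trans[OF _ 9(1), of ?X r1 ?X] by simp
        show ?case
          using 9(3) ag
          by (simp add: update_def r2 acc val_Sj val_S)
            (intro conjI impI upd skip; simp add: r2 acc)
      qed (use good1 assms(4) j(1) rS regs in \<open>simp_all add: good_def\<close>)
    qed
  next
    fix j r1 m1 assume "I j r1 m1"
    then show "r1 rOne = 1"
      using env[of r1] by (auto simp: I_def env_def globals_def)
  next
    fix r1 m1 \<tau>1
    assume "I 0 r1 m1" "\<tau>1 \<le> Suc (Suc (Suc (Suc \<tau>))) + k * (k * 30 + 50 + 4) + 1"
    then show "Q r1 m1 (Suc \<tau>1)"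
      by (intro Q) (auto simp: I_def relax_cost_def algebra_simps)
  qed
  have "r rZero = 0" "r rK = k"
    using assms(1) by (auto simp: env_def globals_def)
  with loop show ?thesis
    by (simp add: relax_def assms(3))
qed

end

context stage
begin

definition settled :: "nat \<Rightarrow> (nat \<Rightarrow> nat) \<Rightarrow> (nat \<Rightarrow> nat) \<Rightarrow> bool" where
  "settled S m0 m \<longleftrightarrow> (\<forall>x < k. bit S x \<longrightarrow> val m0 (S - 2 ^ x) \<noteq> 0 \<longrightarrow>
     better (val m S) (val m0 (S - 2 ^ x) + add_cost k wgt S x))"

text \<open>Values only improve: relaxing against a later table also counts against an earlier one,
  and later updates do not undo it.\<close>

lemma settled_mono:
  assumes "settled S m1 m2" "\<And>S. better (val m1 S) (val m0 S)" "\<And>S. better (val m3 S) (val m2 S)"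
  shows "settled S m0 m3"
  unfolding settled_def
proof (intro allI impI)
  fix x assume x: "x < k" "bit S x" "val m0 (S - 2 ^ x) \<noteq> 0"
  with assms(2)[of "S - 2 ^ x"]
  have *: "val m1 (S - 2 ^ x) \<noteq> 0" "val m1 (S - 2 ^ x) \<le> val m0 (S - 2 ^ x)"
    by (auto simp: better_def)
  then have "better (val m2 S) (val m1 (S - 2 ^ x) + add_cost k wgt S x)"
    using assms(1) x by (auto simp: settled_def)
  then have "better (val m2 S) (val m0 (S - 2 ^ x) + add_cost k wgt S x)"
    using * by (auto simp: better_def)
  then show "better (val m3 S) (val m0 (S - 2 ^ x) + add_cost k wgt S x)"
    using better_trans[OF assms(3)] by blast
qed

lemma wp_relax_settled:
  assumes "env r" "good m" "r rS = S" "S < 2 ^ k"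
    and Q: "\<And>r' m' \<tau>'. agree {18..32} r r' \<Longrightarrow> good m' \<Longrightarrow> (\<And>S'. better (val m' S') (val m S')) \<Longrightarrow>
      settled S m m' \<Longrightarrow> \<tau>' \<le> \<tau> + relax_cost \<Longrightarrow> Q r' m' \<tau>'"
  shows "wp relax Q r m \<tau>"
  by (rule wp_relax[OF assms(1-4)]) (rule Q; simp add: settled_def)

definition "visit_cost = 2 * relax_cost + 30"

lemma wp_visit:
  assumes "env r" "good m" "r rM = S"
    and Q: "\<And>r' m' \<tau>'. agree ({17..32} \<union> {rM}) r r' \<Longrightarrow> r' rM = S + r rInc \<Longrightarrow> good m' \<Longrightarrow>
      (\<And>S'. better (val m' S') (val m S')) \<Longrightarrow>
      (S < 2 ^ (k - 1) \<Longrightarrow> settled S m m' \<and> settled (S + 2 ^ (k - 1)) m m') \<Longrightarrow>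
      \<tau>' \<le> \<tau> + visit_cost \<Longrightarrow> Q r' m' \<tau>'"
  shows "wp visit Q r m \<tau>"
proof (cases "S < 2 ^ (k - 1)")
  case False
  then show ?thesis
    using assms(1-3) by (simp add: visit_def env_def)
      (rule Q; simp add: visit_cost_def)
next
  case True
  have exp: "(2::nat) ^ k = 2 ^ (k - 1) + 2 ^ (k - 1)"
    using k(1) by (cases k) auto
  have regs: "r rTop = 2 ^ (k - 1)" "r rZero = 0"
    using assms(1) by (auto simp: env_def globals_def)
  show ?thesis
  proof (simp add: visit_def regs assms(3) True[simplified], rule wp_relax_settled[where S = S], goal_cases)
    case 1
    show ?case
      by (rule env_agree[OF assms(1), where X = "{17..32}"]) auto
  next
    case 2
    show ?case by fact
  next
    case (5 r1 m1 \<tau>1)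
    have ag1: "agree {17..32} r r1"
      using agree_trans[OF _ 5(1), of "{17..32}" r "{17..32}"] by auto
    have r1: "r1 rTop = 2 ^ (k - 1)" "r1 rM = S"
      using agreeD[OF ag1] regs assms(3) by auto
    show ?case
    proof (simp add: r1, rule wp_relax_settled[where S = "S + 2 ^ (k - 1)"], goal_cases)
      case 1
      show ?case
        by (rule env_agree[OF assms(1), where X = "{17..32}"]) (use ag1 in auto)
    next
      case (5 r2 m2 \<tau>2)
      have ag2: "agree {17..32} r r2"
        using agree_trans[OF _ 5(1), of "{17..32}" r "{17..32}"] ag1 by auto
      have r2: "r2 rM = S" "r2 rInc = r rInc"
        using agreeD[OF ag2] assms(3) by auto
      have better: "better (val m2 S') (val m S')" for S'
        using 5(3) \<open>\<And>S'. better (val m1 S') (val m S')\<close> better_trans by blast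
      have settled: "settled S m m2 \<and> settled (S + 2 ^ (k - 1)) m m2"
        using settled_mono[of S m m1 m m2] settled_mono[of _ m1 m2 m m2] 5(3,4)
          \<open>settled S m m1\<close> \<open>\<And>S'. better (val m1 S') (val m S')\<close> by auto
      have "agree ({17..32} \<union> {rM}) r r2"
        using ag2 by (auto simp: agree_def)
      then show ?case
        using r2 better settled 5(2,5) \<open>\<tau>1 \<le> _\<close>
        by (simp, intro Q) (simp_all add: visit_cost_def)
    qed (use 5 True exp in auto)
  qed (use True exp in auto)
qed

definition "level_cost = 2 ^ (2 * D) * (visit_cost + 4) + 30"

lemma wp_level:
  assumes "env r" "good m" "r rP = p" "p < k" "reached k D wgt p (val m)"
    and Q: "\<And>r' m' \<tau>'. agree ({17..32} \<union> {34..37}) r r' \<Longrightarrow> r' rP = Suc p \<Longrightarrow> good m' \<Longrightarrow>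
      reached k D wgt (Suc p) (val m') \<Longrightarrow> \<tau>' \<le> \<tau> + level_cost \<Longrightarrow> Q r' m' \<tau>'"
  shows "wp level Q r m \<tau>"
proof -
  let ?X = "{17..32} \<union> {34..37::nat}" and ?d = "2 ^ (Suc p - D) :: nat" and ?N = "2 ^ (2 * D) :: nat"
  let ?S = "\<lambda>T. ?d - 1 + ?d * T"
  define I where "I j r' m' \<longleftrightarrow> agree ?X r r' \<and> r' rP = Suc p \<and> r' rInc = ?d \<and>
    r' rM = ?S (?N - j) \<and> good m' \<and> (\<forall>S. better (val m' S) (val m S)) \<and>
    (\<forall>T < ?N - j. ?S T < 2 ^ (k - 1) \<longrightarrow> settled (?S T) m m' \<and> settled (?S T + 2 ^ (k - 1)) m m')"
    for j :: nat and r' m' :: "nat \<Rightarrow> nat"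
  have env: "env r'" if "agree ?X r r'" for r'
    using env_agree[OF assms(1) that] by auto
  have regs: "r rOne = 1" "r rD = D" "r rPow = PB" "r rLim = ?N" "r rZero = 0"
    using assms(1) by (auto simp: env_def globals_def)
  have load: "m (PB + (Suc p - D)) = ?d"
    using assms(2,4) k by (auto simp: good_def store_def tables_def)
  have step: "d - 1 + d * T + d = d - 1 + d * Suc T" if "0 < d" for d T :: nat
    by simp
  show ?thesis
  proof (simp add: level_def regs assms(3) load,
      rule wp_countdown[where N = ?N and I = I and B = visit_cost], goal_cases)
    case 2
    then show ?case
      using assms(2) by (simp add: I_def)
  next
    case (3 j r1 m1)
    then show ?case
      using env[of r1] by (auto simp: I_def env_def globals_def)
  next
    case (4 j r1 m1 \<tau>1)
    have ag: "agree ?X r (r1(rMc := j))" and N: "?N - j = Suc (?N - Suc j)"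
      using 4 by (auto simp: I_def)
    have inv: "good m1" "\<And>S. better (val m1 S) (val m S)"
      "\<And>T. T < ?N - Suc j \<Longrightarrow> ?S T < 2 ^ (k - 1) \<Longrightarrow>
        settled (?S T) m m1 \<and> settled (?S T + 2 ^ (k - 1)) m m1"
      "r1 rP = Suc p" "r1 rInc = ?d" "r1 rM = ?S (?N - Suc j)"
      using 4(2) unfolding I_def by auto
    show ?case
    proof (rule wp_visit[where S = "?S (?N - Suc j)"], goal_cases)
      case 1
      show ?case by (rule env) fact
    next
      case (4 r2 m2 \<tau>2)
      have "agree ?X r r2"
        by (rule agree_trans[OF ag 4(1)]) auto
      moreover have "r2 rP = Suc p" "r2 rInc = ?d" "r2 rMc = j"
        using agreeD[OF 4(1)] inv by auto
      moreover have "r2 rM = ?S (?N - j)"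
        using 4(2) inv(5) step[of ?d "?N - Suc j"] by (simp add: N del: mult_Suc_right)
      moreover have "better (val m2 S) (val m S)" for S
        using better_trans[OF 4(4) inv(2)] .
      moreover have "settled (?S T) m m2 \<and> settled (?S T + 2 ^ (k - 1)) m m2"
        if "T < ?N - j" "?S T < 2 ^ (k - 1)" for T
      proof (cases "T < ?N - Suc j")
        case True
        then show ?thesis
          using inv(3)[OF True that(2)] settled_mono[of _ m m1 m m2] 4(4) by auto
      next
        case False
        then have "T = ?N - Suc j"
          using that N by simp
        then show ?thesis
          using 4(5) that(2) settled_mono[of _ m1 m2 m m2] inv(2) by auto
      qed
      ultimately show ?case
        using 4(3,6) unfolding I_def by blast
    qed (use inv in auto)
  next
    case (5 r1 m1 \<tau>1)
    have "reached k D wgt (Suc p) (val m1)"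
    proof (rule reached_Suc[OF assms(5,4)])
      show "better (val m1 S) (val m S)" for S
        using 5(2) by (simp add: I_def)
      fix X x assume X: "windowed k D (Suc p) X" "X \<subseteq> {..<k}" "x \<in> X" "val m (code X - 2 ^ x) \<noteq> 0"
      obtain T where "T < ?N" "?S T < 2 ^ (k - 1)" "code X = ?S T \<or> code X = ?S T + 2 ^ (k - 1)"
        using windowed_code[OF X(1,2) _ k(1) D_pos] assms(4) by auto
      then have "settled (code X) m m1"
        using 5(2) unfolding I_def by auto
      moreover have "bit (code X) x" "x < k"
        using X bit_code[of X x] finite_subset[OF X(2)] by auto
      ultimately show "better (val m1 (code X)) (val m (code X - 2 ^ x) + add_cost k wgt (code X) x)"
        using X(4) unfolding settled_def by blast
    qed simp
    then show ?case
      using 5 by (intro Q) (auto simp: I_def level_cost_def)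
  qed simp
qed

definition "search_cost = k * (level_cost + 4) + 10"

lemma wp_search:
  assumes "env r" "good m"
    and Q: "\<And>r' m' \<tau>'. agree {17..37} r r' \<Longrightarrow> good m' \<Longrightarrow>
      reached k D wgt k (val m') \<Longrightarrow> \<tau>' \<le> \<tau> + search_cost \<Longrightarrow> Q r' m' \<tau>'"
  shows "wp search Q r m \<tau>"
proof -
  define I where "I j r' m' \<longleftrightarrow> agree {17..37} r r' \<and> r' rP = k - j \<and> good m' \<and>
    reached k D wgt (k - j) (val m')" for j :: nat and r' m' :: "nat \<Rightarrow> nat"
  have env: "env r'" if "agree {17..37} r r'" for r'
    using env_agree[OF assms(1) that] by auto
  have regs: "r rK = k" "r rZero = 0"
    using assms(1) by (auto simp: env_def globals_def)
  show ?thesis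
  proof (simp add: search_def regs,
      rule wp_countdown[where N = k and I = I and B = level_cost], goal_cases)
    case 2
    show ?case
      using assms(2) reached_0 by (auto simp: I_def good_def)
  next
    case (3 j r1 m1)
    then show ?case
      using env[of r1] by (auto simp: I_def env_def globals_def)
  next
    case (4 j r1 m1 \<tau>1)
    have ag: "agree {17..37} r (r1(rPc := j))" and N: "k - j = Suc (k - Suc j)"
      using 4 by (auto simp: I_def)
    show ?case
    proof (rule wp_level[where p = "k - Suc j"], goal_cases)
      case 1
      show ?case by (rule env) fact
    next
      case (6 r2 m2 \<tau>2)
      have "agree {17..37} r r2"
        by (rule agree_trans[OF ag 6(1)]) auto
      moreover have "r2 rPc = j"
        using agreeD[OF 6(1)] by auto
      ultimately show ?case
        using 6 unfolding I_def N by blast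
    qed (use 4 N in \<open>auto simp: I_def\<close>)
  next
    case (5 r1 m1 \<tau>1)
    then show ?case
      by (intro Q) (auto simp: I_def search_cost_def)
  qed simp
qed

definition "traceback_cost = k * 30 + 20"

text \<open>The order \<open>zs\<close> read off need not be windowed itself. Its cost is at most
  the value of the full set, which is at most the cost of each windowed competitor.\<close>

lemma wp_traceback:
  assumes "env r" "good m" "reached k D wgt k (val m)"
    and Q: "\<And>r' m' \<tau>' zs. agree ({17..32} \<union> {39..40}) r r' \<Longrightarrow> r' rNew = CB + 2 ^ k \<Longrightarrow>
      distinct zs \<Longrightarrow> set zs = {..<k} \<Longrightarrow>
      (\<And>zs'. windowed_list k D zs' \<Longrightarrow> lcost wgt zs \<le> lcost wgt zs') \<Longrightarrow>
      tables m' \<Longrightarrow> (\<And>i. i < k \<Longrightarrow> m' (CB + 2 ^ k + i) = os ! (zs ! i)) \<Longrightarrow>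
      (\<And>z. CB + 2 ^ k + k \<le> z \<Longrightarrow> m' z = 0) \<Longrightarrow>
      \<tau>' \<le> \<tau> + traceback_cost \<Longrightarrow> Q r' m' \<tau>'"
  shows "wp traceback Q r m \<tau>"
proof -
  let ?X = "{17..32} \<union> {39..40::nat}" and ?NB = "CB + 2 ^ k"
  define I where "I j r' m' \<longleftrightarrow> agree ?X r r' \<and> r' rNew = ?NB \<and> tables m' \<and>
    (\<forall>z < ?NB. m' z = m z) \<and> (\<forall>z \<ge> ?NB + k. m' z = 0) \<and>
    (\<exists>zs. length zs + j = k \<and> traced k wgt (val m) (r' rS) zs \<and>
       (\<forall>i < length zs. m' (?NB + j + i) = os ! (zs ! i)))"
    for j :: nat and r' m' :: "nat \<Rightarrow> nat"
  have env: "env r'" if "agree ?X r r'" for r'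
    using env_agree[OF assms(1) that] by auto
  have regs: "r rOne = 1" "r rFull = 2 ^ k" "r rCh = CB" "r rK = k" "r rZero = 0"
    using assms(1) by (auto simp: env_def globals_def)
  have final: "better (val m (2 ^ k - 1)) (Suc (lcost wgt zs))" if "windowed_list k D zs" for zs
    by (rule reached_final) fact+
  \<comment> \<open>The old order with the new item last is always windowed, so the full set is
    reached for every outcome of the signals.\<close>
  have nonzero: "val m (2 ^ k - 1) \<noteq> 0"
    using final[OF windowed_list_upt[OF D_pos]] by (auto simp: better_def)
  have sound: "sound k wgt (val m) (ch m)"
    using assms(2) by (simp add: good_def)
  show ?thesis
  proof (simp add: traceback_def regs,
      rule wp_countdown[where N = k and I = I and B = 26], goal_cases)
    case 2
    then show ?case
      using assms(2) traced_init[where v = "val m" and k = k, OF nonzero] unfolding I_def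
      by (auto simp: good_def store_def intro!: exI[of _ "[]"])
  next
    case (3 j r1 m1)
    then show ?case
      using env[of r1] by (auto simp: I_def env_def globals_def)
  next
    case (4 j r1 m1 \<tau>1)
    have env1: "env r1"
      using 4 env by (auto simp: I_def)
    then have regs1: "r1 rCh = CB" "r1 rOrd = OB" "r1 rPow = PB"
      by (auto simp: env_def globals_def)
    obtain zs where zs: "length zs + Suc j = k" "traced k wgt (val m) (r1 rS) zs"
       "\<And>i. i < length zs \<Longrightarrow> m1 (?NB + Suc j + i) = os ! (zs ! i)"
      and same: "\<And>z. z < ?NB \<Longrightarrow> m1 z = m z" and NB: "r1 rNew = ?NB" "tables m1"
      and ag: "agree ?X r r1" and zero: "\<And>z. ?NB + k \<le> z \<Longrightarrow> m1 z = 0"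
      using 4(2) unfolding I_def by blast
    define S where "S = r1 rS"
    define x where "x = ch m S"
    have x: "x < k" "2 ^ x \<le> S" "traced k wgt (val m) (S - 2 ^ x) (x # zs)"
      using traced_step[OF zs(2) sound] zs(1) by (auto simp: S_def x_def)
    have S: "S < 2 ^ k"
      using zs(2) by (simp add: traced_def S_def)
    have load: "m1 (CB + S) = x" "m1 (OB + x) = os ! x"
      using assms(2) x S k by (auto simp: same ch_def x_def good_def store_def CB_def VB_def)
    let ?m = "m1(?NB + j := os ! x)"
    have tab: "tables ?m"
      using OB by (intro tables_upd NB) (simp add: CB_def VB_def)
    have pow: "m1 (PB + x) = 2 ^ x" "PB + x \<noteq> ?NB + j"
      using x(1) k NB(2) OB by (auto simp: tables_def CB_def VB_def)
    have "?m (?NB + j + i) = os ! ((x # zs) ! i)" if "i < length (x # zs)" for i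
      using that zs(3)[of "i - 1"] by (cases i) auto
    then have "I j r2 ?m" if "agree ({17..32} \<union> {rI}) r1 r2" "r2 rS = S - 2 ^ x" for r2
      unfolding I_def
    proof (intro conjI exI[of _ "x # zs"])
      show "agree ?X r r2"
        by (rule agree_trans[OF ag that(1)]) auto
      show "r2 rNew = ?NB"
        using agreeD[OF that(1), of rNew] NB(1) by simp
    qed (use that(2) x(3) zs(1) tab same zero in auto)
    then show ?case
      using pow by (simp add: read_off_def regs1 NB load S_def[symmetric])
  next
    case (5 r1 m1 \<tau>1)
    then obtain zs where zs: "length zs = k" "traced k wgt (val m) (r1 rS) zs"
       "\<And>i. i < length zs \<Longrightarrow> m1 (?NB + i) = os ! (zs ! i)"
      unfolding I_def by auto
    note tr = traced_final[OF zs(2) sound zs(1)]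
    have "lcost wgt zs \<le> lcost wgt zs'" if "windowed_list k D zs'" for zs'
      using tr(3) final[OF that] by (simp add: better_def)
    then show ?case
      using 5 tr zs(1,3) by (intro Q[of r1 zs]) (auto simp: I_def traceback_cost_def)
  qed simp
qed

end

text \<open>What an insertion guarantees unconditionally. That beating the windowed competitors
  means true optimality is left to \<open>best_insertion\<close>, for typical signals.\<close>

definition next_order :: "(nat \<Rightarrow> nat \<Rightarrow> nat) \<Rightarrow> nat \<Rightarrow> nat \<Rightarrow> nat list \<Rightarrow> nat list \<Rightarrow> bool" where
  "next_order f D k ys ys' \<longleftrightarrow> distinct ys' \<and> set ys' = {1..Suc k} \<and>
     (\<forall>zs. windowed_list (Suc k) D zs \<longrightarrow> lcost f ys' \<le> lcost f (map ((!) (ys @ [Suc k])) zs))"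

context layout
begin

definition holds :: "(nat \<Rightarrow> nat) \<Rightarrow> nat \<Rightarrow> nat \<Rightarrow> nat list \<Rightarrow> bool" where
  "holds m OB k ys \<longleftrightarrow> tables m \<and> PB + (n + 2 * D + 1) \<le> OB \<and> distinct ys \<and> set ys = {1..k} \<and>
     (\<forall>j < k. m (OB + j) = ys ! j) \<and> (\<forall>z \<ge> OB + k. m z = 0)"

text \<open>\<open>search_cost + traceback_cost + 40\<close> with every \<open>k\<close> enlarged to
  \<open>n\<close>, so that it is the same for all stages.\<close>

definition "insertion_cost =
  n * (2 ^ (2 * D) * (2 * (n * (n * 30 + 60) + 10) + 34) + 34) + 10 + (n * 30 + 20) + 40"

lemma wp_insertion:
  assumes "globals r" "r rOrd = OB" "r rK = k" "k < n" "holds m OB k ys"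
    and Q: "\<And>r' m' \<tau>' OB' ys'. agree ({10} \<union> {12..37} \<union> {39, 40}) r r' \<Longrightarrow> r' rOrd = OB' \<Longrightarrow>
      r' rK = Suc k \<Longrightarrow> holds m' OB' (Suc k) ys' \<Longrightarrow> next_order f D k ys ys' \<Longrightarrow>
      \<tau>' \<le> \<tau> + insertion_cost \<Longrightarrow> Q r' m' \<tau>'"
  shows "wp insertion Q r m \<tau>"
proof -
  let ?os = "ys @ [Suc k]" and ?X = "{10} \<union> {12..37} \<union> {39, 40::nat}"
  have len: "length ys = k"
    using assms(5) distinct_card[of ys] by (simp add: holds_def)
  interpret stage n D MB PB f OB "Suc k" ?os
    using assms(4,5) len by unfold_locales (auto simp: holds_def)
  let ?m = "m(OB + k := Suc k, VB := 1)"
  have regs: "r rN = n" "r rOne = 1" "r rPow = PB" "r rZero = 0"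
    using assms(1) by (auto simp: globals_def)
  have load: "m (PB + k) = 2 ^ k"
    using assms(4,5) by (simp add: holds_def tables_def)
  have tab: "tables ?m"
    using assms(5) OB by (intro tables_upd) (auto simp: holds_def VB_def)
  have zero: "?m z = 0" if "VB < z" for z
    using that assms(4,5) by (auto simp: holds_def VB_def)
  have ord: "?m (OB + j) = ?os ! j" if "j < Suc k" for j
    using that assms(4,5) len by (auto simp: holds_def VB_def nth_append less_Suc_eq)
  have "store ?m"
    using tab ord zero unfolding store_def by (auto simp: CB_def)
  moreover have "val ?m S = (if S = 0 then 1 else 0)" for S
    using zero[of "VB + S"] by (simp add: val_def)
  ultimately have good: "good ?m"
    by (simp add: good_def sound_def)
  let ?r = "r(rA := OB + k, rTop := 2 ^ k, rK := Suc k, rVal := OB + n, rFull := 2 ^ k + 2 ^ k,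
     rCh := OB + n + (2 ^ k + 2 ^ k))"
  have env: "env ?r"
    using assms(1,2) by (simp add: env_def globals_def VB_def CB_def)
  have ag: "agree ?X r ?r"
    by simp
  have VB: "OB + n = VB"
    by (simp add: VB_def)
  show ?thesis
  proof (simp add: insertion_def regs assms(2,3) load, fold One_nat_def, unfold VB,
      rule wp_search, goal_cases)
    case 1
    then show ?case
      using env by (simp add: VB_def fun_upd_twist)
  next
    case 2
    then show ?case
      using good by simp
  next
    case (3 r1 m1 \<tau>1)
    have env1: "env r1"
      by (rule env_agree[OF env, where X = "{17..37}"])
        (use 3(1) in \<open>auto simp: VB_def fun_upd_twist\<close>)
    show ?case
    proof (rule wp_traceback[OF env1 3(2,3)], goal_cases)
      case (1 r2 m2 \<tau>2 zs)
      have ag2: "agree ?X r r2"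
        using 3(1) 1(1) by (auto simp: agree_def)
      have lenz: "length zs = Suc k"
        using 1(3,4) distinct_card[of zs] by simp
      let ?ys = "map ((!) ?os) zs"
      have cost: "lcost wgt zs' = lcost f (map ((!) ?os) zs')" for zs'
        unfolding lcost_map wgt_def ..
      have dos: "distinct ?os" "set ?os = {1..Suc k}"
        using assms(5) by (auto simp: holds_def)
      have "distinct ?ys"
        unfolding distinct_map using 1(3,4) dos(1) len
        by (auto simp: inj_on_def nth_eq_iff_index_eq)
      moreover have "set ?ys = {1..Suc k}"
      proof -
        have "set ?ys = (!) ?os ` {..<length ?os}"
          using 1(4) len by simp
        also have "\<dots> = set ?os"
          using nth_image[of "length ?os" ?os] by (simp add: lessThan_atLeast0)
        finally show ?thesis
          using dos(2) by simp
      qed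
      ultimately have "next_order f D k ys ?ys" "holds m2 (CB + 2 ^ Suc k) (Suc k) ?ys"
        using 1(5-8) OB lenz unfolding next_order_def holds_def cost[symmetric]
        by (auto simp: CB_def VB_def)
      moreover have "r2 rNew = CB + 2 ^ Suc k" "r2 rZero = 0" "r2 rK = Suc k"
        using 1(2) agreeD[OF ag2, of rZero] regs agreeD[OF 1(1), of rK] env1 by (auto simp: env_def)
      moreover have "Suc (Suc (Suc \<tau>2)) \<le> \<tau> + insertion_cost"
      proof -
        have "relax_cost \<le> n * (n * 30 + 60) + 10"
          unfolding relax_cost_def using assms(4) by (intro add_mono mult_mono) auto
        then have "visit_cost + 4 \<le> 2 * (n * (n * 30 + 60) + 10) + 34"
          unfolding visit_cost_def by simp
        then have level: "level_cost + 4 \<le> 2 ^ (2 * D) * (2 * (n * (n * 30 + 60) + 10) + 34) + 34"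
          unfolding level_cost_def by simp
        have "search_cost \<le> n * (2 ^ (2 * D) * (2 * (n * (n * 30 + 60) + 10) + 34) + 34) + 10"
          unfolding search_cost_def using mult_le_mono[OF Suc_leI[OF assms(4)] level] by simp
        moreover have "traceback_cost \<le> n * 30 + 20"
          unfolding traceback_cost_def using assms(4) by simp
        ultimately show ?thesis
          using 3(4) 1(9) unfolding insertion_cost_def by linarith
      qed
      ultimately show ?case
        using ag2 by (simp, intro Q) auto
    qed
  qed
qed

end

text \<open>A relation rather than a function, since \<open>next_order\<close> leaves the choice
  among equally cheap orders open.\<close>

inductive orders :: "(nat \<Rightarrow> nat \<Rightarrow> nat) \<Rightarrow> nat \<Rightarrow> nat \<Rightarrow> nat list \<Rightarrow> bool" for f D where
  orders_0: "orders f D 0 []"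
| orders_Suc: "orders f D k ys \<Longrightarrow> next_order f D k ys ys' \<Longrightarrow> orders f D (Suc k) ys'"

lemma orders_set: "orders f D k ys \<Longrightarrow> distinct ys \<and> set ys = {1..k}"
  by (induction rule: orders.induct) (auto simp: next_order_def)

text \<open>Inverts the order into ranks. The cells \<open>1\<close> to \<open>n\<close> that it
  writes lie below both the signals and the stored order.\<close>

definition emit :: com where
  "emit = seqs [Instr (Add rA rOrd rI), Instr (Load rB rA), Instr (Add rT rI rOne),
     Instr (Store rB rT)]"

definition sort_loop :: com where
  "sort_loop = seqs [Instr (Add rKc rN rZero), countdown rKc insertion, Instr (Add rI rN rZero),
     countdown rI emit]"

context layout
begin

definition "sort_cost = n * (insertion_cost + 4) + n * 20 + 20"

lemma wp_sort_loop:
  assumes "globals r" "r rOrd = PB + (n + 2 * D + 1)" "r rK = 0" "tables m"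
    "\<And>z. PB + (n + 2 * D + 1) \<le> z \<Longrightarrow> m z = 0"
    and Q: "\<And>r' m' \<tau>' ys. orders f D n ys \<Longrightarrow> (\<And>j. j < n \<Longrightarrow> m' (ys ! j) = Suc j) \<Longrightarrow>
      \<tau>' \<le> \<tau> + sort_cost \<Longrightarrow> Q r' m' \<tau>'"
  shows "wp sort_loop Q r m \<tau>"
proof -
  define I where "I j r m \<longleftrightarrow> globals r \<and> r rK = n - j \<and>
    (\<exists>ys. orders f D (n - j) ys \<and> holds m (r rOrd) (n - j) ys)" for j :: nat and r m :: "nat \<Rightarrow> nat"
  have globals_agree: "globals r'" if "globals r" "agree ({10} \<union> {12..40}) r r'" for r r'
    using that(1) agreeD[OF that(2)] by (simp add: globals_def)
  have regs: "r rN = n" "r rZero = 0"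
    using assms(1) by (auto simp: globals_def)
  show ?thesis
  proof (simp add: sort_loop_def regs,
      rule wp_countdown[where N = n and I = I and B = insertion_cost], goal_cases)
    case 2
    have "holds m (PB + (n + 2 * D + 1)) 0 []"
      using assms(4,5) by (simp add: holds_def)
    then show ?case
      using assms(1-3) orders_0 by (auto simp: I_def globals_def)
  next
    case (3 j r1 m1)
    then show ?case by (auto simp: I_def globals_def)
  next
    case (4 j r1 m1 \<tau>1)
    have N: "n - j = Suc (n - Suc j)"
      using 4(1) by simp
    obtain ys where ys: "orders f D (n - Suc j) ys" "holds m1 (r1 rOrd) (n - Suc j) ys"
      and r1: "globals r1" "r1 rK = n - Suc j"
      using 4(2) unfolding I_def by blast
    have r1': "globals (r1(rKc := j))"
      using r1 by (simp add: globals_def)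
    show ?case
    proof (rule wp_insertion[OF r1', where k = "n - Suc j" and ys = ys], goal_cases)
      case (5 r2 m2 \<tau>2 OB' ys')
      have "globals r2"
        by (rule globals_agree[OF r1']) (use 5(1) in \<open>auto simp: agree_def\<close>)
      moreover have "r2 rKc = j"
        using agreeD[OF 5(1), of rKc] by simp
      moreover have "orders f D (n - j) ys'"
        unfolding N by (rule orders_Suc) fact+
      ultimately show ?case
        using 5 unfolding I_def N by auto
    qed (use 4(1) ys r1 in auto)
  next
    case (5 r1 m1 \<tau>1)
    then obtain ys where ys: "orders f D n ys" "holds m1 (r1 rOrd) n ys" and r1: "globals r1"
      by (auto simp: I_def)
    have items: "distinct ys" "set ys = {1..n}" "length ys = n"
      using orders_set[OF ys(1)] distinct_card[of ys] by auto
    have far: "n < r1 rOrd"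
      using ys(2) PB MB unfolding holds_def by linarith
    define J where "J j r' m' \<longleftrightarrow> r' rOne = 1 \<and> r' rOrd = r1 rOrd \<and> (\<forall>z > n. m' z = m1 z) \<and>
      (\<forall>i. j \<le> i \<and> i < n \<longrightarrow> m' (ys ! i) = Suc i)" for j :: nat and r' m' :: "nat \<Rightarrow> nat"
    have regs1: "r1 rN = n" "r1 rZero = 0"
      using r1 by (auto simp: globals_def)
    show ?case
    proof (simp add: regs1, rule wp_countdown[where N = n and I = J and B = 16], goal_cases)
      case 2
      then show ?case
        using r1 by (auto simp: J_def globals_def)
    next
      case (3 j r2 m2)
      then show ?case by (simp add: J_def)
    next
      case (4 j r2 m2 \<tau>2)
      have load: "m2 (r1 rOrd + j) = ys ! j"
        using 4(1,2) far ys(2) by (auto simp: J_def holds_def)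
      have le: "ys ! j \<le> n"
        using items 4(1) nth_mem[of j ys] by auto
      have neq: "ys ! j \<noteq> ys ! i" if "Suc j \<le> i" "i < n" for i
        using items that 4(1) by (simp add: nth_eq_iff_index_eq)
      have "J j r3 (m2(ys ! j := Suc j))" if "r3 rOne = 1" "r3 rOrd = r1 rOrd" for r3
        unfolding J_def
      proof (intro conjI allI impI)
        fix i assume i: "j \<le> i \<and> i < n"
        show "(m2(ys ! j := Suc j)) (ys ! i) = Suc i"
        proof (cases "i = j")
          case False
          then have "Suc j \<le> i" "i < n"
            using i by auto
          then show ?thesis
            using neq[of i] 4(2) by (auto simp: J_def)
        qed simp
      qed (use 4(2) le that in \<open>auto simp: J_def\<close>)
      moreover have "r2 rOne = 1" "r2 rOrd = r1 rOrd"
        using 4(2) by (auto simp: J_def)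
      ultimately show ?case
        using load by (simp add: emit_def)
    next
      case (5 r2 m2 \<tau>2)
      then show ?case
        using \<open>\<tau>1 \<le> _\<close> ys(1) by (intro Q[of ys]) (auto simp: J_def sort_cost_def)
    qed simp
  qed simp
qed

end

section \<open>Building the tables and the window width by additions alone\<close>

definition log2_ceil :: "nat \<Rightarrow> nat" where
  "log2_ceil n = (LEAST l. n \<le> 2 ^ l)"

lemma le_exp_log2_ceil: "n \<le> 2 ^ log2_ceil n"
  unfolding log2_ceil_def by (rule LeastI[of _ n]) (simp add: less_imp_le)

lemma log2_ceil_le: "n \<le> 2 ^ l \<Longrightarrow> log2_ceil n \<le> l"
  unfolding log2_ceil_def by (rule Least_le)

lemma exp_log2_ceil_le: "1 \<le> n \<Longrightarrow> 2 ^ log2_ceil n \<le> 2 * n"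
proof (cases "log2_ceil n")
  case (Suc l)
  then have "\<not> n \<le> 2 ^ l"
    using log2_ceil_le[of n l] by auto
  then show ?thesis
    by (simp add: Suc)
qed auto

text \<open>Doubling \<open>rQ\<close> until it reaches \<open>n\<close> replaces the logarithm;
  \<open>rSq\<close>, the square of \<open>rQ\<close>, and the window width \<open>rD\<close> are
  carried along by further additions.\<close>

definition scale :: com where
  "scale = seqs [Instr (Sub rT rN rQ), If rT (seqs [Instr (Add rQ rQ rQ), Instr (Add rSq rSq rSq),
     Instr (Add rSq rSq rSq), Instr (Add rD rD rStep)]) Skip]"

definition fill :: com where
  "fill = seqs [Instr (Store rA rV), Instr (Store rB rT), Instr (Add rA rA rOne),
     Instr (Add rB rB rOne), Instr (Add rV rV rN), Instr (Add rT rT rT)]"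

definition noisy_sort :: "nat \<Rightarrow> com" where
  "noisy_sort c = seqs [Instr (Const rOne 1), Instr (Const rStep c), Instr (Const rQ 1),
     Instr (Const rSq 1), Instr (Const rD c), Instr (Add rI rN rZero), countdown rI scale,
     Instr (Add rMul rSq rSq), Instr (Add rMul rMul rOne),
     Instr (Add rSz rN rD), Instr (Add rSz rSz rD), Instr (Add rSz rSz rOne),
     Instr (Add rPow rMul rSz), Instr (Add rOrd rPow rSz),
     Instr (Add rA rMul rZero), Instr (Add rB rPow rZero), Instr (Const rV 0), Instr (Const rT 1),
     Instr (Add rI rSz rZero), countdown rI fill,
     Instr (Add rA rPow rD), Instr (Add rA rA rD), Instr (Load rLim rA), sort_loop]"

text \<open>The summand 1 keeps the width positive and pays for the additive constant in
  \<open>half_width_large\<close>.\<close>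

definition half_width :: "nat \<Rightarrow> nat \<Rightarrow> nat" where
  "half_width c n = c * (log2_ceil n + 1)"

text \<open>The sign \<open>+\<close> from \<open>a\<close> to \<open>b\<close> speaks for
  \<open>b\<close> before \<open>a\<close>, so this is the price of placing \<open>a\<close> before
  \<open>b\<close>.\<close>

definition win :: "signals \<Rightarrow> nat \<Rightarrow> nat \<Rightarrow> nat" where
  "win s a b = of_bool (a \<noteq> b \<and> signal s a b)"

text \<open>A bound beyond the last input cell \<open>n * n + n\<close> that doublings can compute:
  \<open>4 ^ log2_ceil n\<close> is at least \<open>n * n\<close>.\<close>

definition table_base :: "nat \<Rightarrow> nat" where
  "table_base n = 2 * 4 ^ log2_ceil n + 1"

lemma layout_noisy_sort:
  assumes "0 < c"
  shows "layout n (half_width c n) (table_base n)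
    (table_base n + (n + 2 * half_width c n + 1)) (win s)"
proof
  have "n * n \<le> 2 ^ log2_ceil n * 2 ^ log2_ceil n"
    by (intro mult_le_mono le_exp_log2_ceil)
  also have "\<dots> = 4 ^ log2_ceil n"
    by (simp flip: power_mult_distrib)
  finally have "n * n \<le> 4 ^ log2_ceil n" .
  moreover from this have "n \<le> 4 ^ log2_ceil n"
    using le_square[of n] by linarith
  ultimately show "n * n + n < table_base n"
    unfolding table_base_def by linarith
qed (use assms in \<open>simp_all add: half_width_def win_def\<close>)

definition "prepare_cost c n = n * 20 + (n + 2 * half_width c n + 1) * 20 + 60"

lemma wp_noisy_sort:
  assumes "0 < c" "1 \<le> n"
    and Q: "\<And>r' m' \<tau>' ys. orders (win s) (half_width c n) n ys \<Longrightarrow>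
      (\<And>j. j < n \<Longrightarrow> m' (ys ! j) = Suc j) \<Longrightarrow>
      \<tau>' \<le> prepare_cost c n + layout.sort_cost n (half_width c n) \<Longrightarrow> Q r' m' \<tau>'"
  shows "wp (noisy_sort c) Q ((\<lambda>_. 0)(0 := n)) (input_memory n s) 0"
proof -
  define D where "D = half_width c n"
  define MB where "MB = table_base n"
  define L where "L = log2_ceil n"
  define SZ where "SZ = n + 2 * D + 1"
  interpret layout n D MB "MB + SZ" "win s"
    unfolding D_def MB_def SZ_def by (rule layout_noisy_sort) fact
  let ?m = "input_memory n s"
  \<comment> \<open>Either the doubling is complete or each round so far has doubled; at
    \<open>j = 0\<close>, with \<open>L <= n\<close>, both mean \<open>l = L\<close>.\<close>
  define I where "I j r m \<longleftrightarrow> m = ?m \<and> (\<exists>l \<le> L. (l = L \<or> n \<le> l + j) \<and> r rN = n \<and> r rOne = 1 \<and>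
    r rZero = 0 \<and> r rStep = c \<and> r rQ = 2 ^ l \<and> r rSq = 4 ^ l \<and> r rD = c * (l + 1) \<and> r rK = 0)"
    for j :: nat and r m :: "nat \<Rightarrow> nat"
  \<comment> \<open>\<open>rLim\<close> is exempt: it is loaded from the table of powers only after
    this loop has filled it.\<close>
  define J where "J j r m \<longleftrightarrow> globals (r(rLim := 2 ^ (2 * D))) \<and> r rK = 0 \<and> r rOrd = MB + SZ + SZ \<and>
    r rA = MB + (SZ - j) \<and> r rB = MB + SZ + (SZ - j) \<and> r rV = (SZ - j) * n \<and> r rT = 2 ^ (SZ - j) \<and>
    (\<forall>i < SZ - j. m (MB + i) = i * n \<and> m (MB + SZ + i) = 2 ^ i) \<and>
    (\<forall>z < MB. m z = ?m z) \<and> (\<forall>z \<ge> MB + SZ + SZ. m z = 0)"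
    for j :: nat and r m :: "nat \<Rightarrow> nat"
  show ?thesis
  proof (simp add: noisy_sort_def, rule wp_countdown[where N = n and I = I and B = 16], goal_cases)
    case 2
    then show ?case
      by (auto simp: I_def intro!: exI[of _ 0])
  next
    case (3 j r1 m1)
    then show ?case by (auto simp: I_def)
  next
    case (4 j r1 m1 \<tau>1)
    then obtain l where l: "l \<le> L" "l = L \<or> n \<le> l + Suc j" and r1: "m1 = ?m" "r1 rN = n"
        "r1 rOne = 1" "r1 rZero = 0" "r1 rStep = c" "r1 rQ = 2 ^ l" "r1 rSq = 4 ^ l"
        "r1 rD = c * (l + 1)" "r1 rK = 0"
      unfolding I_def by blast
    show ?case
    proof (cases "l < L")
      case True
      then have less: "2 ^ l < n"
        using log2_ceil_le[of n l] unfolding L_def by (meson leD not_le_imp_less)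
      have "I j r2 ?m" if "r2 rN = n" "r2 rOne = 1" "r2 rZero = 0" "r2 rStep = c"
          "r2 rQ = 2 ^ Suc l" "r2 rSq = 4 ^ Suc l" "r2 rD = c * (Suc l + 1)" "r2 rK = 0" for r2
        using that True l unfolding I_def by (intro conjI exI[of _ "Suc l"]) auto
      then show ?thesis
        using less by (simp add: scale_def r1)
    next
      case False
      then have "l = L" "n \<le> 2 ^ l"
        using l le_exp_log2_ceil[of n] by (auto simp: L_def)
      moreover have "I j r2 ?m" if "r2 rN = n" "r2 rOne = 1" "r2 rZero = 0" "r2 rStep = c"
          "r2 rQ = 2 ^ L" "r2 rSq = 4 ^ L" "r2 rD = c * (L + 1)" "r2 rK = 0" for r2
        using that unfolding I_def by auto
      ultimately show ?thesis
        by (simp add: scale_def r1)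
    qed
  next
    case (5 r1 m1 \<tau>1)
    have "L \<le> n"
      unfolding L_def by (rule log2_ceil_le) (simp add: less_imp_le)
    then have r1: "m1 = ?m" "r1 rN = n" "r1 rOne = 1" "r1 rZero = 0" "r1 rSq = 4 ^ L" "r1 rD = D"
       "r1 rK = 0"
      using 5(2) unfolding I_def D_def half_width_def L_def[symmetric] by auto
    have MB': "4 ^ L + 4 ^ L + 1 = MB" and SZ': "n + D + D + 1 = SZ"
      by (simp_all add: MB_def table_base_def L_def SZ_def)
    have input_zero: "?m z = 0" if "MB \<le> z" for z
    proof -
      have "(n + 1) * n \<le> z - 1"
        using that MB by simp
      then have "n + 1 \<le> (z - 1) div n"
        using assms(2) by (simp add: less_eq_div_iff_mult_less_eq)
      then show ?thesis
        by (simp add: input_memory_def Let_def)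
    qed
    show ?case
    proof (simp add: r1 MB'[simplified] SZ'[simplified],
        rule wp_countdown[where N = SZ and I = J and B = 16], goal_cases)
      case 2
      then show ?case
        using input_zero by (simp add: J_def globals_def r1)
    next
      case (3 j r2 m2)
      then show ?case by (simp add: J_def globals_def)
    next
      case (4 j r2 m2 \<tau>2)
      have N: "SZ - j = Suc (SZ - Suc j)"
        using 4(1) by simp
      let ?i = "SZ - Suc j"
      have r2: "r2 rA = MB + ?i" "r2 rB = MB + SZ + ?i" "r2 rV = ?i * n" "r2 rT = 2 ^ ?i"
          "r2 rOne = 1" "r2 rN = n"
        using 4(2) by (auto simp: J_def globals_def)
      let ?m2 = "m2(MB + ?i := ?i * n, MB + SZ + ?i := 2 ^ ?i)"
      have "J j r3 ?m2" if "globals (r3(rLim := 2 ^ (2 * D)))" "r3 rK = 0" "r3 rOrd = MB + SZ + SZ"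
          "r3 rA = MB + Suc ?i" "r3 rB = MB + SZ + Suc ?i" "r3 rV = Suc ?i * n" "r3 rT = 2 ^ Suc ?i" for r3
        unfolding J_def N
      proof (intro conjI allI impI)
        fix i assume "i < Suc ?i"
        then have "i = ?i \<or> i < ?i" "i < SZ" "?i < SZ"
          using 4(1) by auto
        then show "?m2 (MB + i) = i * n" "?m2 (MB + SZ + i) = 2 ^ i"
          using 4(2) unfolding J_def by auto
      next
        fix z assume "z < MB"
        then show "?m2 z = ?m z"
          using 4(2) unfolding J_def by simp
      next
        fix z assume "MB + SZ + SZ \<le> z"
        moreover from this have "z \<noteq> MB + ?i" "z \<noteq> MB + SZ + ?i"
          using 4(1) by linarith+
        ultimately show "?m2 z = 0"
          using 4(2) unfolding J_def by simp
      qed (use that in auto)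
      moreover have "globals (r2(rLim := 2 ^ (2 * D)))" "r2 rK = 0" "r2 rOrd = MB + SZ + SZ"
        using 4(2) by (auto simp: J_def)
      ultimately show ?case
        by (simp add: fill_def r2 globals_def)
    next
      case (5 r2 m2 \<tau>2)
      have inv: "globals (r2(rLim := 2 ^ (2 * D)))" "r2 rK = 0" "r2 rOrd = MB + SZ + SZ"
        "\<And>i. i < SZ \<Longrightarrow> m2 (MB + i) = i * n \<and> m2 (MB + SZ + i) = 2 ^ i"
        "\<And>z. z < MB \<Longrightarrow> m2 z = ?m z" "\<And>z. MB + SZ + SZ \<le> z \<Longrightarrow> m2 z = 0"
        using 5(2) by (auto simp: J_def)
      have r2: "r2 rPow = MB + SZ" "r2 rD = D"
        using inv(1) by (auto simp: globals_def)
      have load: "m2 (MB + SZ + D + D) = 2 ^ (2 * D)"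
        using inv(4)[of "D + D"] by (simp add: SZ_def mult_2 add.assoc)
      have "tables m2"
        unfolding tables_def
      proof (intro conjI ballI allI impI)
        fix a b assume ab: "a \<in> {1..n}" "b \<in> {1..n}"
        have "a * n \<le> n * n" "b \<le> n"
          using ab by simp_all
        then have "a * n + b < MB"
          using MB by linarith
        then show "m2 (a * n + b) = win s a b"
          using inv(5) input_memory_cell[OF ab, of s] by (simp add: win_def)
      qed (use inv(4) in \<open>auto simp: SZ_def\<close>)
      show ?case
      proof (simp add: r2 load, rule wp_sort_loop[OF _ _ _ \<open>tables m2\<close>], goal_cases)
        case 1
        then show ?case
          using inv(1) by (simp add: globals_def)
      next
        case (5 r3 m3 \<tau>3 ys)
        then show ?case
          using \<open>\<tau>1 \<le> _\<close> \<open>\<tau>2 \<le> _\<close>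
          by (intro Q[of ys]) (auto simp: D_def[symmetric] prepare_cost_def SZ_def)
      qed (use inv in \<open>auto simp: SZ_def\<close>)
    qed simp
  qed simp
qed

section \<open>Costs and inversions\<close>

definition best :: "(nat \<Rightarrow> nat \<Rightarrow> nat) \<Rightarrow> nat \<Rightarrow> nat list \<Rightarrow> bool" where
  "best w k xs \<longleftrightarrow> distinct xs \<and> set xs = {1..k} \<and>
     (\<forall>ys. distinct ys \<longrightarrow> set ys = {1..k} \<longrightarrow> lcost w xs \<le> lcost w ys)"

lemma sum_list_mset_cong:
  fixes g :: "'a \<Rightarrow> 'b :: comm_monoid_add"
  shows "mset xs = mset ys \<Longrightarrow> (\<Sum>x\<leftarrow>xs. g x) = (\<Sum>x\<leftarrow>ys. g x)"
  by (metis mset_map sum_mset_sum_list)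

text \<open>Exchange argument: permuting a contiguous block leaves its costs against the rest
  unchanged.\<close>

lemma best_block:
  assumes "best w k (us @ xs @ vs)" "mset xs = mset ys"
  shows "lcost w xs \<le> lcost w ys"
proof -
  have "mset (us @ ys @ vs) = mset (us @ xs @ vs)"
    using assms(2) by simp
  then have "lcost w (us @ xs @ vs) \<le> lcost w (us @ ys @ vs)"
    using assms(1) unfolding best_def by (metis mset_eq_imp_distinct_iff mset_eq_setD)
  moreover have "(\<Sum>u\<leftarrow>us. \<Sum>y\<leftarrow>xs. w u y) = (\<Sum>u\<leftarrow>us. \<Sum>y\<leftarrow>ys. w u y)"
    by (simp only: sum_list_mset_cong[OF assms(2)])
  moreover have "(\<Sum>x\<leftarrow>xs. \<Sum>y\<leftarrow>vs. w x y) = (\<Sum>x\<leftarrow>ys. \<Sum>y\<leftarrow>vs. w x y)"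
    by (rule sum_list_mset_cong) fact
  ultimately show ?thesis
    by (simp add: lcost_append sum_list_addf)
qed

lemma best_exists: "\<exists>xs. best w k xs"
proof -
  let ?P = "\<lambda>xs. distinct xs \<and> set xs = {1..k}"
  have "?P [1..<Suc k]"
    by (simp only: distinct_upt set_upt atLeastLessThanSuc_atLeastAtMost simp_thms)
  then obtain xs where "?P xs" "\<forall>ys. ?P ys \<longrightarrow> lcost w xs \<le> lcost w ys"
    using ex_has_least_nat[of ?P _ "lcost w"] by blast
  then show ?thesis
    unfolding best_def by blast
qed

text \<open>Inverted pairs are oriented along the true order, not along the list, so
  \<open>w i j = 1\<close> on them marks a wrong signal.\<close>

primrec inv_pairs :: "('a \<Rightarrow> nat) \<Rightarrow> 'a list \<Rightarrow> ('a \<times> 'a) set" where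
  "inv_pairs \<pi> [] = {}"
| "inv_pairs \<pi> (x # xs) = (\<lambda>y. (y, x)) ` {y \<in> set xs. \<pi> y < \<pi> x} \<union> inv_pairs \<pi> xs"

lemma inv_pairs_subset: "inv_pairs \<pi> xs \<subseteq> {(i, j). i \<in> set xs \<and> j \<in> set xs \<and> \<pi> i < \<pi> j}"
  by (induction xs) auto

lemma finite_inv_pairs: "finite (inv_pairs \<pi> xs)"
  by (induction xs) auto

lemma inv_pairs_nth:
  "a < b \<Longrightarrow> b < length xs \<Longrightarrow> \<pi> (xs ! b) < \<pi> (xs ! a) \<Longrightarrow> (xs ! b, xs ! a) \<in> inv_pairs \<pi> xs"
proof (induction xs arbitrary: a b)
  case (Cons x xs)
  then show ?case
    by (cases a; cases b) auto
qed simp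

lemma inv_pairs_sorted: "sorted (map \<pi> xs) \<Longrightarrow> inv_pairs \<pi> xs = {}"
  by (induction xs) auto

definition order_cost :: "('a \<Rightarrow> 'a \<Rightarrow> nat) \<Rightarrow> ('a \<Rightarrow> nat) \<Rightarrow> 'a set \<Rightarrow> nat" where
  "order_cost w \<pi> S = (\<Sum>(i, j) \<in> {(i, j). i \<in> S \<and> j \<in> S \<and> \<pi> i < \<pi> j}. w i j)"

lemma order_cost_insert:
  assumes "finite S" "x \<notin> S"
  shows "order_cost w \<pi> (insert x S) =
    order_cost w \<pi> S + (\<Sum>y | y \<in> S \<and> \<pi> x < \<pi> y. w x y) + (\<Sum>y | y \<in> S \<and> \<pi> y < \<pi> x. w y x)"
proof -
  let ?A = "{(i, j). i \<in> S \<and> j \<in> S \<and> \<pi> i < \<pi> j}"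
  let ?B = "Pair x ` {y. y \<in> S \<and> \<pi> x < \<pi> y}" and ?C = "(\<lambda>y. (y, x)) ` {y. y \<in> S \<and> \<pi> y < \<pi> x}"
  have "{(i, j). i \<in> insert x S \<and> j \<in> insert x S \<and> \<pi> i < \<pi> j} = ?A \<union> ?B \<union> ?C"
    by auto
  moreover have fin: "finite ?A" "finite ?B" "finite ?C"
    using assms(1) finite_subset[of ?A "S \<times> S"] by auto
  moreover have "?A \<inter> ?B = {}" "(?A \<union> ?B) \<inter> ?C = {}"
    using assms(2) by auto
  ultimately have "order_cost w \<pi> (insert x S) =
      order_cost w \<pi> S + (\<Sum>(i, j) \<in> ?B. w i j) + (\<Sum>(i, j) \<in> ?C. w i j)"
    unfolding order_cost_def by (simp add: sum.union_disjoint)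
  moreover have "(\<Sum>(i, j) \<in> ?B. w i j) = (\<Sum>y | y \<in> S \<and> \<pi> x < \<pi> y. w x y)"
    by (subst sum.reindex) (auto simp: inj_on_def)
  moreover have "(\<Sum>(i, j) \<in> ?C. w i j) = (\<Sum>y | y \<in> S \<and> \<pi> y < \<pi> x. w y x)"
    by (subst sum.reindex) (auto simp: inj_on_def)
  ultimately show ?thesis
    by simp
qed

text \<open>An inverted pair \<open>(i, j)\<close> is charged \<open>w j i = 1 - w i j\<close> in
  the list but \<open>w i j\<close> in the true order; all other pairs are charged alike.\<close>

lemma lcost_inversions:
  assumes "distinct xs" "inj_on \<pi> (set xs)"
    and compl: "\<And>i j. i \<noteq> j \<Longrightarrow> w i j + w j i = (1::nat)"
  shows "lcost w xs + 2 * (\<Sum>(i, j) \<in> inv_pairs \<pi> xs. w i j) =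
    order_cost w \<pi> (set xs) + card (inv_pairs \<pi> xs)"
  using assms(1,2)
proof (induction xs)
  case (Cons x xs)
  let ?L = "{y. y \<in> set xs \<and> \<pi> y < \<pi> x}" and ?R = "{y. y \<in> set xs \<and> \<pi> x < \<pi> y}"
  let ?I = "(\<lambda>y. (y, x)) ` ?L"
  have split: "set xs = ?L \<union> ?R"
    using Cons.prems by (fastforce simp: inj_on_def)
  have "(\<Sum>y \<in> ?L \<union> ?R. w x y) = (\<Sum>y \<in> ?L. w x y) + (\<Sum>y \<in> ?R. w x y)"
    by (rule sum.union_disjoint) auto
  then have "(\<Sum>y \<in> set xs. w x y) = (\<Sum>y \<in> ?L. w x y) + (\<Sum>y \<in> ?R. w x y)"
    using split by simp
  moreover have "(\<Sum>y\<leftarrow>xs. w x y) = (\<Sum>y \<in> set xs. w x y)"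
    using Cons.prems by (simp add: sum_list_distinct_conv_sum_set)
  moreover have "(\<Sum>y \<in> ?L. w x y) + (\<Sum>y \<in> ?L. w y x) = card ?L"
  proof -
    have "(\<Sum>y \<in> ?L. w x y + w y x) = (\<Sum>y \<in> ?L. 1)"
      using Cons.prems by (intro sum.cong compl) auto
    then show ?thesis
      by (simp add: sum.distrib)
  qed
  moreover have disj: "?I \<inter> inv_pairs \<pi> xs = {}"
    using inv_pairs_subset[of \<pi> xs] Cons.prems by auto
  have "card (inv_pairs \<pi> (x # xs)) = card ?L + card (inv_pairs \<pi> xs)"
    using disj by (simp add: card_Un_disjoint finite_inv_pairs card_image inj_on_def)
  moreover have "(\<Sum>(i, j) \<in> inv_pairs \<pi> (x # xs). w i j) =
      (\<Sum>y \<in> ?L. w y x) + (\<Sum>(i, j) \<in> inv_pairs \<pi> xs. w i j)"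
    using disj by (simp add: sum.union_disjoint finite_inv_pairs sum.reindex inj_on_def)
  moreover have "order_cost w \<pi> (set (x # xs)) =
      order_cost w \<pi> (set xs) + (\<Sum>y \<in> ?R. w x y) + (\<Sum>y \<in> ?L. w y x)"
    using Cons.prems by (simp add: order_cost_insert)
  ultimately show ?case
    using Cons by simp
qed (simp add: order_cost_def)

lemma lcost_sorted:
  assumes "distinct xs" "inj_on \<pi> (set xs)" "sorted (map \<pi> xs)"
    and "\<And>i j. i \<noteq> j \<Longrightarrow> w i j + w j i = (1::nat)"
  shows "lcost w xs = order_cost w \<pi> (set xs)"
  using lcost_inversions[OF assms(1,2,4)] inv_pairs_sorted[OF assms(3)] by simp

text \<open>Sorting the block by the true order cannot make it cheaper, so at least half of its
  inverted pairs carry a wrong signal.\<close>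

lemma best_block_inversions:
  assumes "best w k (us @ xs @ vs)" "inj_on \<pi> (set xs)"
    and compl: "\<And>i j. i \<noteq> j \<Longrightarrow> w i j + w j i = (1::nat)"
  shows "card (inv_pairs \<pi> xs) \<le> 2 * (\<Sum>(i, j) \<in> inv_pairs \<pi> xs. w i j)"
proof -
  let ?ys = "sort_key \<pi> xs"
  have "distinct xs"
    using assms(1) by (simp add: best_def)
  moreover have "lcost w ?ys = order_cost w \<pi> (set ?ys)"
    using assms(2) \<open>distinct xs\<close> compl by (intro lcost_sorted) auto
  moreover have "lcost w xs \<le> lcost w ?ys"
    using assms(1) by (rule best_block) simp
  ultimately show ?thesis
    using lcost_inversions[of xs \<pi> w] assms(2) compl by simp
qed

section \<open>Displacement of optimal orders\<close>

definition true_rank :: "(nat \<Rightarrow> nat) \<Rightarrow> nat \<Rightarrow> nat \<Rightarrow> nat" where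
  "true_rank \<pi> k j = card {i \<in> {1..k}. \<pi> i < \<pi> j}"

lemma true_rank_less_iff:
  assumes "i \<in> {1..k}" "j \<in> {1..k}"
  shows "true_rank \<pi> k i < true_rank \<pi> k j \<longleftrightarrow> \<pi> i < \<pi> j"
proof -
  have mono: "true_rank \<pi> k a < true_rank \<pi> k b" if "a \<in> {1..k}" "\<pi> a < \<pi> b" for a b
    unfolding true_rank_def using that by (intro psubset_card_mono) auto
  have "\<pi> i < \<pi> j \<or> \<pi> i = \<pi> j \<or> \<pi> j < \<pi> i"
    by auto
  moreover have "true_rank \<pi> k i = true_rank \<pi> k j" if "\<pi> i = \<pi> j"
    using that by (simp add: true_rank_def)
  ultimately show ?thesis
    using mono[OF assms(1), of j] mono[OF assms(2), of i] by auto
qed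

lemma true_rank_bij:
  assumes "inj_on \<pi> {1..k}"
  shows "bij_betw (true_rank \<pi> k) {1..k} {..<k}"
proof -
  have inj: "inj_on (true_rank \<pi> k) {1..k}"
    using assms true_rank_less_iff[of _ k _ \<pi>] unfolding inj_on_def by (metis less_irrefl nat_neq_iff)
  have "true_rank \<pi> k j < k" if "j \<in> {1..k}" for j
  proof -
    have "true_rank \<pi> k j \<le> card ({1..k} - {j})"
      unfolding true_rank_def by (intro card_mono) auto
    then show ?thesis
      using that by (cases k) auto
  qed
  then have "true_rank \<pi> k ` {1..k} \<subseteq> {..<k}"
    by auto
  with inj show ?thesis
    using card_image[OF inj] card_subset_eq[of "{..<k}" "true_rank \<pi> k ` {1..k}"] by (simp add: bij_betw_def)
qed

text \<open>The source of the \<open>+ 1\<close> in the required window width: one new item shifts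
  ranks by at most 1.\<close>

lemma true_rank_Suc: "true_rank \<pi> k j \<le> true_rank \<pi> (Suc k) j" "true_rank \<pi> (Suc k) j \<le> Suc (true_rank \<pi> k j)"
proof -
  have "{i \<in> {1..Suc k}. \<pi> i < \<pi> j} \<subseteq> insert (Suc k) {i \<in> {1..k}. \<pi> i < \<pi> j}"
    by auto
  then have "true_rank \<pi> (Suc k) j \<le> card (insert (Suc k) {i \<in> {1..k}. \<pi> i < \<pi> j})"
    unfolding true_rank_def by (intro card_mono) auto
  then show "true_rank \<pi> (Suc k) j \<le> Suc (true_rank \<pi> k j)"
    unfolding true_rank_def by (rule order_trans) (simp add: card_insert_le_m1 card_insert_if)
  show "true_rank \<pi> k j \<le> true_rank \<pi> (Suc k) j"
    unfolding true_rank_def by (intro card_mono) auto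
qed

text \<open>For pairs oriented by the true order, wrong signals have mean \<open>1 / 2 - lam\<close>
  each; the threshold lies midway between this and the \<open>1 / 2\<close> that optimality would
  force. Being strict, it fails for empty \<open>P\<close>.\<close>

definition typical :: "real \<Rightarrow> (nat \<Rightarrow> nat \<Rightarrow> nat) \<Rightarrow> (nat \<times> nat) set \<Rightarrow> bool" where
  "typical lam w P \<longleftrightarrow> real (\<Sum>(i, j) \<in> P. w i j) < (1 / 2 - lam / 2) * card P"

definition between :: "(nat \<Rightarrow> nat) \<Rightarrow> nat \<Rightarrow> nat \<Rightarrow> nat \<Rightarrow> nat set" where
  "between \<pi> k i u = {j \<in> {1..k}. \<pi> i < \<pi> j \<and> \<pi> j \<le> \<pi> u \<or> \<pi> u \<le> \<pi> j \<and> \<pi> j < \<pi> i}"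

text \<open>The item \<open>i\<close> against a whole interval of the true order that starts next to
  it. At most \<open>n ^ 3\<close> choices of \<open>k\<close>, \<open>i\<close>, \<open>u\<close>
  keep the union bound cheap.\<close>

definition star :: "(nat \<Rightarrow> nat) \<Rightarrow> nat \<Rightarrow> nat \<Rightarrow> nat \<Rightarrow> (nat \<times> nat) set" where
  "star \<pi> k i u = (\<lambda>j. if \<pi> i < \<pi> j then (i, j) else (j, i)) ` between \<pi> k i u"

lemma card_star: "card (star \<pi> k i u) = card (between \<pi> k i u)"
  unfolding star_def by (rule card_image) (auto simp: inj_on_def between_def split: if_splits)

text \<open>The last two assumptions carry all the probability. The factor \<open>length ws\<close>
  pays for the \<open>n ^ length ws\<close> sequences in the union bound.\<close>

locale typical_signals =
  fixes lam h :: real and w :: "nat \<Rightarrow> nat \<Rightarrow> nat" and \<pi> :: "nat \<Rightarrow> nat" and n :: nat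
  assumes lam: "0 < lam" "lam < 1" and h: "0 < h" and inj: "inj_on \<pi> {1..n}"
    and compl: "\<And>i j. i \<noteq> j \<Longrightarrow> w i j + w j i = 1"
    and typical_inv: "\<And>ws. distinct ws \<Longrightarrow> set ws \<subseteq> {1..n} \<Longrightarrow>
      h * length ws < card (inv_pairs \<pi> ws) \<Longrightarrow> typical lam w (inv_pairs \<pi> ws)"
    and typical_star: "\<And>k i u. k \<le> n \<Longrightarrow> i \<in> {1..n} \<Longrightarrow> u \<in> {1..n} \<Longrightarrow>
      h \<le> card (between \<pi> k i u) \<Longrightarrow> typical lam w (star \<pi> k i u)"
begin

section \<open>Displacement in one fixed optimal order\<close>

context
  fixes k :: nat and xs :: "nat list"
  assumes k: "k \<le> n" and best: "best w k xs"
begin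

definition rk :: "nat \<Rightarrow> nat" where
  "rk p = true_rank \<pi> k (xs ! p)"

definition up :: "nat \<Rightarrow> nat set" where
  "up t = {p. p < k \<and> t \<le> p \<and> rk p < t}"

definition down :: "nat \<Rightarrow> nat set" where
  "down t = {p. p < t \<and> t \<le> rk p}"

lemma xs: "distinct xs" "set xs = {1..k}" "length xs = k"
  using best distinct_card[of xs] by (auto simp: best_def)

lemma xs_nth: "p < k \<Longrightarrow> xs ! p \<in> {1..k}"
  using xs nth_mem by blast

lemma xs_nth_eq: "a < k \<Longrightarrow> b < k \<Longrightarrow> xs ! a = xs ! b \<longleftrightarrow> a = b"
  using xs by (simp add: nth_eq_iff_index_eq)

lemma inj_k: "inj_on \<pi> {1..k}"
  by (rule inj_on_subset[OF inj]) (use k in auto)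

lemma rk_bij: "bij_betw rk {..<k} {..<k}"
proof -
  have "bij_betw ((!) xs) {..<k} {1..k}"
    using bij_betw_nth[OF xs(1), of "{..<k}" "{1..k}"] xs by simp
  from bij_betw_trans[OF this true_rank_bij[OF inj_k]] show ?thesis
    by (simp add: rk_def[abs_def] comp_def)
qed

lemma rk_less: "p < k \<Longrightarrow> rk p < k"
  using bij_betwE[OF rk_bij] by auto

lemma rk_inj: "a < k \<Longrightarrow> b < k \<Longrightarrow> rk a = rk b \<longleftrightarrow> a = b"
  using bij_betw_imp_inj_on[OF rk_bij] by (auto simp: inj_on_def)

lemma rk_surj: "a < k \<Longrightarrow> \<exists>p < k. rk p = a"
  using bij_betw_imp_surj_on[OF rk_bij] by (metis imageE lessThan_iff)

lemma pi_less_iff: "a < k \<Longrightarrow> b < k \<Longrightarrow> \<pi> (xs ! a) < \<pi> (xs ! b) \<longleftrightarrow> rk a < rk b"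
  using true_rank_less_iff[OF xs_nth xs_nth, of a b \<pi>] by (simp add: rk_def)

lemma pi_le_iff: "a < k \<Longrightarrow> b < k \<Longrightarrow> \<pi> (xs ! a) \<le> \<pi> (xs ! b) \<longleftrightarrow> rk a \<le> rk b"
  using pi_less_iff[of b a] by (meson not_less)

lemma finite_up: "finite (up t)" and finite_down: "finite (down t)"
  by (simp_all add: up_def down_def)

text \<open>Exactly \<open>t\<close> positions and \<open>t\<close> true ranks lie below the cut, so
  as many items cross it one way as the other.\<close>

lemma card_down: "t \<le> k \<Longrightarrow> card (down t) = card (up t)"
proof -
  assume t: "t \<le> k"
  have "card {p \<in> {..<k}. rk p < t} = card {..<t}"
  proof (rule bij_betw_same_card)
    show "bij_betw rk {p \<in> {..<k}. rk p < t} {..<t}"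
      unfolding bij_betw_def
    proof
      show "inj_on rk {p \<in> {..<k}. rk p < t}"
        by (rule inj_on_subset[OF bij_betw_imp_inj_on[OF rk_bij]]) auto
      show "rk ` {p \<in> {..<k}. rk p < t} = {..<t}"
      proof (intro equalityI subsetI)
        fix a assume "a \<in> {..<t}"
        then obtain p where "p < k" "rk p = a"
          using rk_surj[of a] t by auto
        then show "a \<in> rk ` {p \<in> {..<k}. rk p < t}"
          using \<open>a \<in> {..<t}\<close> by auto
      qed auto
    qed
  qed
  moreover have "{p \<in> {..<k}. rk p < t} = {p. p < t \<and> rk p < t} \<union> up t"
    using t by (auto simp: up_def)
  moreover have "{..<t} = {p. p < t \<and> rk p < t} \<union> down t"
    by (auto simp: down_def)
  moreover have "card ({p. p < t \<and> rk p < t} \<union> up t) = card {p. p < t \<and> rk p < t} + card (up t)"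
    by (rule card_Un_disjoint) (auto simp: up_def)
  moreover have "card ({p. p < t \<and> rk p < t} \<union> down t) = card {p. p < t \<and> rk p < t} + card (down t)"
    by (rule card_Un_disjoint) (auto simp: down_def)
  ultimately show ?thesis
    by simp
qed

text \<open>The quantity \<open>M\<close> of the overview.\<close>

definition "flow = Max ((\<lambda>t. card (up t)) ` {..k})"

lemma card_up_le: "t \<le> k \<Longrightarrow> card (up t) \<le> flow"
  unfolding flow_def by (intro Max_ge) auto

lemma flow_attained: "\<exists>t \<le> k. card (up t) = flow"
proof -
  have "flow \<in> (\<lambda>t. card (up t)) ` {..k}"
    unfolding flow_def by (intro Max_in) auto
  then show ?thesis by auto
qed

text \<open>
  Moving the item at position \<open>p\<close> to its true rank does not help, so at least half of the items
  it passes vote for its current place. Up to \<open>2 * flow\<close> exceptions these are the items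
  whose true position lies between.
\<close>

lemma displacement_aux:
  assumes p: "p < k" and W: "W \<subseteq> {..<k}" "card W = d"
    and J: "J = {a \<in> {..<k}. rk p < rk a \<and> rk a \<le> r \<or> r \<le> rk a \<and> rk a < rk p}" "r < k" "card J = d"
    and exc: "card (W - J) \<le> 2 * flow"
    and vote: "d \<le> 2 * (\<Sum>a \<in> W. v a)"
    and v: "\<And>a. a \<in> J \<Longrightarrow> v a = (if rk p < rk a then w (xs ! p) (xs ! a) else w (xs ! a) (xs ! p))"
    and v_le: "\<And>a. a \<in> W \<Longrightarrow> v a \<le> 1"
  shows "real d \<le> max h (4 * flow / lam)"
proof (cases "h \<le> d")
  case True
  obtain u where u: "u < k" "rk u = r"
    using rk_surj J(2) by auto
  have between: "between \<pi> k (xs ! p) (xs ! u) = (!) xs ` J"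
  proof -
    have "{1..k} = (!) xs ` {..<k}"
      using xs by (auto simp: set_conv_nth)
    then have "between \<pi> k (xs ! p) (xs ! u) = (!) xs ` {a \<in> {..<k}.
        \<pi> (xs ! p) < \<pi> (xs ! a) \<and> \<pi> (xs ! a) \<le> \<pi> (xs ! u) \<or>
        \<pi> (xs ! u) \<le> \<pi> (xs ! a) \<and> \<pi> (xs ! a) < \<pi> (xs ! p)}"
      unfolding between_def by auto
    also have "\<dots> = (!) xs ` J"
      using p u unfolding J(1) by (intro arg_cong[of _ _ "\<lambda>X. (!) xs ` X"] Collect_cong)
        (auto simp: pi_less_iff pi_le_iff)
    finally show ?thesis .
  qed
  have inj_J: "inj_on ((!) xs) J"
    using xs_nth_eq J(1) by (auto simp: inj_on_def)
  have finJ: "finite J"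
    by (simp add: J(1))
  have card_b: "card (between \<pi> k (xs ! p) (xs ! u)) = d"
    unfolding between using card_image[OF inj_J] J(3) by simp
  have "typical lam w (star \<pi> k (xs ! p) (xs ! u))"
    using True xs_nth[of p] xs_nth[of u] p u k card_b by (intro typical_star) auto
  moreover have "(\<Sum>(i, j) \<in> star \<pi> k (xs ! p) (xs ! u). w i j) = (\<Sum>a \<in> J. v a)"
  proof -
    let ?g = "\<lambda>j. if \<pi> (xs ! p) < \<pi> j then (xs ! p, j) else (j, xs ! p)"
    have "inj_on ?g (between \<pi> k (xs ! p) (xs ! u))"
      by (auto simp: inj_on_def between_def split: if_splits)
    then have "(\<Sum>(i, j) \<in> star \<pi> k (xs ! p) (xs ! u). w i j) =
        (\<Sum>j \<in> (!) xs ` J. (case ?g j of (i, j) \<Rightarrow> w i j))"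
      unfolding star_def between by (subst sum.reindex) (auto simp: comp_def)
    also have "\<dots> = (\<Sum>a \<in> J. (case ?g (xs ! a) of (i, j) \<Rightarrow> w i j))"
      by (subst sum.reindex[OF inj_J]) (auto simp: comp_def)
    also have "\<dots> = (\<Sum>a \<in> J. v a)"
    proof (rule sum.cong)
      fix a assume "a \<in> J"
      then show "(case ?g (xs ! a) of (i, j) \<Rightarrow> w i j) = v a"
        using v[of a] p by (auto simp: pi_less_iff J(1))
    qed simp
    finally show ?thesis .
  qed
  ultimately have few: "real (\<Sum>a \<in> J. v a) < (1 / 2 - lam / 2) * d"
    unfolding typical_def card_star card_b by simp
  have finW: "finite W"
    using W(1) finite_subset by blast
  have "(\<Sum>a \<in> W. v a) = (\<Sum>a \<in> W \<inter> J. v a) + (\<Sum>a \<in> W - J. v a)"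
    using sum.Int_Diff[OF finW] .
  also have "(\<Sum>a \<in> W \<inter> J. v a) \<le> (\<Sum>a \<in> J. v a)"
    by (rule sum_mono2) (use finJ in auto)
  also have "(\<Sum>a \<in> W - J. v a) \<le> card (W - J)"
    using sum_bounded_above[of "W - J" v 1] v_le by simp
  finally have "d \<le> 2 * ((\<Sum>a \<in> J. v a) + 2 * flow)"
    using vote exc by simp
  then have "real d \<le> 2 * (real (\<Sum>a \<in> J. v a) + 2 * real flow)"
    by (metis of_nat_add of_nat_le_iff of_nat_mult of_nat_numeral)
  \<comment> \<open>Together these give \<open>d <= (1 - lam) * d + 4 * flow\<close>.\<close>
  with few have "lam * d \<le> 4 * flow"
    by (simp add: algebra_simps)
  then have "real d \<le> 4 * flow / lam"
    using lam by (simp add: field_simps)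
  then show ?thesis by simp
qed simp

lemma w_le_1: "i \<noteq> j \<Longrightarrow> w i j \<le> 1"
  using compl[of i j] by simp

lemma xs_split: "a \<le> b \<Longrightarrow> b \<le> k \<Longrightarrow>
    xs = map ((!) xs) [0..<a] @ map ((!) xs) [a..<b] @ map ((!) xs) [b..<k]"
proof -
  assume ab: "a \<le> b" "b \<le> k"
  have "[0..<k] = [0..<a] @ [a..<k]"
    using ab upt_add_eq_append[of 0 a "k - a"] by simp
  also have "[a..<k] = [a..<b] @ [b..<k]"
    using ab upt_add_eq_append[of a b "k - b"] by simp
  finally have "map ((!) xs) [0..<k] = map ((!) xs) [0..<a] @ map ((!) xs) [a..<b] @ map ((!) xs) [b..<k]"
    by simp
  then show ?thesis
    using map_nth[of xs] xs(3) by simp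
qed

lemma sum_list_block: "(\<Sum>y\<leftarrow>map ((!) xs) [a..<b]. g y) = (\<Sum>c \<in> {a..<b}. g (xs ! c))"
  by (simp add: comp_def interv_sum_list_conv_sum_set_nat)

lemma card_rk_vimage: "X \<subseteq> {..<k} \<Longrightarrow> card {a \<in> {..<k}. rk a \<in> X} = card X"
proof (rule bij_betw_same_card)
  assume X: "X \<subseteq> {..<k}"
  show "bij_betw rk {a \<in> {..<k}. rk a \<in> X} X"
    unfolding bij_betw_def
  proof
    show "inj_on rk {a \<in> {..<k}. rk a \<in> X}"
      by (rule inj_on_subset[OF bij_betw_imp_inj_on[OF rk_bij]]) auto
    show "rk ` {a \<in> {..<k}. rk a \<in> X} = X"
    proof (intro equalityI subsetI)
      fix a assume "a \<in> X"
      then obtain p where "p < k" "rk p = a"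
        using rk_surj[of a] X by auto
      then show "a \<in> rk ` {a \<in> {..<k}. rk a \<in> X}"
        using \<open>a \<in> X\<close> by auto
    qed auto
  qed
qed

lemma displacement_flow:
  assumes p: "p < k"
  shows "\<bar>real p - real (rk p)\<bar> \<le> max h (4 * flow / lam)"
proof (cases "rk p < p")
  case True
  let ?r = "rk p" and ?J = "{a \<in> {..<k}. rk p < rk a \<and> rk a \<le> p \<or> p \<le> rk a \<and> rk a < rk p}"
  let ?ws = "map ((!) xs) [?r..<p]"
  have "?J = {a \<in> {..<k}. rk a \<in> {Suc ?r..p}}"
    using True by auto
  then have card_J: "card ?J = p - ?r"
    using card_rk_vimage[of "{Suc ?r..p}"] p by (simp add: subset_iff)
  have "best w k (map ((!) xs) [0..<?r] @ map ((!) xs) [?r..<Suc p] @ map ((!) xs) [Suc p..<k])"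
    using best xs_split[of ?r "Suc p"] True p by simp
  then have "lcost w (map ((!) xs) [?r..<Suc p]) \<le> lcost w (xs ! p # ?ws)"
    by (rule best_block) (use True in simp)
  then have "(\<Sum>y\<leftarrow>?ws. w y (xs ! p)) \<le> (\<Sum>y\<leftarrow>?ws. w (xs ! p) y)"
    using True by (simp add: lcost_snoc)
  then have le: "(\<Sum>a \<in> {?r..<p}. w (xs ! a) (xs ! p)) \<le> (\<Sum>a \<in> {?r..<p}. w (xs ! p) (xs ! a))"
    unfolding sum_list_block .
  have neq: "xs ! a \<noteq> xs ! p" if "a \<in> {?r..<p}" for a
    using that p by (simp add: xs_nth_eq)
  have "(\<Sum>a \<in> {?r..<p}. w (xs ! a) (xs ! p) + w (xs ! p) (xs ! a)) = (\<Sum>a \<in> {?r..<p}. 1)"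
    by (intro sum.cong compl neq) auto
  then have vote: "p - ?r \<le> 2 * (\<Sum>a \<in> {?r..<p}. w (xs ! p) (xs ! a))"
    using le by (simp add: sum.distrib)
  \<comment> \<open>A passed item outside the interval has true rank below \<open>rk p\<close> or
    above \<open>p\<close>, hence crosses the cut at \<open>rk p\<close> or at
    \<open>Suc p\<close>.\<close>
  have "{?r..<p} - ?J \<subseteq> up ?r \<union> down (Suc p)"
  proof
    fix a assume a: "a \<in> {?r..<p} - ?J"
    then have "rk a \<noteq> rk p"
      using p rk_inj[of a p] by auto
    with a p show "a \<in> up ?r \<union> down (Suc p)"
      by (auto simp: up_def down_def)
  qed
  then have "card ({?r..<p} - ?J) \<le> card (up ?r \<union> down (Suc p))"
    by (intro card_mono) (simp_all add: finite_up finite_down)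
  also have "\<dots> \<le> card (up ?r) + card (down (Suc p))"
    by (rule card_Un_le)
  also have "\<dots> \<le> 2 * flow"
    using card_up_le[of ?r] card_up_le[of "Suc p"] card_down[of "Suc p"] True p by simp
  finally have "real (p - ?r) \<le> max h (4 * flow / lam)"
    using True p vote w_le_1[OF neq[symmetric]] card_J
    by (intro displacement_aux[where p = p and W = "{?r..<p}" and J = ?J and r = p and v = "\<lambda>a. w (xs ! p) (xs ! a)"])
      auto
  then show ?thesis
    using True by (simp add: of_nat_diff)
next
  case False
  let ?r = "rk p" and ?J = "{a \<in> {..<k}. rk p < rk a \<and> rk a \<le> p \<or> p \<le> rk a \<and> rk a < rk p}"
  let ?ws = "map ((!) xs) [Suc p..<Suc ?r]"
  have r: "?r < k"
    using rk_less p .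
  have "?J = {a \<in> {..<k}. rk a \<in> {p..<?r}}"
    using False by auto
  then have card_J: "card ?J = ?r - p"
    using card_rk_vimage[of "{p..<?r}"] r by (simp add: subset_iff)
  have "best w k (map ((!) xs) [0..<p] @ map ((!) xs) [p..<Suc ?r] @ map ((!) xs) [Suc ?r..<k])"
    using best xs_split[of p "Suc ?r"] False r by simp
  then have "lcost w (map ((!) xs) [p..<Suc ?r]) \<le> lcost w (?ws @ [xs ! p])"
    by (rule best_block) (use False in \<open>simp add: upt_conv_Cons[of p] del: upt_Suc\<close>)
  then have "(\<Sum>y\<leftarrow>?ws. w (xs ! p) y) \<le> (\<Sum>y\<leftarrow>?ws. w y (xs ! p))"
    using False by (simp add: lcost_snoc upt_conv_Cons[of p] del: upt_Suc)
  then have le: "(\<Sum>a \<in> {Suc p..<Suc ?r}. w (xs ! p) (xs ! a)) \<le> (\<Sum>a \<in> {Suc p..<Suc ?r}. w (xs ! a) (xs ! p))"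
    unfolding sum_list_block .
  have neq: "xs ! a \<noteq> xs ! p" if "a \<in> {Suc p..<Suc ?r}" for a
    using that p r by (simp add: xs_nth_eq)
  have "(\<Sum>a \<in> {Suc p..<Suc ?r}. w (xs ! a) (xs ! p) + w (xs ! p) (xs ! a)) = (\<Sum>a \<in> {Suc p..<Suc ?r}. 1)"
    by (intro sum.cong compl neq) auto
  then have vote: "?r - p \<le> 2 * (\<Sum>a \<in> {Suc p..<Suc ?r}. w (xs ! a) (xs ! p))"
    using le by (simp add: sum.distrib)
  have "{Suc p..<Suc ?r} - ?J \<subseteq> up p \<union> down (Suc ?r)"
  proof
    fix a assume a: "a \<in> {Suc p..<Suc ?r} - ?J"
    then have "rk a \<noteq> rk p"
      using p r rk_inj[of a p] by auto
    with a p r show "a \<in> up p \<union> down (Suc ?r)"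
      by (auto simp: up_def down_def)
  qed
  then have "card ({Suc p..<Suc ?r} - ?J) \<le> card (up p \<union> down (Suc ?r))"
    by (intro card_mono) (simp_all add: finite_up finite_down)
  also have "\<dots> \<le> card (up p) + card (down (Suc ?r))"
    by (rule card_Un_le)
  also have "\<dots> \<le> 2 * flow"
    using card_up_le[of p] card_up_le[of "Suc ?r"] card_down[of "Suc ?r"] p r by simp
  finally have "real (?r - p) \<le> max h (4 * flow / lam)"
    using False p r vote w_le_1[OF neq] card_J
    by (intro displacement_aux[where p = p and W = "{Suc p..<Suc ?r}" and J = ?J and r = p and v = "\<lambda>a. w (xs ! a) (xs ! p)"])
      auto
  then show ?thesis
    using False by (simp add: of_nat_diff)
qed

text \<open>
  The \<open>flow\<close> items on either side of the worst cut are mutually inverted, and by the previous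
  lemma all of them lie in a short block around the cut.
\<close>

lemma flow_square:
  assumes D: "\<And>p. p < k \<Longrightarrow> \<bar>real p - real (rk p)\<bar> \<le> D" and "0 \<le> D"
  shows "(real flow)\<^sup>2 \<le> h * (2 * D)"
proof -
  obtain t where t: "t \<le> k" "card (up t) = flow"
    using flow_attained by blast
  define e where "e = nat \<lfloor>D\<rfloor>"
  have e: "real e \<le> D"
    using assms(2) by (simp add: e_def)
  have near: "p \<le> rk p + e" "rk p \<le> p + e" if "p < k" for p
  proof -
    have "real_of_int (int p - int (rk p)) \<le> D" "real_of_int (int (rk p) - int p) \<le> D"
      using D[OF that] by auto
    then have "int p - int (rk p) \<le> \<lfloor>D\<rfloor>" "int (rk p) - int p \<le> \<lfloor>D\<rfloor>"
      by (simp_all only: le_floor_iff)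
    then show "p \<le> rk p + e" "rk p \<le> p + e"
      by (auto simp: e_def)
  qed
  \<comment> \<open>An item crossing the cut has position and true rank on different sides of
    \<open>t\<close> and at most \<open>e\<close> apart, so its position is within \<open>e\<close>
    of \<open>t\<close>.\<close>
  define a where "a = t - e"
  define b where "b = min k (t + e)"
  have ab: "a \<le> b" "b \<le> k"
    using t by (auto simp: a_def b_def)
  let ?ws = "map ((!) xs) [a..<b]"
  have "xs ! c \<in> {1..n}" if "c < b" for c
    using xs_nth[of c] that ab k by auto
  then have ws: "distinct ?ws" "set ?ws \<subseteq> {1..n}"
    using ab xs_nth_eq by (auto simp: distinct_map inj_on_def)
  have sub: "(\<lambda>(p, p'). (xs ! p, xs ! p')) ` (up t \<times> down t) \<subseteq> inv_pairs \<pi> ?ws"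
  proof (clarify)
    fix p p' assume p: "p \<in> up t" "p' \<in> down t"
    have p1: "p < k" "t \<le> p" "rk p < t"
      using p(1) by (auto simp: up_def)
    have p2: "p' < t" "t \<le> rk p'" "p' < k"
      using p(2) t by (auto simp: down_def)
    have in_ab: "a \<le> p'" "p' < p" "p < b"
      using p1 p2 near(1)[OF p1(1)] near(2)[OF p2(3)] by (auto simp: a_def b_def)
    have "\<pi> (xs ! p) < \<pi> (xs ! p')"
      using p1 p2 by (simp add: pi_less_iff)
    then show "(xs ! p, xs ! p') \<in> inv_pairs \<pi> ?ws"
      using inv_pairs_nth[of "p' - a" "p - a" ?ws \<pi>] in_ab by simp
  qed
  have "inj_on (\<lambda>(p, p'). (xs ! p, xs ! p')) (up t \<times> down t)"
    using t xs_nth_eq by (auto simp: inj_on_def up_def down_def)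
  then have "flow * flow = card ((\<lambda>(p, p'). (xs ! p, xs ! p')) ` (up t \<times> down t))"
    using t card_down by (simp add: card_image card_cartesian_product)
  also have "\<dots> \<le> card (inv_pairs \<pi> ?ws)"
    by (rule card_mono[OF finite_inv_pairs sub])
  finally have flow: "real (flow * flow) \<le> card (inv_pairs \<pi> ?ws)"
    by (simp only: of_nat_le_iff)
  \<comment> \<open>Half of the inverted pairs being wrong exceeds the threshold, so the premise of
    \<open>typical_inv\<close> must fail, which bounds the inversions.\<close>
  have "\<not> typical lam w (inv_pairs \<pi> ?ws)"
  proof -
    have "best w k (map ((!) xs) [0..<a] @ ?ws @ map ((!) xs) [b..<k])"
      using best xs_split[OF ab] by simp
    moreover have "inj_on \<pi> (set ?ws)"
      by (rule inj_on_subset[OF inj ws(2)])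
    ultimately have "card (inv_pairs \<pi> ?ws) \<le> 2 * (\<Sum>(i, j) \<in> inv_pairs \<pi> ?ws. w i j)"
      using compl by (rule best_block_inversions)
    then have "real (card (inv_pairs \<pi> ?ws)) \<le> 2 * real (\<Sum>(i, j) \<in> inv_pairs \<pi> ?ws. w i j)"
      by linarith
    moreover have "0 \<le> lam * real (card (inv_pairs \<pi> ?ws))"
      using lam by simp
    ultimately show ?thesis
      unfolding typical_def by (simp add: algebra_simps)
  qed
  then have "card (inv_pairs \<pi> ?ws) \<le> h * length ?ws"
    using typical_inv[OF ws] by force
  also have "length ?ws \<le> 2 * e"
    by (simp add: a_def b_def)
  then have "h * length ?ws \<le> h * (2 * D)"
    using h e by (intro mult_left_mono) auto
  finally show ?thesis
    using flow by (simp add: power2_eq_square)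
qed

text \<open>If the maximum is not \<open>h\<close>, then
  \<open>flow ^ 2 <= 8 * h * flow / lam\<close>; cancelling gives
  \<open>flow <= 8 * h / lam\<close>, and \<open>4 * flow / lam\<close> becomes the stated
  bound.\<close>

lemma displacement:
  assumes "p < k"
  shows "\<bar>real p - real (true_rank \<pi> k (xs ! p))\<bar> \<le> 32 * h / lam\<^sup>2"
proof -
  let ?D = "max h (4 * flow / lam)"
  have lam2: "lam\<^sup>2 \<le> 1" "0 < lam\<^sup>2"
    using lam by (auto simp: power_le_one)
  have "(real flow)\<^sup>2 \<le> h * (2 * ?D)"
    using displacement_flow h by (intro flow_square) auto
  moreover have "\<bar>real p - real (rk p)\<bar> \<le> ?D"
    by (rule displacement_flow) fact
  moreover have "?D \<le> 32 * h / lam\<^sup>2"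
  proof (cases "4 * flow / lam \<le> h")
    case True
    then show ?thesis
      using h lam2 by (simp add: field_simps)
  next
    case False
    then have D: "?D = 4 * flow / lam" and pos: "0 < real flow"
      using h lam by (auto simp: max_def intro!: Nat.gr0I)
    have "(real flow)\<^sup>2 \<le> h * (2 * (4 * flow / lam))"
      using \<open>(real flow)\<^sup>2 \<le> _\<close> unfolding D .
    then have "real flow * real flow \<le> (8 * h / lam) * real flow"
      by (simp add: power2_eq_square field_simps)
    then have "real flow \<le> 8 * h / lam"
      using pos by (rule mult_right_le_imp_le)
    then have "4 * flow / lam \<le> 4 * (8 * h / lam) / lam"
      using lam by (intro divide_right_mono mult_left_mono) auto
    then show ?thesis
      unfolding D by (simp add: power2_eq_square)
  qed
  ultimately show ?thesis
    unfolding rk_def by linarith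
qed

end

text \<open>Any optimal order \<open>zs\<close> of the enlarged set is a windowed competitor: an
  item's position in \<open>xs\<close> and in \<open>zs\<close> differs from its true rank by at
  most \<open>?K\<close> each, and the two ranks differ by at most 1.\<close>

lemma best_insertion:
  assumes k: "Suc k \<le> n" and xs: "best w k xs" and ys: "next_order w D k xs ys"
    and D: "2 * (32 * h / lam\<^sup>2) + 1 \<le> real D"
  shows "best w (Suc k) ys"
proof -
  let ?K = "32 * h / lam\<^sup>2" and ?os = "xs @ [Suc k]"
  obtain zs where zs: "best w (Suc k) zs"
    using best_exists by blast
  have len: "length xs = k" "length zs = Suc k" and set: "set xs = {1..k}" "set zs = {1..Suc k}"
    and dist: "distinct xs" "distinct zs"
    using xs zs distinct_card[of xs] distinct_card[of zs] by (auto simp: best_def)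
  have os: "distinct ?os" "set ?os = {1..Suc k}" "length ?os = Suc k"
    using dist len set by auto
  have D_pos: "0 < D"
    using D h lam by (simp add: zero_less_divide_iff not_le) (smt (verit) divide_nonneg_nonneg of_nat_0_less_iff zero_le_power2)
  define ix where "ix y = inv_into {..<Suc k} ((!) ?os) y" for y
  have bij: "bij_betw ((!) ?os) {..<Suc k} {1..Suc k}"
    using bij_betw_nth[OF os(1), of "{..<Suc k}" "{1..Suc k}"] os by simp
  have nth_ix: "?os ! ix y = y" if "y \<in> {1..Suc k}" for y
    using that bij unfolding ix_def by (intro f_inv_into_f) (auto simp: bij_betw_def)
  have ix_bij: "bij_betw ix {1..Suc k} {..<Suc k}"
    unfolding ix_def by (rule bij_betw_inv_into) (rule bij)
  let ?zs = "map ix zs"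
  have map_zs: "map ((!) ?os) ?zs = zs"
    using nth_ix set(2) by (auto intro!: map_idI simp: comp_def)
  have near_xs: "\<bar>real j - real (true_rank \<pi> k (xs ! j))\<bar> \<le> ?K" if "j < k" for j
    using displacement[OF _ xs that] k by simp
  have near_zs: "\<bar>real b - real (true_rank \<pi> (Suc k) (zs ! b))\<bar> \<le> ?K" if "b < Suc k" for b
    using displacement[OF k zs that] .
  have ix_zs: "xs ! ix (zs ! b) = zs ! b" if "b < Suc k" "ix (zs ! b) < k" for b
  proof -
    have "zs ! b \<in> {1..Suc k}"
      using that(1) len(2) set(2) nth_mem[of b zs] by simp
    then show ?thesis
      using nth_ix[of "zs ! b"] that(2) len(1) by (simp add: nth_append)
  qed
  have "windowed_list (Suc k) D ?zs"
    unfolding windowed_list_def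
  proof (intro conjI allI impI)
    show "distinct ?zs"
      using dist(2) set(2) bij_betw_imp_inj_on[OF ix_bij] by (simp add: distinct_map)
    show "set ?zs = {..<Suc k}"
      using set(2) bij_betw_imp_surj_on[OF ix_bij] by simp
    fix p assume p: "p \<le> Suc k"
    have take: "set (take p ?zs) = (\<lambda>b. ix (zs ! b)) ` {..<p}"
      using p len(2) by (simp add: take_map nth_image[symmetric] image_image lessThan_atLeast0)
    show "windowed (Suc k) D p (set (take p ?zs))"
      unfolding windowed_def
    proof (intro conjI subsetI)
      fix j assume "j \<in> {..<p - D}"
      then have j: "j < k" "j + D < p"
        using p D_pos by auto
      have "j \<in> set ?zs"
        using \<open>set ?zs = {..<Suc k}\<close> j(1) by simp
      then obtain b where b: "b < Suc k" "ix (zs ! b) = j"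
        using len(2) by (auto simp: in_set_conv_nth)
      have "real b \<le> real (true_rank \<pi> (Suc k) (zs ! b)) + ?K"
        using near_zs[OF b(1)] by linarith
      also have "real (true_rank \<pi> (Suc k) (zs ! b)) \<le> real (true_rank \<pi> k (zs ! b)) + 1"
        using true_rank_Suc(2)[of \<pi> k "zs ! b"] by linarith
      also have "real (true_rank \<pi> k (zs ! b)) \<le> real j + ?K"
        using near_xs[OF j(1)] ix_zs[OF b(1)] b(2) j(1) by simp
      finally have "real b < real p"
        using D j(2) by linarith
      then show "j \<in> set (take p ?zs)"
        unfolding take using b by auto
    next
      fix j assume "j \<in> set (take p ?zs)"
      then obtain b where b: "b < p" "j = ix (zs ! b)"
        unfolding take by auto
      have "j < Suc k"
        using b p set(2) bij_betwE[OF ix_bij] nth_mem[of b zs] len(2) by auto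
      show "j \<in> {..<p - D + 2 * D} \<union> {Suc k - 1}"
      proof (cases "j = k")
        case False
        then have j: "j < k"
          using \<open>j < Suc k\<close> by simp
        have "real j \<le> real (true_rank \<pi> k (zs ! b)) + ?K"
          using near_xs[OF j] ix_zs[of b] b p j by simp
        also have "real (true_rank \<pi> k (zs ! b)) \<le> real (true_rank \<pi> (Suc k) (zs ! b))"
          using true_rank_Suc(1) by simp
        also have "\<dots> \<le> real b + ?K"
          using near_zs[of b] b p by linarith
        finally have "real j < real (p + D)"
          using D b(1) by simp
        then have "j < p + D"
          by (simp only: of_nat_less_iff)
        then show ?thesis
          by auto
      qed simp
    qed
  qed
  then have "lcost w ys \<le> lcost w zs"
    using ys map_zs unfolding next_order_def by metis
  then show ?thesis
    using ys zs unfolding best_def next_order_def by (meson le_trans)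
qed

lemma orders_best:
  assumes "orders w D k ys" "k \<le> n" "2 * (32 * h / lam\<^sup>2) + 1 \<le> real D"
  shows "best w k ys"
  using assms(1,2)
proof (induction rule: orders.induct)
  case orders_0
  show ?case
    by (simp add: best_def)
next
  case (orders_Suc k ys ys')
  then show ?case
    using best_insertion[OF _ _ _ assms(3)] by simp
qed

end

section \<open>Scores\<close>

lemma win_compl: "i \<noteq> j \<Longrightarrow> win s i j + win s j i = 1"
  by (auto simp: win_def signal_def)

lemma card_ordered_pairs:
  assumes "inj_on \<sigma> S" "finite S"
  shows "2 * card {(i, j). i \<in> S \<and> j \<in> S \<and> \<sigma> i < (\<sigma> j :: nat)} = card S * (card S - 1)"
proof -
  let ?A = "{(i, j). i \<in> S \<and> j \<in> S \<and> \<sigma> i < \<sigma> j}"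
  have fin: "finite ?A"
    by (rule finite_subset[of _ "S \<times> S"]) (use assms in auto)
  have "S \<times> S = ?A \<union> prod.swap ` ?A \<union> (\<lambda>i. (i, i)) ` S"
    using assms(1) by (auto simp: inj_on_def image_iff)
  moreover have "card (?A \<union> prod.swap ` ?A \<union> (\<lambda>i. (i, i)) ` S) =
      card ?A + card (prod.swap ` ?A) + card ((\<lambda>i. (i, i)) ` S)"
    using fin assms(2) by (subst card_Un_disjoint; (subst card_Un_disjoint)?) auto
  moreover have "card (prod.swap ` ?A) = card ?A" "card ((\<lambda>i. (i, i)) ` S) = card S"
    by (auto intro!: card_image simp: inj_on_def)
  ultimately have "card (S \<times> S) = 2 * card ?A + card S"
    by simp
  then have "card S * card S = 2 * card ?A + card S"
    by (simp only: card_cartesian_product)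
  then show ?thesis
    by (simp add: diff_mult_distrib2)
qed

text \<open>\<open>q\<close> takes only two values, plus and minus the log-odds, so the score is a
  decreasing affine function of the number of contradicted signals.\<close>

lemma score_order_cost:
  assumes lam: "0 < lam" "lam < 1 / 2" and \<sigma>: "\<sigma> permutes {1..n}"
  shows "score lam n s \<sigma> = ln ((1 / 2 + lam) / (1 / 2 - lam)) *
    (real (n * (n - 1)) / 2 - 2 * real (order_cost (win s) \<sigma> {1..n}))"
proof -
  let ?L = "ln ((1 / 2 + lam) / (1 / 2 - lam))"
  let ?A = "{(i, j). i \<in> {1..n} \<and> j \<in> {1..n} \<and> \<sigma> i < \<sigma> j}"
  have q: "q lam s i j = ?L * (1 - 2 * real (win s i j))" if "i \<noteq> j" for i j
    using lam that by (auto simp: q_def D_before_def D_after_def win_def ln_div)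
  have "score lam n s \<sigma> = (\<Sum>(i, j) \<in> ?A. ?L * (1 - 2 * real (win s i j)))"
    unfolding score_def
  proof (rule sum.cong)
    fix x assume "x \<in> ?A"
    then obtain i j where "x = (i, j)" "i \<noteq> j"
      by auto
    then show "(case x of (i, j) \<Rightarrow> q lam s i j) = (case x of (i, j) \<Rightarrow> ?L * (1 - 2 * real (win s i j)))"
      using q by simp
  qed simp
  also have "\<dots> = ?L * (real (card ?A) - 2 * real (order_cost (win s) \<sigma> {1..n}))"
    by (simp add: order_cost_def case_prod_unfold sum_subtractf sum_distrib_left[symmetric])
  also have "real (card ?A) = real (n * (n - 1)) / 2"
    using card_ordered_pairs[of \<sigma> "{1..n}"] permutes_inj_on[OF \<sigma>]
    by (metis (no_types, lifting) card_atLeastAtMost diff_Suc_1 finite_atLeastAtMost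
        nonzero_mult_div_cancel_left of_nat_mult of_nat_numeral zero_neq_numeral)
  finally show ?thesis .
qed

text \<open>Each permutation \<open>\<tau>\<close> is matched with the list sorted by
  \<open>\<tau>\<close>; for the output permutation this list is \<open>ys\<close>.\<close>

lemma best_optimal:
  assumes lam: "0 < lam" "lam < 1 / 2" and best: "best (win s) n ys"
    and st: "\<And>j. j < n \<Longrightarrow> snd st (ys ! j) = Suc j"
  shows "optimal lam n s (output_perm n st)"
proof -
  let ?\<sigma> = "output_perm n st"
  have ys: "distinct ys" "set ys = {1..n}" "length ys = n"
    using best distinct_card[of ys] by (auto simp: best_def)
  have \<sigma>_nth: "?\<sigma> (ys ! j) = Suc j" if "j < n" for j
    using st[OF that] nth_mem[of j ys] that ys by (auto simp: output_perm_def)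
  have perm: "?\<sigma> permutes {1..n}"
  proof (rule bij_imp_permutes)
    have "map ?\<sigma> ys = [1..<Suc n]"
      using \<sigma>_nth ys by (intro nth_equalityI) (auto simp del: upt_Suc)
    then have "inj_on ?\<sigma> (set ys)" "?\<sigma> ` set ys = set [1..<Suc n]"
      by (metis distinct_map distinct_upt, metis set_map)
    then show "bij_betw ?\<sigma> {1..n} {1..n}"
      unfolding bij_betw_def ys(2) by (simp only: set_upt atLeastLessThanSuc_atLeastAtMost simp_thms)
  qed (auto simp: output_perm_def)
  have "sorted (map ?\<sigma> ys)"
    using ys \<sigma>_nth by (auto simp: sorted_iff_nth_mono)
  then have cost: "lcost (win s) ys = order_cost (win s) ?\<sigma> {1..n}"
    using lcost_sorted[of ys ?\<sigma> "win s"] ys permutes_inj_on[OF perm] win_compl by simp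
  have "score lam n s \<tau> \<le> score lam n s ?\<sigma>" if \<tau>: "\<tau> permutes {1..n}" for \<tau>
  proof -
    let ?zs = "sort_key \<tau> ys"
    have "lcost (win s) ys \<le> lcost (win s) ?zs"
      using best ys unfolding best_def by simp
    also have "\<dots> = order_cost (win s) \<tau> {1..n}"
      using lcost_sorted[of ?zs \<tau> "win s"] ys permutes_inj_on[OF \<tau>] win_compl by simp
    finally have "real (order_cost (win s) ?\<sigma> {1..n}) \<le> real (order_cost (win s) \<tau> {1..n})"
      unfolding cost by simp
    moreover have "0 < ln ((1 / 2 + lam) / (1 / 2 - lam))"
      using lam by (intro ln_gt_zero) (simp add: field_simps)
    ultimately show ?thesis
      unfolding score_order_cost[OF lam perm] score_order_cost[OF lam \<tau>]
      by (intro mult_left_mono) auto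
  qed
  then show ?thesis
    using perm by (simp add: optimal_def)
qed

section \<open>Typical signals\<close>

definition wrong :: "(nat \<Rightarrow> nat) \<Rightarrow> nat \<times> nat \<Rightarrow> bool \<Rightarrow> bool" where
  "wrong \<pi> x v = (if \<pi> (fst x) < \<pi> (snd x) then v else \<not> v)"

text \<open>The pairs of interest are oriented by the true order, while a signal is stored with the
  smaller item first.\<close>

definition ordered :: "nat \<times> nat \<Rightarrow> nat \<times> nat" where
  "ordered x = (min (fst x) (snd x), max (fst x) (snd x))"

lemma win_wrong: "\<pi> i < \<pi> j \<Longrightarrow> win s i j = of_bool (wrong \<pi> (ordered (i, j)) (s (ordered (i, j))))"
  by (cases i j rule: linorder_cases)
    (auto simp: win_def signal_def wrong_def ordered_def min_def max_def)

lemma finite_pairs: "finite (pairs n)"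
  by (rule finite_subset[of _ "{1..n} \<times> {1..n}"]) (auto simp: pairs_def)

text \<open>Hoeffding's lemma for one Bernoulli variable, with the mean moved to the right.\<close>

lemma bernoulli_mgf_le:
  fixes h p :: real
  assumes "0 \<le> h" "0 \<le> p"
  shows "1 + p * (exp h - 1) \<le> exp (h\<^sup>2 / 8 + h * p)"
proof -
  have "0 < 1 + p * (exp h - 1)"
    using assms by (simp add: add_pos_nonneg)
  moreover have "ln (1 + p * (exp h - 1)) \<le> h\<^sup>2 / 8 + h * p"
    using Hoeffdings_lemma_aux[OF assms] by simp
  ultimately show ?thesis
    by (metis exp_le_cancel_iff exp_ln)
qed

text \<open>Chernoff bound for the number of wrong signals: the threshold exceeds the mean by
  \<open>lam / 2\<close> per pair.\<close>

lemma prob_not_typical: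
  assumes lam: "0 < lam" "lam < 1 / 2"
    and P: "P \<subseteq> {(i, j). i \<in> {1..n} \<and> j \<in> {1..n} \<and> \<pi> i < \<pi> j}"
  shows "measure_pmf.prob (signals_pmf lam n \<pi>) {s. \<not> typical lam (win s) P} \<le>
    exp (- (lam\<^sup>2 / 2 * card P))"
proof -
  define N where "N = ordered ` P"
  \<comment> \<open>\<open>?h\<close> minimises \<open>h ^ 2 / 8 - h * lam / 2\<close>, where
    \<open>lam / 2\<close> is \<open>?\<theta> - ?p\<close>; the minimum is
    \<open>- (lam ^ 2 / 2)\<close>.\<close>
  let ?p = "1 / 2 - lam" and ?\<theta> = "1 / 2 - lam / 2" and ?h = "2 * lam"
  let ?D = "\<lambda>(a, b). if \<pi> a < \<pi> b then D_before lam else D_after lam"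
  let ?M = "Pi_pmf (pairs n) False ?D"
  \<comment> \<open>The factor 1 outside \<open>N\<close> extends the product to all of
    \<open>pairs n\<close>, where its expectation splits under \<open>Pi_pmf\<close>.\<close>
  define g where "g x v = (if x \<in> N then exp (?h * (of_bool (wrong \<pi> x v) - ?\<theta>)) else 1)"
    for x v
  \<comment> \<open>A pair and its reverse are never both in \<open>P\<close>, so different pairs
    have different, independent signals.\<close>
  have inj: "inj_on ordered P"
  proof (rule inj_onI)
    fix x y assume "x \<in> P" "y \<in> P" "ordered x = ordered y"
    moreover from this have "\<pi> (fst x) < \<pi> (snd x)" "\<pi> (fst y) < \<pi> (snd y)"
      using P by auto
    ultimately show "x = y"
      by (cases x; cases y) (auto simp: ordered_def min_def max_def split: if_splits)
  qed
  have N: "N \<subseteq> pairs n"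
  proof -
    have "ordered (i, j) \<in> pairs n" if "(i, j) \<in> P" for i j
      using that P by (cases i j rule: linorder_cases) (auto simp: ordered_def pairs_def)
    then show ?thesis
      by (auto simp: N_def)
  qed
  have card_N: "card N = card P"
    unfolding N_def by (rule card_image) (rule inj)
  have finN: "finite N"
    using N finite_pairs finite_subset by blast
  have sum: "(\<Sum>(i, j) \<in> P. win s i j) = (\<Sum>x \<in> N. of_bool (wrong \<pi> x (s x)))" for s
    unfolding N_def sum.reindex[OF inj] comp_def
  proof (rule sum.cong)
    fix x assume "x \<in> P"
    then show "(case x of (i, j) \<Rightarrow> win s i j) = of_bool (wrong \<pi> (ordered x) (s (ordered x)))"
      using P by (auto simp: win_wrong)
  qed simp
  have fin: "finite (set_pmf ?M)"
    unfolding set_Pi_pmf[OF finite_pairs] by (intro finite_PiE_dflt finite_pairs) simp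
  have prod: "(\<Prod>x \<in> pairs n. g x (s x)) = exp (?h * (real (\<Sum>(i, j) \<in> P. win s i j) - ?\<theta> * card P))"
    for s
  proof -
    have "(\<Prod>x \<in> pairs n. g x (s x)) = (\<Prod>x \<in> N. exp (?h * (of_bool (wrong \<pi> x (s x)) - ?\<theta>)))"
      unfolding g_def using N finite_pairs by (simp add: prod.If_cases Int_absorb1)
    also have "\<dots> = exp (\<Sum>x \<in> N. ?h * (of_bool (wrong \<pi> x (s x)) - ?\<theta>))"
      by (simp add: exp_sum finN)
    also have "(\<Sum>x \<in> N. ?h * (of_bool (wrong \<pi> x (s x)) - ?\<theta>)) =
        ?h * ((\<Sum>x \<in> N. of_bool (wrong \<pi> x (s x))) - ?\<theta> * card N)"
      by (simp add: sum_subtractf sum_distrib_left[symmetric])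
    finally show ?thesis
      by (simp add: sum card_N)
  qed
  have "measure_pmf.prob ?M {s. \<not> typical lam (win s) P} =
      measure_pmf.expectation ?M (indicator {s. \<not> typical lam (win s) P})"
    by simp
  also have "\<dots> \<le> measure_pmf.expectation ?M (\<lambda>s. \<Prod>x \<in> pairs n. g x (s x))"
  proof (rule integral_mono)
    fix s
    show "indicator {s. \<not> typical lam (win s) P} s \<le> (\<Prod>x \<in> pairs n. g x (s x))"
      using lam unfolding prod typical_def by (auto simp: indicator_def not_less)
  qed (rule integrable_measure_pmf_finite[OF fin])+
  also have "\<dots> = (\<Prod>x \<in> pairs n. measure_pmf.expectation (?D x) (g x))"
    by (rule expectation_prod_Pi_pmf)
      (auto simp: finite_pairs g_def D_before_def D_after_def split: if_splits
        intro!: integrable_measure_pmf_finite)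
  also have "\<dots> = (\<Prod>x \<in> N. exp (- (?h * ?\<theta>)) * (1 + ?p * (exp ?h - 1)))"
  proof -
    have "measure_pmf.expectation (?D x) (g x) =
        (if x \<in> N then exp (- (?h * ?\<theta>)) * (1 + ?p * (exp ?h - 1)) else 1)" for x
      using lam by (cases x) (auto simp: g_def wrong_def D_before_def D_after_def algebra_simps
          simp flip: exp_add)
    then show ?thesis
      using N finite_pairs by (simp add: prod.If_cases Int_absorb1)
  qed
  also have "\<dots> \<le> (\<Prod>x \<in> N. exp (- (lam\<^sup>2 / 2)))"
  proof (rule prod_mono, rule conjI)
    have "1 + ?p * (exp ?h - 1) \<le> exp (?h\<^sup>2 / 8 + ?h * ?p)"
      using lam by (intro bernoulli_mgf_le) auto
    then have "exp (- (?h * ?\<theta>)) * (1 + ?p * (exp ?h - 1)) \<le>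
        exp (- (?h * ?\<theta>)) * exp (?h\<^sup>2 / 8 + ?h * ?p)"
      by simp
    also have "\<dots> = exp (- (lam\<^sup>2 / 2))"
      by (simp add: exp_add[symmetric] power2_eq_square algebra_simps)
    finally show "exp (- (?h * ?\<theta>)) * (1 + ?p * (exp ?h - 1)) \<le> exp (- (lam\<^sup>2 / 2))" .
    show "0 \<le> exp (- (?h * ?\<theta>)) * (1 + ?p * (exp ?h - 1))"
      using lam by simp
  qed
  also have "\<dots> = exp (- (lam\<^sup>2 / 2 * card P))"
    by (simp add: card_N exp_of_nat_mult[symmetric] mult.commute)
  finally show ?thesis
    by (simp add: signals_pmf_def)
qed

definition atypical :: "real \<Rightarrow> real \<Rightarrow> nat \<Rightarrow> (nat \<Rightarrow> nat) \<Rightarrow> signals set" where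
  "atypical lam h n \<pi> =
    (\<Union>ws \<in> {ws. distinct ws \<and> set ws \<subseteq> {1..n} \<and> h * length ws < card (inv_pairs \<pi> ws)}.
       {s. \<not> typical lam (win s) (inv_pairs \<pi> ws)}) \<union>
    (\<Union>(k, i, u) \<in> {(k, i, u). k \<in> {1..n} \<and> i \<in> {1..n} \<and> u \<in> {1..n} \<and> h \<le> card (between \<pi> k i u)}.
       {s. \<not> typical lam (win s) (star \<pi> k i u)})"

lemma typical_signals_compl:
  assumes "0 < lam" "lam < 1" "0 < h" "inj_on \<pi> {1..n}" "s \<notin> atypical lam h n \<pi>"
  shows "typical_signals lam h (win s) \<pi> n"
proof
  fix k i u
  assume *: "k \<le> n" "i \<in> {1..n}" "u \<in> {1..n}" "h \<le> card (between \<pi> k i u)"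
  then have "1 \<le> k"
    using assms(3) by (cases k) (auto simp: between_def)
  then show "typical lam (win s) (star \<pi> k i u)"
    using assms(5) * unfolding atypical_def by auto
qed (use assms win_compl in \<open>auto simp: atypical_def\<close>)

text \<open>\<open>h\<close> is chosen so that the tail for \<open>h * m\<close> pairs is
  \<open>n powr - (alpha + 6)\<close> to the power \<open>m\<close>. It beats the
  \<open>n ^ m\<close> sequences for each \<open>m\<close> and, with \<open>m = 1\<close>, the
  \<open>n ^ 3\<close> stars.\<close>

lemma prob_atypical:
  assumes lam: "0 < lam" "lam < 1 / 2" and n: "2 \<le> n" and alpha: "0 < alpha"
    and inj: "inj_on \<pi> {1..n}"
    and h: "h = 2 * (alpha + 6) * ln n / lam\<^sup>2"
  shows "measure_pmf.prob (signals_pmf lam n \<pi>) (atypical lam h n \<pi>) \<le> real n powr (- alpha)"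
proof -
  let ?prob = "measure_pmf.prob (signals_pmf lam n \<pi>)"
  let ?W = "{ws. distinct ws \<and> set ws \<subseteq> {1..n} \<and> h * length ws < card (inv_pairs \<pi> ws)}"
  let ?K = "{(k, i, u). k \<in> {1..n} \<and> i \<in> {1..n} \<and> u \<in> {1..n} \<and> h \<le> card (between \<pi> k i u)}"
  let ?b = "real n powr - (alpha + 6)"
  have h_pos: "0 < h"
    using n lam alpha by (simp add: h)
  have shift: "real n ^ k * real n powr a = real n powr b" if "b = a + real k" for a b k
    using n by (simp add: that powr_add powr_realpow)
  have tail: "exp (- (lam\<^sup>2 / 2 * c)) \<le> ?b ^ m" if "h * real m \<le> c" for c m
  proof -
    have "exp (- (lam\<^sup>2 / 2 * c)) \<le> exp (- (lam\<^sup>2 / 2 * (h * m)))"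
      using that by (simp add: mult_left_mono)
    also have "lam\<^sup>2 / 2 * (h * m) = m * ((alpha + 6) * ln n)"
      using lam by (simp add: h)
    also have "exp (- (m * ((alpha + 6) * ln n))) = ?b ^ m"
      using n by (simp add: powr_def exp_of_nat_mult[symmetric] algebra_simps)
    finally show ?thesis .
  qed
  \<comment> \<open>The empty sequence drops out, having no inversions; it would contribute 1 to the
    sum.\<close>
  have lists: "?W \<subseteq> (\<Union>m \<in> {1..n}. {ws. set ws \<subseteq> {1..n} \<and> length ws = m})"
  proof
    fix ws assume ws: "ws \<in> ?W"
    then have "length ws \<le> n"
      using distinct_card[of ws] card_mono[of "{1..n}" "set ws"] by auto
    moreover have "ws \<noteq> []"
      using ws by auto
    ultimately show "ws \<in> (\<Union>m \<in> {1..n}. {ws. set ws \<subseteq> {1..n} \<and> length ws = m})"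
      using ws by (auto simp: Suc_le_eq)
  qed
  have finW: "finite ?W"
    by (rule finite_subset[OF lists]) (auto intro!: finite_lists_length_eq)
  have finK: "finite ?K" and card_K: "card ?K \<le> n ^ 3"
  proof -
    have sub: "?K \<subseteq> {1..n} \<times> {1..n} \<times> {1..n}"
      by auto
    show "finite ?K"
      by (rule finite_subset[OF sub]) auto
    have "card ?K \<le> card ({1..n} \<times> {1..n} \<times> {1..n})"
      by (rule card_mono[OF _ sub]) auto
    then show "card ?K \<le> n ^ 3"
      by (simp add: card_cartesian_product power3_eq_cube)
  qed
  have "?prob (\<Union>ws \<in> ?W. {s. \<not> typical lam (win s) (inv_pairs \<pi> ws)}) \<le>
      (\<Sum>ws \<in> ?W. ?prob {s. \<not> typical lam (win s) (inv_pairs \<pi> ws)})"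
    by (rule measure_pmf.finite_measure_subadditive_finite[OF finW]) auto
  also have "\<dots> \<le> (\<Sum>ws \<in> ?W. ?b ^ length ws)"
  proof (rule sum_mono)
    fix ws assume ws: "ws \<in> ?W"
    then have "inv_pairs \<pi> ws \<subseteq> {(i, j). i \<in> {1..n} \<and> j \<in> {1..n} \<and> \<pi> i < \<pi> j}"
      using inv_pairs_subset[of \<pi> ws] by blast
    from prob_not_typical[OF lam this] show "?prob {s. \<not> typical lam (win s) (inv_pairs \<pi> ws)} \<le> ?b ^ length ws"
      using tail[of "length ws" "card (inv_pairs \<pi> ws)"] ws by force
  qed
  also have "\<dots> \<le> (\<Sum>ws \<in> (\<Union>m \<in> {1..n}. {ws. set ws \<subseteq> {1..n} \<and> length ws = m}). ?b ^ length ws)"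
    by (rule sum_mono2[OF _ lists]) (auto intro!: finite_lists_length_eq)
  also have "\<dots> = (\<Sum>m \<in> {1..n}. \<Sum>ws \<in> {ws. set ws \<subseteq> {1..n} \<and> length ws = m}. ?b ^ length ws)"
    by (rule sum.UNION_disjoint) (auto intro!: finite_lists_length_eq)
  also have "\<dots> = (\<Sum>m \<in> {1..n}. real n ^ m * ?b ^ m)"
    by (intro sum.cong refl) (simp add: card_lists_length_eq)
  also have "\<dots> \<le> (\<Sum>m \<in> {1..n}. real n powr - (alpha + 5))"
  proof (rule sum_mono)
    fix m assume m: "m \<in> {1..n}"
    have nb: "real n * ?b = real n powr - (alpha + 5)"
      using shift[of "- (alpha + 5)" "- (alpha + 6)" 1] by simp
    have "real n powr - (alpha + 5) \<le> real n powr 0"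
      using n alpha by (intro powr_mono) auto
    then have le1: "real n powr - (alpha + 5) \<le> 1"
      using n by simp
    have "real n ^ m * ?b ^ m = (real n powr - (alpha + 5)) ^ m"
      by (simp only: power_mult_distrib[symmetric] nb)
    also have "\<dots> \<le> (real n powr - (alpha + 5)) ^ 1"
      using m le1 by (intro power_decreasing) auto
    finally show "real n ^ m * ?b ^ m \<le> real n powr - (alpha + 5)"
      by simp
  qed
  also have "\<dots> = real n powr - (alpha + 4)"
    using shift[of "- (alpha + 4)" "- (alpha + 5)" 1] by simp
  finally have 1: "?prob (\<Union>ws \<in> ?W. {s. \<not> typical lam (win s) (inv_pairs \<pi> ws)}) \<le> real n powr - (alpha + 4)" .
  have "?prob (\<Union>(k, i, u) \<in> ?K. {s. \<not> typical lam (win s) (star \<pi> k i u)}) \<le>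
      (\<Sum>x \<in> ?K. ?prob (case x of (k, i, u) \<Rightarrow> {s. \<not> typical lam (win s) (star \<pi> k i u)}))"
    by (rule measure_pmf.finite_measure_subadditive_finite[OF finK]) auto
  also have "\<dots> \<le> (\<Sum>x \<in> ?K. ?b)"
  proof (rule sum_mono)
    fix x assume "x \<in> ?K"
    then obtain k i u where x: "x = (k, i, u)" "k \<in> {1..n}" "i \<in> {1..n}" "h \<le> card (between \<pi> k i u)"
      by auto
    have "star \<pi> k i u \<subseteq> {(i, j). i \<in> {1..n} \<and> j \<in> {1..n} \<and> \<pi> i < \<pi> j}"
      using x(2,3) by (auto simp: star_def between_def split: if_splits)
    from prob_not_typical[OF lam this]
    show "?prob (case x of (k, i, u) \<Rightarrow> {s. \<not> typical lam (win s) (star \<pi> k i u)}) \<le> ?b"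
      using tail[of 1 "card (star \<pi> k i u)"] x by (simp add: card_star)
  qed
  also have "\<dots> \<le> real n ^ 3 * ?b"
    using card_K by (simp add: mult_right_mono flip: of_nat_power)
  also have "\<dots> = real n powr - (alpha + 3)"
    by (rule shift) simp
  finally have 2: "?prob (\<Union>(k, i, u) \<in> ?K. {s. \<not> typical lam (win s) (star \<pi> k i u)}) \<le> real n powr - (alpha + 3)" .
  have "?prob (atypical lam h n \<pi>) \<le> real n powr - (alpha + 4) + real n powr - (alpha + 3)"
    unfolding atypical_def using 1 2
    by (intro order_trans[OF measure_Un_le add_mono]) auto
  also have "\<dots> \<le> real n powr - (alpha + 1) + real n powr - (alpha + 1)"
    using n by (intro add_mono powr_mono) auto
  also have "\<dots> \<le> real n * real n powr - (alpha + 1)"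
    using n mult_right_mono[of 2 "real n" "real n powr - (alpha + 1)"] by simp
  also have "\<dots> = real n powr - alpha"
    using shift[of "- alpha" "- (alpha + 1)" 1] by simp
  finally show ?thesis .
qed

section \<open>Running time and conclusion\<close>

definition "time_bound c n = prepare_cost c n + layout.sort_cost n (half_width c n)"

lemma noisy_sort_terminates:
  assumes "0 < c" "1 \<le> n"
  shows "\<exists>st ys. run (time_bound c n) (noisy_sort c, input_state n s) = return_pmf (Skip, st) \<and>
    orders (win s) (half_width c n) n ys \<and> (\<forall>j < n. snd st (ys ! j) = Suc j)"
proof -
  define Q where "Q r m \<tau> \<longleftrightarrow> \<tau> \<le> time_bound c n \<and>
    (\<exists>ys. orders (win s) (half_width c n) n ys \<and> (\<forall>j < n. m (ys ! j) = Suc j))"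
    for r m :: "nat \<Rightarrow> nat" and \<tau>
  have "wp (noisy_sort c) Q ((\<lambda>_. 0)(0 := n)) (input_memory n s) 0"
    by (rule wp_noisy_sort[OF assms]) (auto simp: Q_def time_bound_def)
  then obtain t st where "big (noisy_sort c) (input_state n s) t st" "Q (fst st) (snd st) t"
    unfolding wp_def input_state_def by auto
  then show ?thesis
    unfolding Q_def using run_big by blast
qed

text \<open>All terms are multiples of \<open>E * n ^ 4\<close>, and the factor
  \<open>2 ^ 10\<close> is at most \<open>n ^ 10\<close>. \<open>E\<close> is
  \<open>2 ^ (log2_ceil n + 1) <= 4 * n <= n ^ 3\<close> to the power \<open>2 * c\<close>.\<close>

lemma time_bound_le:
  assumes n: "2 \<le> n" and c: "1 \<le> c"
  shows "time_bound c n \<le> n ^ (6 * c + 14)"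
proof -
  define E where "E = (2::nat) ^ (2 * half_width c n)"
  interpret layout n "half_width c n" "table_base n" "table_base n + (n + 2 * half_width c n + 1)"
      "win undefined"
    using c by (intro layout_noisy_sort) simp
  have D: "2 * half_width c n \<le> E"
    unfolding E_def using less_exp[of "2 * half_width c n"] by linarith
  have E: "1 \<le> E"
    by (simp add: E_def)
  let ?x2 = "E * (n * n)" and ?x3 = "E * (n * n * n)" and ?x4 = "E * (n * n * n * n)"
  have le: "1 \<le> n * n" "n \<le> n * n" "1 \<le> ?x2" "n \<le> ?x3" "1 \<le> ?x3" "n \<le> ?x4" "1 \<le> ?x4" "E \<le> ?x4"
  proof -
    show "1 \<le> n * n" "n \<le> n * n"
      using n by auto
    then have "n \<le> n * n * n" "n \<le> n * n * n * n"
      using n by (auto simp: le_square)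
    then show "n \<le> ?x3" "n \<le> ?x4" "1 \<le> ?x3" "1 \<le> ?x4" "1 \<le> ?x2" "E \<le> ?x4"
      using n E by (auto simp: Suc_le_eq intro: le_trans)
  qed
  define s1 where "s1 = 2 * (n * (n * 30 + 60) + 10) + 34"
  have "s1 = 60 * (n * n) + 120 * n + 54"
    by (simp add: s1_def algebra_simps)
  then have "s1 \<le> 234 * (n * n)"
    using le(1,2) by linarith
  then have "E * s1 \<le> E * (234 * (n * n))"
    by simp
  then have "E * s1 + 34 \<le> 268 * ?x2"
    using le(3) by linarith
  then have "n * (E * s1 + 34) \<le> n * (268 * ?x2)"
    by (rule mult_le_mono2)
  also have "n * (268 * ?x2) = 268 * ?x3"
    by (simp only: ac_simps)
  finally have "n * (E * s1 + 34) + 10 + (n * 30 + 20) + 40 + 4 \<le> 372 * ?x3"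
    using le(4,5) by linarith
  then have "n * (n * (E * s1 + 34) + 10 + (n * 30 + 20) + 40 + 4) \<le> n * (372 * ?x3)"
    by (rule mult_le_mono2)
  also have "n * (372 * ?x3) = 372 * ?x4"
    by (simp only: ac_simps)
  finally have s4: "n * (n * (E * s1 + 34) + 10 + (n * 30 + 20) + 40 + 4) + n * 20 + 20 \<le> 412 * ?x4"
    using le(6,7) by linarith
  have "time_bound c n \<le> 2 ^ 10 * ?x4"
  proof -
    define Z where "Z = n * (n * (E * s1 + 34) + 10 + (n * 30 + 20) + 40 + 4) + n * 20 + 20"
    define x where "x = ?x4"
    have "time_bound c n = n * 20 + (n + 2 * half_width c n + 1) * 20 + 60 + Z"
      by (simp only: time_bound_def prepare_cost_def sort_cost_def insertion_cost_def E_def s1_def Z_def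
          add.assoc)
    moreover have "Z \<le> 412 * x" "n \<le> x" "1 \<le> x" "E \<le> x"
      using s4 le(6-8) by (simp_all add: Z_def x_def)
    moreover have "(n + 2 * half_width c n + 1) * 20 = n * 20 + (2 * half_width c n) * 20 + 20"
      by simp
    moreover define w where "w = 2 * half_width c n"
    ultimately have "time_bound c n \<le> 1024 * x"
      using D unfolding w_def[symmetric] by linarith
    then show ?thesis
      by (simp add: x_def)
  qed
  also have "\<dots> = 2 ^ 10 * E * n ^ 4"
    by (simp add: power4_eq_xxxx)
  also have "E \<le> n ^ (6 * c)"
  proof -
    have "2 ^ (log2_ceil n + 1) \<le> 2 * 2 * n"
      using exp_log2_ceil_le[of n] n by simp
    also have "\<dots> \<le> n ^ 3"
      using n by (simp add: power3_eq_cube) (metis mult_le_mono mult_2 mult_numeral_1_right numeral_Bit0 numeral_times_numeral)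
    finally have "(2 ^ (log2_ceil n + 1)) ^ (2 * c) \<le> (n ^ 3) ^ (2 * c)"
      by (rule power_mono) simp
    then show ?thesis
      by (simp add: E_def half_width_def power_mult[symmetric] mult.commute mult.left_commute del: power_Suc)
  qed
  also have "(2::nat) ^ 10 \<le> n ^ 10"
    using n by (rule power_mono) simp
  finally have "time_bound c n \<le> n ^ 10 * n ^ (6 * c) * n ^ 4"
    by simp
  then show ?thesis
    by (simp add: power_add[symmetric] ac_simps)
qed

text \<open>The origin of 128: inserting \<open>h\<close> turns \<open>64 * h / lam ^ 2\<close> into
  \<open>128 * (alpha + 6) / lam ^ 4 * ln n\<close>, and \<open>ln n\<close> is at most
  \<open>log2_ceil n\<close>.\<close>

lemma half_width_large:
  assumes lam: "0 < lam" and alpha: "0 < alpha" and n: "2 \<le> n"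
    and c: "128 * (alpha + 6) / lam ^ 4 \<le> real c" "1 \<le> c"
    and h: "h = 2 * (alpha + 6) * ln n / lam\<^sup>2"
  shows "2 * (32 * h / lam\<^sup>2) + 1 \<le> real (half_width c n)"
proof -
  have "ln (real n) \<le> ln (2 ^ log2_ceil n)"
    using n le_exp_log2_ceil[of n] by (simp flip: of_nat_le_iff)
  also have "\<dots> = log2_ceil n * ln 2"
    by (simp add: ln_realpow)
  also have "\<dots> \<le> real (log2_ceil n) * 1"
    using ln_2_less_1 by (intro mult_left_mono) auto
  finally have "128 * (alpha + 6) / lam ^ 4 * ln n \<le> real c * log2_ceil n"
    using c(1) n by (intro mult_mono) auto
  moreover have "2 * (32 * h / lam\<^sup>2) = 128 * (alpha + 6) / lam ^ 4 * ln n"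
    using lam by (simp add: h power2_eq_square power4_eq_xxxx field_simps)
  moreover have "real (half_width c n) = real c * log2_ceil n + real c"
    by (simp add: half_width_def algebra_simps)
  ultimately show ?thesis
    using c(2) by linarith
qed

text \<open>Without coin flips the joint law is the image of the law of the signals, so failure is
  confined to \<open>atypical\<close>.\<close>

lemma noisy_sort_optimal:
  assumes lam: "0 < lam" "lam < 1 / 2" and alpha: "0 < alpha" and n: "2 \<le> n"
    and c: "128 * (alpha + 6) / lam ^ 4 \<le> real c" "1 \<le> c" and \<pi>: "\<pi> permutes {1..n}"
  shows "measure_pmf.prob (run_outcome lam n \<pi> (noisy_sort c) (time_bound c n))
    {(s, \<sigma>). \<not> optimal lam n s \<sigma>} \<le> real n powr (- alpha)"
proof -
  define h where "h = 2 * (alpha + 6) * ln n / lam\<^sup>2"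
  have h: "0 < h"
    using lam alpha n by (simp add: h_def)
  have inj: "inj_on \<pi> {1..n}"
    using permutes_inj_on[OF \<pi>] .
  obtain st ys where run: "\<And>s. run (time_bound c n) (noisy_sort c, input_state n s) = return_pmf (Skip, st s)"
    and ys: "\<And>s. orders (win s) (half_width c n) n (ys s)"
    and out: "\<And>s j. j < n \<Longrightarrow> snd (st s) (ys s ! j) = Suc j"
    using noisy_sort_terminates[of c n] c(2) n by (metis One_nat_def Suc_le_lessD one_le_numeral le_trans)
  note lam' = lam
  have "optimal lam n s (output_perm n (st s))" if "s \<notin> atypical lam h n \<pi>" for s
  proof -
    interpret typical_signals lam h "win s" \<pi> n
      using lam h inj that by (intro typical_signals_compl) auto
    have "best (win s) n (ys s)"
      by (rule orders_best[OF ys order_refl]) (rule half_width_large[OF lam'(1) alpha n c h_def])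
    then show ?thesis
      by (rule best_optimal[OF lam']) (rule out)
  qed
  then have sub: "{s. \<not> optimal lam n s (output_perm n (st s))} \<subseteq> atypical lam h n \<pi>"
    by auto
  have "run_outcome lam n \<pi> (noisy_sort c) (time_bound c n) =
      map_pmf (\<lambda>s. (s, output_perm n (st s))) (signals_pmf lam n \<pi>)"
    by (simp add: run_outcome_def run map_pmf_def bind_return_pmf)
  then have "measure_pmf.prob (run_outcome lam n \<pi> (noisy_sort c) (time_bound c n))
      {(s, \<sigma>). \<not> optimal lam n s \<sigma>} =
      measure_pmf.prob (signals_pmf lam n \<pi>) {s. \<not> optimal lam n s (output_perm n (st s))}"
    by (simp add: measure_map_pmf vimage_def)
  also have "\<dots> \<le> measure_pmf.prob (signals_pmf lam n \<pi>) (atypical lam h n \<pi>)"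
    by (rule measure_pmf.finite_measure_mono[OF sub]) simp
  also have "\<dots> \<le> real n powr (- alpha)"
    by (rule prob_atypical[OF lam n alpha inj h_def])
  finally show ?thesis .
qed

theorem theorem2:
  "\<exists>C :: real. C > 0 \<and> (\<forall>lam alpha :: real. 0 < lam \<and> lam < 1/2 \<and> 0 < alpha \<longrightarrow>
     (\<exists>c :: com. \<forall>n \<ge> 2. \<exists>t :: nat.
        real t \<le> real n powr (C * ((alpha + 1) * (1 / lam ^ 4))) \<and>
        halts_within t c n \<and>
        (\<forall>\<pi>. \<pi> permutes {1..n} \<longrightarrow>
           measure_pmf.prob (run_outcome lam n \<pi> c t) {(s, \<sigma>). \<not> optimal lam n s \<sigma>}
             \<le> real n powr (- alpha))))"
proof (intro exI[of _ "5000::real"] conjI allI impI)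
  fix lam alpha :: real
  assume *: "0 < lam \<and> lam < 1/2 \<and> 0 < alpha"
  let ?A = "(alpha + 1) * (1 / lam ^ 4)" and ?B = "128 * (alpha + 6) / lam ^ 4"
  define c where "c = nat \<lceil>?B\<rceil>"
  have lam4: "0 < lam ^ 4" "lam ^ 4 \<le> 1"
    using * by (auto simp: power_le_one)
  have B: "0 < ?B"
    using * by simp
  have c: "?B \<le> real c" "1 \<le> c" "real c \<le> ?B + 1"
    using B unfolding c_def by linarith+
  have A: "1 \<le> ?A"
    using lam4 * by (simp add: field_simps)
  have "?B \<le> 768 * ?A"
    using lam4 * by (simp add: field_simps)
  \<comment> \<open>\<open>6 * c + 14 <= 4608 * ?A + 20\<close>, and \<open>1 <= ?A\<close> absorbs
    the 20.\<close>
  then have exponent: "real (6 * c + 14) \<le> 5000 * ?A"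
    using c(3) A unfolding of_nat_add of_nat_mult of_nat_numeral by linarith
  show "\<exists>c :: com. \<forall>n \<ge> 2. \<exists>t :: nat.
        real t \<le> real n powr (5000 * ?A) \<and> halts_within t c n \<and>
        (\<forall>\<pi>. \<pi> permutes {1..n} \<longrightarrow>
           measure_pmf.prob (run_outcome lam n \<pi> c t) {(s, \<sigma>). \<not> optimal lam n s \<sigma>}
             \<le> real n powr (- alpha))"
  proof (intro exI[of _ "noisy_sort c"] allI impI, rule exI, intro conjI allI impI)
    fix n :: nat assume n: "2 \<le> n"
    have "real (time_bound c n) \<le> real n ^ (6 * c + 14)"
      using time_bound_le[OF n c(2)] by (simp flip: of_nat_power)
    also have "\<dots> = real n powr real (6 * c + 14)"
      using n by (subst powr_realpow) simp_all
    also have "\<dots> \<le> real n powr (5000 * ?A)"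
      using n exponent by (intro powr_mono) auto
    finally show "real (time_bound c n) \<le> real n powr (5000 * ?A)" .
    show "halts_within (time_bound c n) (noisy_sort c) n"
      unfolding halts_within_def
    proof (intro allI ballI)
      fix s cfg assume "cfg \<in> set_pmf (run (time_bound c n) (noisy_sort c, input_state n s))"
      then show "fst cfg = Skip"
        using noisy_sort_terminates[of c n s] c(2) n by auto
    qed
    fix \<pi> assume "\<pi> permutes {1..n}"
    then show "measure_pmf.prob (run_outcome lam n \<pi> (noisy_sort c) (time_bound c n))
        {(s, \<sigma>). \<not> optimal lam n s \<sigma>} \<le> real n powr (- alpha)"
      using * n c by (intro noisy_sort_optimal) auto
  qed
qed simp

end
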